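(* Let $T$ be a complete continuous theory and $\phi(x,y)$ a formula. The following are equivalent: (i) $\phi(x,y)$ has $NIP$. (ii) For any separable model $M$ of $T$ and saturated elementary extension $M^*$ of it, whenever $p(x)\in S_\phi(M^* )$ is approximately finitely satisfiable in $M$, it is Baire-1/2 definable over $M$. (iii) For any separable model $M$ of $T$ and saturated elementary extension $M^*$ of it, the number of $p(x)\in S_\phi(M^* )$ which are approximately finitely satisfiable in $M$ is $<2^{2^{\aleph_0}}$.
   Context: Continuous first-order logic is that of Ben Yaacov–Berenstein–Henson–Usvyatsov: formulas are $[0,1]$-valued, with value $0$ interpreted as "true". Variables $x,y$ denote finite tuples. $\mathcal U$ is the monster model of $T$. "Saturated" means in particular that all types over $M$ are realized in $M^*$. $\phi(x,y)$ has $IP$ if there are real numbers $r<s$ and a sequence $(a_i:i<\omega)$ in $\mathcal U$ such that for all disjoint finite sets $E,F\subseteq\omega$: $\exists y\big(\bigwedge_{i\in E}\phi(a_i,y)\le r\wedge\bigwedge_{i\in F}\phi(a_i,y)\ge s\big)$ holds in $\mathcal U$. It has $NIP$ if it does not have $IP$. A complete $\phi$-type $p\in S_\phi(M^* )$ is identified with the function $b\mapsto\phi(p,b)\in[0,1]$ on $|y|$-tuples $b$ of $M^*$, where $\phi(p,b)=\phi(a,b)$ for any realization $a$ of $p$ in an elementary extension. It is approximately finitely satisfiable in $M$ if for each $\epsilon>0$ and $b_1,\dots,b_n\in M^*$ there is $a\in M$ with $|\phi(p,b_i)-\phi(a,b_i)|<\epsilon$ for all $i\le n$. Put $\tilde\phi(y,x)=\phi(x,y)$,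 and let $S_{\tilde\phi}(M)$ be the space of complete $\tilde\phi$-types over $M$ (functions $a\mapsto\phi(a,b)$ on $|x|$-tuples of $M$, $b$ in an elementary extension), with the weakest topology making all maps $q\mapsto\phi(a,q)$, $a\in M$, continuous; for $M$ separable it is compact metrizable. If $p$ is approximately finitely satisfiable in $M$, then $\phi(p,b)$ depends only on $q=\mathrm{tp}_{\tilde\phi}(b/M)$, and one writes $\phi(p,q)$ for this value. For a compact metric space $X$: $DBSC(X)$ is the set of real-valued functions $F_1-F_2$ with $F_1,F_2$ bounded semi-continuous on $X$; $f:X\to\mathbb R$ is Baire-1/2 if it is the uniform limit of a sequence from $DBSC(X)$. A type $p\in S_\phi(M^* )$ approximately finitely satisfiable in $M$ is Baire-1/2 definable over $M$ if there is a sequence $(a_n)$ in $M$ such that the functions $\phi(a_n,y)$ on $S_{\tilde\phi}(M)$ converge pointwise to a Baire-1/2 function $f$ with $\phi(p,q)=f(q)$ for all $q\in S_{\tilde\phi}(M)$.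
   Formalization: The language of T is assumed countable; without this the claim fails: for the random graph with uncountably many distinct named constants the edge formula has IP, but T has no separable model, so (ii) and (iii) hold vacuously. *)

theory Defs
  imports "HOL-Analysis.Analysis" "HOL-Library.Equipollence"
begin

section \<open>Continuous first-order logic\<close>

text \<open>
  Syntax and semantics follow Ben Yaacov, Berenstein, Henson and Usvyatsov, \<^emph>\<open>Model theory
  for metric structures\<close>: structures are complete metric spaces of diameter at most 1, predicates
  and formulas take values in [0,1], and the value 0 means ``true''.  A signature carries the
  arities and the moduli of uniform continuity of its symbols; constants are 0-ary functions.
\<close>

record ('f, 'p) msig =
  sig_funs :: "'f set"
  sig_preds :: "'p set"
  fun_ar :: "'f \<Rightarrow> nat"
  pred_ar :: "'p \<Rightarrow> nat"
  fun_mod :: "'f \<Rightarrow> real \<Rightarrow> real"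
  pred_mod :: "'p \<Rightarrow> real \<Rightarrow> real"

definition signature :: "('f, 'p) msig \<Rightarrow> bool" where
  "signature L \<longleftrightarrow>
     (\<forall>f\<in>sig_funs L. \<forall>\<epsilon>\<in>{0<..1}. fun_mod L f \<epsilon> \<in> {0<..1}) \<and>
     (\<forall>P\<in>sig_preds L. \<forall>\<epsilon>\<in>{0<..1}. pred_mod L P \<epsilon> \<in> {0<..1})"

definition countable_signature :: "('f, 'p) msig \<Rightarrow> bool" where
  "countable_signature L \<longleftrightarrow> countable (sig_funs L) \<and> countable (sig_preds L)"

record ('f, 'p, 'u) mstruct =
  carr :: "'u set"
  mdist :: "'u \<Rightarrow> 'u \<Rightarrow> real"
  fun_of :: "'f \<Rightarrow> 'u list \<Rightarrow> 'u"
  pred_of :: "'p \<Rightarrow> 'u list \<Rightarrow> real"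

definition tuples :: "('f, 'p, 'u) mstruct \<Rightarrow> nat \<Rightarrow> 'u list set" where
  "tuples M n = {a. length a = n \<and> set a \<subseteq> carr M}"

text \<open>Tuples carry the maximum metric, which is why the moduli are applied coordinatewise.\<close>

definition tuples_close :: "('f, 'p, 'u) mstruct \<Rightarrow> real \<Rightarrow> 'u list \<Rightarrow> 'u list \<Rightarrow> bool" where
  "tuples_close M \<delta> a b \<longleftrightarrow> (\<forall>i<length a. mdist M (a ! i) (b ! i) < \<delta>)"

definition metric_structure :: "('f, 'p) msig \<Rightarrow> ('f, 'p, 'u) mstruct \<Rightarrow> bool" where
  "metric_structure L M \<longleftrightarrow>
     carr M \<noteq> {} \<and>
     Metric_space (carr M) (mdist M) \<and>
     Metric_space.mcomplete (carr M) (mdist M) \<and>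
     (\<forall>x\<in>carr M. \<forall>y\<in>carr M. mdist M x y \<le> 1) \<and>
     (\<forall>f\<in>sig_funs L. \<forall>a\<in>tuples M (fun_ar L f). fun_of M f a \<in> carr M) \<and>
     (\<forall>f\<in>sig_funs L. \<forall>\<epsilon>\<in>{0<..1}. \<forall>a\<in>tuples M (fun_ar L f). \<forall>b\<in>tuples M (fun_ar L f).
        tuples_close M (fun_mod L f \<epsilon>) a b \<longrightarrow> mdist M (fun_of M f a) (fun_of M f b) \<le> \<epsilon>) \<and>
     (\<forall>P\<in>sig_preds L. \<forall>a\<in>tuples M (pred_ar L P). pred_of M P a \<in> {0..1}) \<and>
     (\<forall>P\<in>sig_preds L. \<forall>\<epsilon>\<in>{0<..1}. \<forall>a\<in>tuples M (pred_ar L P). \<forall>b\<in>tuples M (pred_ar L P).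
        tuples_close M (pred_mod L P \<epsilon>) a b \<longrightarrow> \<bar>pred_of M P a - pred_of M P b\<bar> \<le> \<epsilon>)"

definition separable :: "('f, 'p, 'u) mstruct \<Rightarrow> bool" where
  "separable M \<longleftrightarrow> separable_space (Metric_space.mtopology (carr M) (mdist M))"

datatype 'f trm = Var nat | Fn 'f "'f trm list"

text \<open>In \<open>Conn u \<phi>s\<close> the connective \<open>u\<close> is applied to the values of all the formulas in \<open>\<phi>s\<close>.\<close>

datatype ('f, 'p) fmla =
    Dist "'f trm" "'f trm"
  | Pred 'p "'f trm list"
  | Conn "(nat \<Rightarrow> real) \<Rightarrow> real" "('f, 'p) fmla list"
  | Sup_q nat "('f, 'p) fmla"
  | Inf_q nat "('f, 'p) fmla"

text \<open>The n-cube, with its points padded by zeros to infinite sequences (a homeomorphic copy of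
  it inside the product topology).\<close>

definition unit_cube :: "nat \<Rightarrow> (nat \<Rightarrow> real) set" where
  "unit_cube n = {z. (\<forall>i<n. z i \<in> {0..1}) \<and> (\<forall>i\<ge>n. z i = 0)}"

definition pad :: "real list \<Rightarrow> nat \<Rightarrow> real" where
  "pad rs = (\<lambda>i. if i < length rs then rs ! i else 0)"

definition connective :: "nat \<Rightarrow> ((nat \<Rightarrow> real) \<Rightarrow> real) \<Rightarrow> bool" where
  "connective n u \<longleftrightarrow> continuous_on (unit_cube n) u \<and> u ` unit_cube n \<subseteq> {0..1}"

fun wf_trm :: "('f, 'p) msig \<Rightarrow> 'f trm \<Rightarrow> bool" where
  "wf_trm L (Var v) = True"
| "wf_trm L (Fn f ts) = (f \<in> sig_funs L \<and> length ts = fun_ar L f \<and> (\<forall>t\<in>set ts. wf_trm L t))"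

fun wf_fmla :: "('f, 'p) msig \<Rightarrow> ('f, 'p) fmla \<Rightarrow> bool" where
  "wf_fmla L (Dist s t) = (wf_trm L s \<and> wf_trm L t)"
| "wf_fmla L (Pred P ts) = (P \<in> sig_preds L \<and> length ts = pred_ar L P \<and> (\<forall>t\<in>set ts. wf_trm L t))"
| "wf_fmla L (Conn u \<phi>s) = (connective (length \<phi>s) u \<and> (\<forall>\<phi>\<in>set \<phi>s. wf_fmla L \<phi>))"
| "wf_fmla L (Sup_q v \<phi>) = wf_fmla L \<phi>"
| "wf_fmla L (Inf_q v \<phi>) = wf_fmla L \<phi>"

fun fv_trm :: "'f trm \<Rightarrow> nat set" where
  "fv_trm (Var v) = {v}"
| "fv_trm (Fn f ts) = (\<Union>t\<in>set ts. fv_trm t)"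

fun fv :: "('f, 'p) fmla \<Rightarrow> nat set" where
  "fv (Dist s t) = fv_trm s \<union> fv_trm t"
| "fv (Pred P ts) = (\<Union>t\<in>set ts. fv_trm t)"
| "fv (Conn u \<phi>s) = (\<Union>\<phi>\<in>set \<phi>s. fv \<phi>)"
| "fv (Sup_q v \<phi>) = fv \<phi> - {v}"
| "fv (Inf_q v \<phi>) = fv \<phi> - {v}"

fun trm_val :: "('f, 'p, 'u) mstruct \<Rightarrow> (nat \<Rightarrow> 'u) \<Rightarrow> 'f trm \<Rightarrow> 'u" where
  "trm_val M \<rho> (Var v) = \<rho> v"
| "trm_val M \<rho> (Fn f ts) = fun_of M f (map (\<lambda>t. trm_val M \<rho> t) ts)"

fun val :: "('f, 'p, 'u) mstruct \<Rightarrow> (nat \<Rightarrow> 'u) \<Rightarrow> ('f, 'p) fmla \<Rightarrow> real" where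
  "val M \<rho> (Dist s t) = mdist M (trm_val M \<rho> s) (trm_val M \<rho> t)"
| "val M \<rho> (Pred P ts) = pred_of M P (map (\<lambda>t. trm_val M \<rho> t) ts)"
| "val M \<rho> (Conn u \<phi>s) = u (pad (map (\<lambda>\<phi>. val M \<rho> \<phi>) \<phi>s))"
| "val M \<rho> (Sup_q v \<phi>) = (SUP a\<in>carr M. val M (\<rho>(v := a)) \<phi>)"
| "val M \<rho> (Inf_q v \<phi>) = (INF a\<in>carr M. val M (\<rho>(v := a)) \<phi>)"


section \<open>Theories, elementary maps, saturation\<close>

text \<open>A theory is a set of closed conditions \<open>\<sigma> = 0\<close>, represented by the sentences \<open>\<sigma>\<close>.\<close>

definition sentence :: "('f, 'p) msig \<Rightarrow> ('f, 'p) fmla \<Rightarrow> bool" where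
  "sentence L \<sigma> \<longleftrightarrow> wf_fmla L \<sigma> \<and> fv \<sigma> = {}"

definition theory_of :: "('f, 'p) msig \<Rightarrow> ('f, 'p, 'u) mstruct \<Rightarrow> ('f, 'p) fmla set" where
  "theory_of L M = {\<sigma>. sentence L \<sigma> \<and> (\<forall>\<rho>. val M \<rho> \<sigma> = 0)}"

definition model_of ::
  "('f, 'p) msig \<Rightarrow> ('f, 'p) fmla set \<Rightarrow> ('f, 'p, 'u) mstruct \<Rightarrow> bool" where
  "model_of L T M \<longleftrightarrow> metric_structure L M \<and> (\<forall>\<sigma>\<in>T. \<forall>\<rho>. val M \<rho> \<sigma> = 0)"

text \<open>The complete theories are those of the form Th(M); the type argument only says where the
  carrier of M is sought, as HOL cannot quantify over types.\<close>

definition complete_theory ::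
  "'u itself \<Rightarrow> ('f, 'p) msig \<Rightarrow> ('f, 'p) fmla set \<Rightarrow> bool" where
  "complete_theory _ L T \<longleftrightarrow>
     (\<exists>M :: ('f, 'p, 'u) mstruct. metric_structure L M \<and> T = theory_of L M)"

definition elementary_map ::
  "('f, 'p) msig \<Rightarrow> ('f, 'p, 'u) mstruct \<Rightarrow> 'u set \<Rightarrow> ('f, 'p, 'v) mstruct \<Rightarrow> ('u \<Rightarrow> 'v) \<Rightarrow> bool"
  where
  "elementary_map L M A N g \<longleftrightarrow> A \<subseteq> carr M \<and> g ` A \<subseteq> carr N \<and>
     (\<forall>\<phi> \<rho>. wf_fmla L \<phi> \<and> (\<forall>v\<in>fv \<phi>. \<rho> v \<in> A) \<longrightarrow> val N (g \<circ> \<rho>) \<phi> = val M \<rho> \<phi>)"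

definition elementary_embedding ::
  "('f, 'p) msig \<Rightarrow> ('f, 'p, 'u) mstruct \<Rightarrow> ('f, 'p, 'v) mstruct \<Rightarrow> ('u \<Rightarrow> 'v) \<Rightarrow> bool" where
  "elementary_embedding L M N g \<longleftrightarrow> elementary_map L M (carr M) N g"

text \<open>That \<open>M\<close> is a substructure of \<open>N\<close> is the special case of atomic formulas (for the
  function symbols, of the formulas \<open>d(f(x),y)\<close>).\<close>

definition elementary_extension ::
  "('f, 'p) msig \<Rightarrow> ('f, 'p, 'u) mstruct \<Rightarrow> ('f, 'p, 'u) mstruct \<Rightarrow> bool" where
  "elementary_extension L M N \<longleftrightarrow> metric_structure L N \<and> elementary_embedding L M N id"

definition automorphism ::
  "('f, 'p) msig \<Rightarrow> ('f, 'p, 'u) mstruct \<Rightarrow> ('u \<Rightarrow> 'u) \<Rightarrow> bool" where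
  "automorphism L M g \<longleftrightarrow> bij_betw g (carr M) (carr M) \<and>
     (\<forall>x\<in>carr M. \<forall>y\<in>carr M. mdist M (g x) (g y) = mdist M x y) \<and>
     (\<forall>f\<in>sig_funs L. \<forall>a\<in>tuples M (fun_ar L f). fun_of M f (map g a) = g (fun_of M f a)) \<and>
     (\<forall>P\<in>sig_preds L. \<forall>a\<in>tuples M (pred_ar L P). pred_of M P (map g a) = pred_of M P a)"

text \<open>
  An L(A)-condition in the variables \<open>x\<^sub>0, \<dots>, x\<^bsub>n-1\<^esub>\<close> is a pair \<open>(\<phi>, \<rho>)\<close>: the other free
  variables of \<open>\<phi>\<close> stand for parameters, \<open>\<rho>\<close> being their interpretation in A.  It says that the
  value is 0.
\<close>

definition condition_over ::
  "('f, 'p) msig \<Rightarrow> 'u set \<Rightarrow> nat \<Rightarrow> ('f, 'p) fmla \<times> (nat \<Rightarrow> 'u) \<Rightarrow> bool" where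
  "condition_over L A n = (\<lambda>(\<phi>, \<rho>). wf_fmla L \<phi> \<and> (\<forall>v\<in>fv \<phi>. n \<le> v \<longrightarrow> \<rho> v \<in> A))"

definition satisfies ::
  "('f, 'p, 'u) mstruct \<Rightarrow> 'u list \<Rightarrow> ('f, 'p) fmla \<times> (nat \<Rightarrow> 'u) \<Rightarrow> bool" where
  "satisfies M c = (\<lambda>(\<phi>, \<rho>). val M (\<lambda>v. if v < length c then c ! v else \<rho> v) \<phi> = 0)"

definition saturated_over ::
  "('f, 'p) msig \<Rightarrow> ('f, 'p, 'u) mstruct \<Rightarrow> 'u set \<Rightarrow> bool" where
  "saturated_over L M A \<longleftrightarrow>
     (\<forall>n \<Gamma>. (\<forall>\<gamma>\<in>\<Gamma>. condition_over L A n \<gamma>) \<and>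
        (\<forall>\<Delta>. finite \<Delta> \<and> \<Delta> \<subseteq> \<Gamma> \<longrightarrow> (\<exists>c\<in>tuples M n. \<forall>\<gamma>\<in>\<Delta>. satisfies M c \<gamma>)) \<longrightarrow>
        (\<exists>c\<in>tuples M n. \<forall>\<gamma>\<in>\<Gamma>. satisfies M c \<gamma>))"

text \<open>Cardinals \<open>\<kappa>\<close> are represented by sets of that cardinality.\<close>

definition kappa_saturated ::
  "('f, 'p) msig \<Rightarrow> 'k set \<Rightarrow> ('f, 'p, 'u) mstruct \<Rightarrow> bool" where
  "kappa_saturated L \<kappa> M \<longleftrightarrow> (\<forall>A\<subseteq>carr M. A \<prec> \<kappa> \<longrightarrow> saturated_over L M A)"

definition strongly_homogeneous ::
  "('f, 'p) msig \<Rightarrow> 'k set \<Rightarrow> ('f, 'p, 'u) mstruct \<Rightarrow> bool" where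
  "strongly_homogeneous L \<kappa> M \<longleftrightarrow>
     (\<forall>A g. A \<prec> \<kappa> \<and> elementary_map L M A M g \<longrightarrow>
        (\<exists>h. automorphism L M h \<and> (\<forall>a\<in>A. h a = g a)))"

text \<open>The monster model is \<open>\<kappa>\<close>-saturated and strongly \<open>\<kappa>\<close>-homogeneous for a large \<open>\<kappa>\<close>; here
  ``large'' means that separable structures (which have at most continuum many elements) are
  small.\<close>

definition monster_model ::
  "('f, 'p) msig \<Rightarrow> ('f, 'p) fmla set \<Rightarrow> 'k set \<Rightarrow> ('f, 'p, 'u) mstruct \<Rightarrow> bool" where
  "monster_model L T \<kappa> U \<longleftrightarrow> (UNIV :: nat set set) \<prec> \<kappa> \<and> model_of L T U \<and>
     kappa_saturated L \<kappa> U \<and> strongly_homogeneous L \<kappa> U"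

text \<open>``\<open>Mstar\<close> is a saturated elementary extension of \<open>M\<close>'': it is \<open>|M|\<^sup>+\<close>-saturated.  With
  A = M, all types over \<open>M\<close> are realized in \<open>Mstar\<close>.\<close>

definition saturated_elementary_extension ::
  "('f, 'p) msig \<Rightarrow> ('f, 'p, 'u) mstruct \<Rightarrow> ('f, 'p, 'u) mstruct \<Rightarrow> bool" where
  "saturated_elementary_extension L M Mstar \<longleftrightarrow> elementary_extension L M Mstar \<and>
     (\<forall>A\<subseteq>carr Mstar. A \<lesssim> carr M \<longrightarrow> saturated_over L Mstar A)"


section \<open>NIP and \<open>\<phi>\<close>-types\<close>

text \<open>The tuples of variables x and y of a formula \<open>\<phi>(x,y)\<close> are given by lists \<open>xs\<close>, \<open>ys\<close>.\<close>

definition partitioned_formula ::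
  "('f, 'p) msig \<Rightarrow> ('f, 'p) fmla \<Rightarrow> nat list \<Rightarrow> nat list \<Rightarrow> bool" where
  "partitioned_formula L \<phi> xs ys \<longleftrightarrow>
     wf_fmla L \<phi> \<and> distinct (xs @ ys) \<and> fv \<phi> \<subseteq> set xs \<union> set ys"

text \<open>\<open>pval M \<phi> xs ys a b\<close> is \<open>\<phi>(a,b)\<close> computed in \<open>M\<close>.  Exchanging \<open>xs\<close> and \<open>ys\<close> gives
  the opposite formula \<open>\<phi>\<^sup>~(y,x) = \<phi>(x,y)\<close>, so \<open>\<phi>\<^sup>~\<close>-types are obtained below from \<open>\<phi>\<close>-types by this
  exchange.\<close>

definition pval ::
  "('f, 'p, 'u) mstruct \<Rightarrow> ('f, 'p) fmla \<Rightarrow> nat list \<Rightarrow> nat list \<Rightarrow> 'u list \<Rightarrow> 'u list \<Rightarrow> real" where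
  "pval M \<phi> xs ys a b = val M (\<lambda>v. the (map_of (zip (xs @ ys) (a @ b)) v)) \<phi>"

definition has_IP ::
  "('f, 'p, 'u) mstruct \<Rightarrow> ('f, 'p) fmla \<Rightarrow> nat list \<Rightarrow> nat list \<Rightarrow> bool" where
  "has_IP U \<phi> xs ys \<longleftrightarrow>
     (\<exists>(r::real) s (a :: nat \<Rightarrow> _ list). r < s \<and> (\<forall>i. a i \<in> tuples U (length xs)) \<and>
        (\<forall>E F. finite E \<and> finite F \<and> E \<inter> F = {} \<longrightarrow>
           (\<exists>b\<in>tuples U (length ys).
              (\<forall>i\<in>E. pval U \<phi> xs ys (a i) b \<le> r) \<and> (\<forall>i\<in>F. pval U \<phi> xs ys (a i) b \<ge> s))))"

definition has_NIP ::
  "('f, 'p, 'u) mstruct \<Rightarrow> ('f, 'p) fmla \<Rightarrow> nat list \<Rightarrow> nat list \<Rightarrow> bool" where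
  "has_NIP U \<phi> xs ys \<longleftrightarrow> \<not> has_IP U \<phi> xs ys"

text \<open>
  The \<open>\<phi>\<close>-type over \<open>M\<close> of a tuple \<open>a\<close> of \<open>N\<close>, where \<open>M\<close> is elementarily embedded in \<open>N\<close>
  by \<open>j\<close>, is the function \<open>b \<mapsto> \<phi>(a, j b)\<close> on tuples of \<open>M\<close>.  It is undefined elsewhere, so that
  types are equal as soon as they agree on all tuples of \<open>M\<close>.
\<close>

definition phi_tp ::
  "('f, 'p, 'v) mstruct \<Rightarrow> ('u \<Rightarrow> 'v) \<Rightarrow> ('f, 'p, 'u) mstruct \<Rightarrow> ('f, 'p) fmla \<Rightarrow>
     nat list \<Rightarrow> nat list \<Rightarrow> 'v list \<Rightarrow> 'u list \<Rightarrow> real" where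
  "phi_tp N j M \<phi> xs ys a = (\<lambda>b\<in>tuples M (length ys). pval N \<phi> xs ys a (map j b))"

text \<open>
  The space \<open>S\<^sub>\<phi>(M)\<close>.  The realization lives in an elementary extension of \<open>M\<close>, which may have to
  be larger than the universe \<open>'u\<close> of \<open>M\<close>.  In a countable signature the type \<open>nat \<Rightarrow> 'u\<close> is
  always large enough: by Loewenheim-Skolem every \<open>\<phi>\<close>-type over an infinite \<open>M\<close> is realized in an
  elementary extension of density character at most \<open>|M|\<close>, hence of cardinality at most
  \<open>|M|\<close> to the power \<open>\<aleph>\<^sub>0\<close>, while a finite \<open>M\<close> has no proper elementary extension.
\<close>

definition phi_types ::
  "('f, 'p) msig \<Rightarrow> ('f, 'p, 'u) mstruct \<Rightarrow> ('f, 'p) fmla \<Rightarrow> nat list \<Rightarrow> nat list \<Rightarrow>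
     ('u list \<Rightarrow> real) set" where
  "phi_types L M \<phi> xs ys =
     {p. \<exists>(N :: ('f, 'p, nat \<Rightarrow> 'u) mstruct) j. metric_structure L N \<and> elementary_embedding L M N j \<and>
           (\<exists>a\<in>tuples N (length xs). p = phi_tp N j M \<phi> xs ys a)}"

definition approx_fin_satisfiable ::
  "('f, 'p, 'u) mstruct \<Rightarrow> ('f, 'p, 'u) mstruct \<Rightarrow> ('f, 'p) fmla \<Rightarrow> nat list \<Rightarrow> nat list \<Rightarrow>
     ('u list \<Rightarrow> real) \<Rightarrow> bool" where
  "approx_fin_satisfiable M Mstar \<phi> xs ys p \<longleftrightarrow>
     (\<forall>\<epsilon>>0. \<forall>B. finite B \<and> B \<subseteq> tuples Mstar (length ys) \<longrightarrow>
        (\<exists>a\<in>tuples M (length xs). \<forall>b\<in>B. \<bar>p b - pval Mstar \<phi> xs ys a b\<bar> < \<epsilon>))"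

text \<open>The weakest topology on \<open>S\<^sub>\<phi>(M)\<close> for which all evaluations at tuples of \<open>M\<close> are continuous.\<close>

definition phi_type_space ::
  "('f, 'p) msig \<Rightarrow> ('f, 'p, 'u) mstruct \<Rightarrow> ('f, 'p) fmla \<Rightarrow> nat list \<Rightarrow> nat list \<Rightarrow>
     ('u list \<Rightarrow> real) topology" where
  "phi_type_space L M \<phi> xs ys = topology_generated_by
     {{q \<in> phi_types L M \<phi> xs ys. q b \<in> V} | b V. b \<in> tuples M (length ys) \<and> open V}"

text \<open>\<open>\<phi>(p,q)\<close> for \<open>q\<close> a \<open>\<phi>\<^sup>~\<close>-type over \<open>M\<close>: the common value of \<open>\<phi>(p,b)\<close> at the tuples \<open>b\<close> of
  \<open>Mstar\<close> with \<open>\<phi>\<^sup>~\<close>-type \<open>q\<close> over \<open>M\<close>.  It is meant for \<open>p\<close> approximately finitely satisfiable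
  in \<open>M\<close> and saturated \<open>Mstar\<close>, when it exists and is unique.\<close>

definition type_value ::
  "('f, 'p, 'u) mstruct \<Rightarrow> ('f, 'p, 'u) mstruct \<Rightarrow> ('f, 'p) fmla \<Rightarrow> nat list \<Rightarrow> nat list \<Rightarrow>
     ('u list \<Rightarrow> real) \<Rightarrow> ('u list \<Rightarrow> real) \<Rightarrow> real" where
  "type_value M Mstar \<phi> xs ys p q =
     (THE r. \<exists>b\<in>tuples Mstar (length ys). phi_tp Mstar id M \<phi> ys xs b = q \<and> r = p b)"


section \<open>Baire-1/2 functions and definability\<close>

definition semicontinuous :: "'a topology \<Rightarrow> ('a \<Rightarrow> real) \<Rightarrow> bool" where
  "semicontinuous X F \<longleftrightarrow>
     (\<forall>c. openin X {x\<in>topspace X. F x > c}) \<or> (\<forall>c. openin X {x\<in>topspace X. F x < c})"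

definition DBSC :: "'a topology \<Rightarrow> ('a \<Rightarrow> real) set" where
  "DBSC X = {h. \<exists>F1 F2. semicontinuous X F1 \<and> bounded (F1 ` topspace X) \<and>
     semicontinuous X F2 \<and> bounded (F2 ` topspace X) \<and> (\<forall>x\<in>topspace X. h x = F1 x - F2 x)}"

definition Baire_half :: "'a topology \<Rightarrow> ('a \<Rightarrow> real) \<Rightarrow> bool" where
  "Baire_half X f \<longleftrightarrow>
     (\<exists>h :: nat \<Rightarrow> 'a \<Rightarrow> real. (\<forall>n. h n \<in> DBSC X) \<and> uniform_limit (topspace X) h f sequentially)"

definition Baire_half_definable ::
  "('f, 'p) msig \<Rightarrow> ('f, 'p, 'u) mstruct \<Rightarrow> ('f, 'p, 'u) mstruct \<Rightarrow> ('f, 'p) fmla \<Rightarrow>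
     nat list \<Rightarrow> nat list \<Rightarrow> ('u list \<Rightarrow> real) \<Rightarrow> bool" where
  "Baire_half_definable L M Mstar \<phi> xs ys p \<longleftrightarrow>
     (\<exists>(a :: nat \<Rightarrow> 'u list) f. (\<forall>n. a n \<in> tuples M (length xs)) \<and>
        (\<forall>q\<in>phi_types L M \<phi> ys xs. (\<lambda>n. q (a n)) \<longlonglongrightarrow> f q) \<and>
        Baire_half (phi_type_space L M \<phi> ys xs) f \<and>
        (\<forall>q\<in>phi_types L M \<phi> ys xs. type_value M Mstar \<phi> xs ys p q = f q))"

end

theory Submission
  imports Defs
begin

text \<open>
  Everything turns on finite shattering.  Call \<open>\<phi>\<close> tame in a structure if for all reals \<open>r < s\<close>
  there is a bound on the length of sequences of x-tuples all of whose subsets are cut out, with the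
  gap between \<open>r\<close> and \<open>s\<close>, by y-tuples.  By compactness (\<open>has_IP_of_shattering\<close>) and because
  finite configurations pass between models of a complete theory (\<open>shatters_transfer\<close>), NIP in the
  monster model makes \<open>\<phi>\<close> tame in every model of T (\<open>NIP_no_shattering\<close>).

  From NIP to definability (\<open>definable_of_NIP\<close>).  A type p that is approximately finitely
  satisfiable in a separable M is the limit, along an ultrafilter on a countable dense set of tuples
  of M, of the functions \<open>\<phi>(a,y)\<close>.  Two facts about a tame family of functions and a limit f of it
  are needed.  First, f is the limit of a single sequence of the family, at all points at once
  (\<open>convergent_sequence_of_no_shattering\<close>): the sequence is chosen generic for the ultrafilter, like a
  Morley sequence.  If it failed to converge to f at some point, interleaving it with tuples chosen
  from the ultrafilter would give long generic sequences on which that point alternates between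
  low and high values; in a generic sequence all subsequences of the same length look alike, so that
  all of them admit an alternating point, and this is shattering.  Secondly, f is Baire-1/2
  (\<open>Baire_half_of_no_shattering\<close>): the sets on which f oscillates between r and s, iterated, must
  vanish after finitely many steps, for otherwise f, and with it the family, shatters; finitely many
  closed sets then separate \<open>f \<le> r\<close> from \<open>f \<ge> s\<close> by a difference of two semicontinuous functions,
  and averages of such differences are uniformly close to f.  The first fact is a case of the theorem
  of Bourgain, Fremlin and Talagrand, which the bound on shattering makes elementary.

  From definability to few types (\<open>few_types_of_definable\<close>).  A definable p is determined by a
  sequence in M, and there are only continuum many of these.

  From few types to NIP (\<open>many_types_of_IP\<close>).  Given a sequence that witnesses IP, a separable
  elementary substructure M of the monster model U containing it exists by the Loewenheim-Skolem
  argument; as M has at most continuum many elements, U itself is a saturated extension of M.  Each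
  ultrafilter on the index set gives a type over U as the limit of the sequence along it; the type is
  realized in the metric ultrapower of U and is approximately finitely satisfiable in M.  Saturation separates the sets of indices by tuples of U,
  so that distinct ultrafilters give distinct types; and an independent family provides as many
  ultrafilters as there are sets of sets of natural numbers.
\<close>

section \<open>Ultrafilters\<close>

definition ultrafilter :: "'a filter \<Rightarrow> bool" where
  "ultrafilter D \<longleftrightarrow> D \<noteq> bot \<and> (\<forall>P. eventually P D \<or> eventually (\<lambda>x. \<not> P x) D)"

lemma ultrafilter_not_bot: "ultrafilter D \<Longrightarrow> D \<noteq> bot"
  by (simp add: ultrafilter_def)

lemma ultrafilter_eventually_not:
  "ultrafilter D \<Longrightarrow> eventually (\<lambda>x. \<not> P x) D \<longleftrightarrow> \<not> eventually P D"
proof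
  assume D: "ultrafilter D" and "eventually (\<lambda>x. \<not> P x) D"
  show "\<not> eventually P D"
  proof
    assume "eventually P D"
    with \<open>eventually (\<lambda>x. \<not> P x) D\<close> have "eventually (\<lambda>x. False) D" by eventually_elim simp
    with D show False by (simp add: ultrafilter_def)
  qed
qed (auto simp: ultrafilter_def)

text \<open>Zorn's lemma: the infimum of a chain of proper filters is proper, and a minimal proper filter
  decides every property P, as otherwise adding P gives a smaller one.\<close>

lemma ultrafilter_below:
  assumes "F \<noteq> (bot :: 'a filter)"
  obtains D where "ultrafilter D" "D \<le> F"
proof -
  define A where "A = {G. G \<noteq> bot \<and> G \<le> F}"
  have "\<exists>D\<in>A. \<forall>G\<in>A. D \<ge> G \<longrightarrow> G = D"
  proof (rule predicate_Zorn)
    show "partial_order_on A (relation_of (\<ge>) A)"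
      by (rule partial_order_on_relation_ofI) auto
    fix C assume "C \<in> Chains (relation_of (\<ge>) A)"
    then have C: "C \<subseteq> A" "\<And>a b. a \<in> C \<Longrightarrow> b \<in> C \<Longrightarrow> a \<le> b \<or> b \<le> a"
      by (auto simp: Chains_def relation_of_def)
    show "\<exists>u\<in>A. \<forall>a\<in>C. a \<ge> u"
    proof (cases "C = {}")
      case True
      then show ?thesis using assms by (auto simp: A_def)
    next
      case False
      have ev: "eventually P (Inf C) \<longleftrightarrow> (\<exists>b\<in>C. eventually P b)" for P
      proof (rule eventually_Inf_base[OF False])
        fix G G' assume "G \<in> C" "G' \<in> C"
        with C(2)[OF this] show "\<exists>x\<in>C. x \<le> inf G G'" by auto
      qed
      have "Inf C \<noteq> bot"
        using C(1) ev[of "\<lambda>_. False"] by (auto simp: trivial_limit_def A_def)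
      moreover have "Inf C \<le> F"
      proof -
        obtain G where "G \<in> C" using False by blast
        then show ?thesis using C(1) by (intro Inf_lower2[of G]) (auto simp: A_def)
      qed
      ultimately have "Inf C \<in> A" by (simp add: A_def)
      then show ?thesis by (auto intro!: bexI[of _ "Inf C"] Inf_lower)
    qed
  qed
  then obtain D where D: "D \<in> A" "\<And>G. G \<in> A \<Longrightarrow> G \<le> D \<Longrightarrow> G = D" by blast
  have "eventually P D \<or> eventually (\<lambda>x. \<not> P x) D" for P
  proof (cases "inf D (principal {x. P x}) = bot")
    case True
    then have "eventually (\<lambda>x. \<not> P x) D"
      by (simp add: trivial_limit_def eventually_inf_principal)
    then show ?thesis by simp
  next
    case False
    moreover have "inf D (principal {x. P x}) \<le> F"
      using D(1) by (simp add: A_def le_infI1)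
    ultimately have "inf D (principal {x. P x}) = D"
      by (intro D(2)) (auto simp: A_def)
    then have "D \<le> principal {x. P x}" by (metis inf_le2)
    then have "eventually P D" by (simp add: le_principal)
    then show ?thesis by simp
  qed
  with D(1) that[of D] show ?thesis by (auto simp: ultrafilter_def A_def)
qed

lemma ultrafilter_containing:
  assumes "\<And>\<F>. finite \<F> \<Longrightarrow> \<F> \<subseteq> \<S> \<Longrightarrow> \<Inter>\<F> \<noteq> {}"
  obtains D where "ultrafilter D" "\<And>A. A \<in> \<S> \<Longrightarrow> eventually (\<lambda>x. x \<in> A) D"
proof -
  define F where "F = (INF A\<in>\<S>. principal A)"
  have "F \<noteq> bot"
  proof
    assume "F = bot"
    then have "eventually (\<lambda>_. False) F" by simp
    then obtain X where X: "X \<subseteq> \<S>" "finite X" "eventually (\<lambda>_. False) (INF A\<in>X. principal A)"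
      using eventually_INF[THEN iffD1, of "\<lambda>_. False" principal \<S>] unfolding F_def by blast
    have "(INF A\<in>X. principal A) = principal (\<Inter>X)"
      using X(2) by (simp add: INF_principal_finite)
    moreover obtain x where "x \<in> \<Inter>X" using assms[OF X(2,1)] by blast
    ultimately show False using X(3) by (auto simp: eventually_principal)
  qed
  then obtain D where D: "ultrafilter D" "D \<le> F" by (rule ultrafilter_below)
  have "eventually (\<lambda>x. x \<in> A) D" if "A \<in> \<S>" for A
  proof -
    have "D \<le> principal A" using D(2) that unfolding F_def by (meson INF_lower order_trans)
    then show ?thesis by (simp add: le_principal)
  qed
  with D(1) that show ?thesis by blast
qed

lemma ultrafilter_tendsto_unit:
  assumes "ultrafilter D" and "\<forall>\<^sub>F x in D. (f x :: real) \<in> {0..1}"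
  obtains l where "(f \<longlongrightarrow> l) D" "l \<in> {0..1}"
proof -
  have "compact {0..1::real}" by simp
  moreover have "filtermap f D \<noteq> bot" using assms(1) by (simp add: ultrafilter_def filtermap_bot_iff)
  moreover have "eventually (\<lambda>x. x \<in> {0..1}) (filtermap f D)"
    using assms(2) by (simp add: eventually_filtermap)
  ultimately obtain l where l: "l \<in> {0..1}" "inf (nhds l) (filtermap f D) \<noteq> bot"
    unfolding compact_filter by blast
  have "filtermap f D \<le> nhds l"
  proof (rule filter_leI)
    fix P assume P: "eventually P (nhds l)"
    show "eventually P (filtermap f D)"
    proof (rule ccontr)
      assume "\<not> ?thesis"
      then have "eventually (\<lambda>x. \<not> P x) (filtermap f D)"
        using ultrafilter_eventually_not[OF assms(1), of "\<lambda>x. P (f x)"] by (simp add: eventually_filtermap)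
      with P have "eventually (\<lambda>_. False) (inf (nhds l) (filtermap f D))"
        unfolding eventually_inf by blast
      with l(2) show False by simp
    qed
  qed
  then show ?thesis using that l(1) by (simp add: filterlim_def)
qed

text \<open>This is meaningful only when the limit exists, as it does by compactness for functions with
  values in the unit interval.\<close>

definition ulim :: "'a filter \<Rightarrow> ('a \<Rightarrow> real) \<Rightarrow> real" where
  "ulim D f = (THE l. (f \<longlongrightarrow> l) D)"

lemma ulim_eq: "ultrafilter D \<Longrightarrow> (f \<longlongrightarrow> l) D \<Longrightarrow> ulim D f = l"
  unfolding ulim_def by (rule the_equality) (assumption, rule tendsto_unique[OF ultrafilter_not_bot])

lemma ulim_tendsto:
  assumes "ultrafilter D" and "\<And>x. f x \<in> {0..1}"
  shows "(f \<longlongrightarrow> ulim D f) D" and "ulim D f \<in> {0..1}"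
proof -
  obtain l where l: "(f \<longlongrightarrow> l) D" "l \<in> {0..1}"
    by (rule ultrafilter_tendsto_unit[OF assms(1), of f]) (use assms(2) in auto)
  with ulim_eq[OF assms(1) l(1)] show "(f \<longlongrightarrow> ulim D f) D" "ulim D f \<in> {0..1}" by simp_all
qed

lemma ultrafilter_at_top:
  obtains D :: "nat filter" where "ultrafilter D" "D \<le> sequentially"
  using ultrafilter_below[of sequentially] by auto

lemma distinct_traces:
  assumes "finite \<Z>"
  obtains F :: "nat set" where "finite F" "inj_on (\<lambda>Z. Z \<inter> F) \<Z>"
proof -
  define w where "w Z Z' = (SOME n. (n \<in> Z) \<noteq> (n \<in> Z'))" for Z Z' :: "nat set"
  have w: "(w Z Z' \<in> Z) \<noteq> (w Z Z' \<in> Z')" if "Z \<noteq> Z'" for Z Z'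
  proof -
    have "\<exists>n. (n \<in> Z) \<noteq> (n \<in> Z')" using that by blast
    then show ?thesis unfolding w_def by (rule someI_ex)
  qed
  define F where "F = (\<lambda>(Z, Z'). w Z Z') ` (\<Z> \<times> \<Z>)"
  have "inj_on (\<lambda>Z. Z \<inter> F) \<Z>"
  proof (rule inj_onI, rule ccontr)
    fix Z Z' assume *: "Z \<in> \<Z>" "Z' \<in> \<Z>" "Z \<inter> F = Z' \<inter> F" "Z \<noteq> Z'"
    have "w Z Z' \<in> F" using * by (auto simp: F_def)
    moreover have "(w Z Z' \<in> Z \<inter> F) = (w Z Z' \<in> Z' \<inter> F)" using *(3) by simp
    ultimately show False using w[OF *(4)] by simp
  qed
  moreover have "finite F" using assms by (simp add: F_def)
  ultimately show ?thesis using that by blast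
qed

text \<open>Hausdorff's family of continuum many independent subsets of a countable set.  Its elements are pairs
  of a finite set F and a finite family of subsets of F, coded by lists; such a pair belongs to the
  member given by Z if the trace of Z on F is in the family.  Finitely many sets have distinct traces
  on a large enough F, so that the family can be chosen to contain any of these traces and to omit the
  others.\<close>

definition independent_set :: "nat set \<Rightarrow> (nat list \<times> nat list list) set" where
  "independent_set Z = {(F, \<S>). Z \<inter> set F \<in> set ` set \<S>}"

text \<open>The independent family makes every choice of its members or their complements a filter base,
  and two choices that differ give ultrafilters that are separated by a member of the family.\<close>

lemma ultrafilter_separating_family:
  obtains \<D> :: "nat set set \<Rightarrow> nat filter" where
    "\<And>H. ultrafilter (\<D> H)"
    "\<And>H H'. H \<noteq> H' \<Longrightarrow> \<exists>S. eventually (\<lambda>n. n \<in> S) (\<D> H) \<and> eventually (\<lambda>n. n \<notin> S) (\<D> H')"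
proof -
  define A where "A Z = from_nat -` independent_set Z" for Z
  define \<S> where "\<S> H = (\<lambda>Z. if Z \<in> H then A Z else - A Z) ` UNIV" for H
  have "\<exists>D. ultrafilter D \<and> (\<forall>B\<in>\<S> H. eventually (\<lambda>x. x \<in> B) D)" for H
  proof -
    have fip: "\<Inter>\<F> \<noteq> {}" if \<F>: "finite \<F>" "\<F> \<subseteq> \<S> H" for \<F>
    proof -
      obtain \<Z> where \<Z>: "finite \<Z>" "\<F> = (\<lambda>Z. if Z \<in> H then A Z else - A Z) ` \<Z>"
        using finite_subset_image[OF \<F>(1) \<F>(2)[unfolded \<S>_def]] by blast
      obtain F where F: "finite F" "inj_on (\<lambda>Z. Z \<inter> F) \<Z>" using distinct_traces[OF \<Z>(1)] .
      obtain fl where fl: "set fl = F" using finite_list[OF F(1)] by blast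
      have "finite ((\<lambda>Z. sorted_list_of_set (Z \<inter> F)) ` (\<Z> \<inter> H))" using \<Z>(1) by simp
      then obtain sl where sl: "set sl = (\<lambda>Z. sorted_list_of_set (Z \<inter> F)) ` (\<Z> \<inter> H)"
        using finite_list by blast
      have "set ` set sl = (\<lambda>Z. Z \<inter> F) ` (\<Z> \<inter> H)"
        unfolding sl image_image by (rule image_cong) (use F(1) in auto)
      then have mem: "(fl, sl) \<in> independent_set Z \<longleftrightarrow> Z \<in> H" if "Z \<in> \<Z>" for Z
      proof -
        have "(fl, sl) \<in> independent_set Z \<longleftrightarrow> Z \<inter> F \<in> (\<lambda>Z. Z \<inter> F) ` (\<Z> \<inter> H)"
          by (simp add: independent_set_def fl \<open>set ` set sl = _\<close>)
        also have "\<dots> \<longleftrightarrow> Z \<in> \<Z> \<inter> H"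
          using inj_on_image_mem_iff[OF F(2) that, of "\<Z> \<inter> H"] by simp
        finally show ?thesis using that by simp
      qed
      have "to_nat (fl, sl) \<in> (if Z \<in> H then A Z else - A Z)" if "Z \<in> \<Z>" for Z
        using mem[OF that] by (simp add: A_def)
      then have "to_nat (fl, sl) \<in> \<Inter>\<F>" unfolding \<Z>(2) by (simp only: INT_iff) blast
      then show ?thesis by blast
    qed
    obtain D where "ultrafilter D" "\<And>B. B \<in> \<S> H \<Longrightarrow> eventually (\<lambda>x. x \<in> B) D"
      using ultrafilter_containing[of "\<S> H", OF fip] by blast
    then show ?thesis by blast
  qed
  then have "\<forall>H. \<exists>D. ultrafilter D \<and> (\<forall>B\<in>\<S> H. eventually (\<lambda>x. x \<in> B) D)" by blast
  from choice[OF this] obtain \<D> where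
    \<D>: "\<And>H. ultrafilter (\<D> H)" "\<And>H B. B \<in> \<S> H \<Longrightarrow> eventually (\<lambda>x. x \<in> B) (\<D> H)"
    by blast
  have mem: "(if Z \<in> H then A Z else - A Z) \<in> \<S> H" for Z H by (auto simp: \<S>_def)
  have "\<exists>S. eventually (\<lambda>n. n \<in> S) (\<D> H) \<and> eventually (\<lambda>n. n \<notin> S) (\<D> H')" if "H \<noteq> H'" for H H'
  proof -
    obtain Z where Z: "(Z \<in> H) \<noteq> (Z \<in> H')" using \<open>H \<noteq> H'\<close> by blast
    show ?thesis
    proof (cases "Z \<in> H")
      case True
      then show ?thesis using Z \<D>(2)[OF mem[of Z H]] \<D>(2)[OF mem[of Z H']] by auto
    next
      case False
      then show ?thesis using Z \<D>(2)[OF mem[of Z H]] \<D>(2)[OF mem[of Z H']]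
        by (intro exI[of _ "- A Z"]) auto
    qed
  qed
  with \<D>(1) that show ?thesis by blast
qed

section \<open>Shattering and Baire-1/2 functions\<close>

text \<open>The gap is strict on both sides, so that shattering survives small changes of the values at the
  price of narrowing the gap.\<close>

definition shatters :: "('i \<Rightarrow> 'x \<Rightarrow> real) \<Rightarrow> 'i set \<Rightarrow> 'x set \<Rightarrow> real \<Rightarrow> real \<Rightarrow> nat \<Rightarrow> bool" where
  "shatters \<Phi> I X r s m \<longleftrightarrow> (\<exists>e. (\<forall>k<m. e k \<in> I) \<and>
     (\<forall>J. \<exists>x\<in>X. \<forall>k<m. if k \<in> J then \<Phi> (e k) x < r else s < \<Phi> (e k) x))"

lemma shatters_approx:
  assumes sh: "shatters \<Psi> I Z r s m" and "0 < \<epsilon>"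
    and approx: "\<And>z B. z \<in> Z \<Longrightarrow> finite B \<Longrightarrow> B \<subseteq> I \<Longrightarrow> \<exists>y\<in>Y. \<forall>i\<in>B. \<bar>\<Phi> i y - \<Psi> i z\<bar> < \<epsilon>"
  shows "shatters \<Phi> I Y (r + \<epsilon>) (s - \<epsilon>) m"
proof -
  obtain e where e: "\<And>k. k < m \<Longrightarrow> e k \<in> I"
    "\<And>J. \<exists>z\<in>Z. \<forall>k<m. if k \<in> J then \<Psi> (e k) z < r else s < \<Psi> (e k) z"
    using sh unfolding shatters_def by blast
  have "\<exists>y\<in>Y. \<forall>k<m. if k \<in> J then \<Phi> (e k) y < r + \<epsilon> else s - \<epsilon> < \<Phi> (e k) y" for J
  proof -
    obtain z where z: "z \<in> Z" "\<And>k. k < m \<Longrightarrow> if k \<in> J then \<Psi> (e k) z < r else s < \<Psi> (e k) z" using e(2)[of J] by blast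
    obtain y where y: "y \<in> Y" "\<And>i. i \<in> e ` {..<m} \<Longrightarrow> \<bar>\<Phi> i y - \<Psi> i z\<bar> < \<epsilon>"
      using approx[OF z(1), of "e ` {..<m}"] e(1) by auto
    have "if k \<in> J then \<Phi> (e k) y < r + \<epsilon> else s - \<epsilon> < \<Phi> (e k) y" if "k < m" for k
      using z(2)[OF that] y(2)[of "e k"] that by (auto split: if_splits)
    with y(1) show ?thesis by blast
  qed
  with e(1) show ?thesis unfolding shatters_def by blast
qed

lemma shatters_reindex:
  assumes "shatters (\<lambda>i. \<Phi> (g i)) I' X r s m" and "g ` I' \<subseteq> I"
  shows "shatters \<Phi> I X r s m"
proof -
  obtain e where e: "\<forall>k<m. e k \<in> I'"
    "\<forall>J. \<exists>x\<in>X. \<forall>k<m. if k \<in> J then \<Phi> (g (e k)) x < r else s < \<Phi> (g (e k)) x"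
    using assms(1) unfolding shatters_def by blast
  show ?thesis
    unfolding shatters_def by (intro exI[of _ "\<lambda>k. g (e k)"] conjI e(2)) (use e(1) assms(2) in blast)
qed

text \<open>The iterated derivation of Haydon, Odell and Rosenthal: a point survives a step if, among the
  points left so far, it is a limit both of points with value at most r and of points with value at
  least s.\<close>

fun osc :: "'a topology \<Rightarrow> ('a \<Rightarrow> real) \<Rightarrow> real \<Rightarrow> real \<Rightarrow> nat \<Rightarrow> 'a set" where
  "osc X f r s 0 = topspace X"
| "osc X f r s (Suc m) = X closure_of (osc X f r s m \<inter> {x. f x \<le> r}) \<inter>
                         X closure_of (osc X f r s m \<inter> {x. s \<le> f x})"

lemma closedin_osc: "closedin X (osc X f r s m)"
  by (cases m) auto

lemma closure_osc_subset: "X closure_of (osc X f r s m \<inter> A) \<subseteq> osc X f r s m"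
  by (rule closure_of_minimal[OF Int_lower1 closedin_osc])

text \<open>Every open set that meets the derived set of order m + 1 contains a low and a high point of the
  derived set of order m.  A single function of the family is close to f at finitely many such points;
  it splits each of finitely many open sets into two smaller ones that still meet the derived set of
  order m.  Iterating this from one open set gives a full binary tree, with the same function at all
  nodes of the same level, which is shattering.\<close>

lemma shatters_of_osc:
  fixes X :: "'a topology" and f :: "'a \<Rightarrow> real"
  assumes open_less: "\<And>i c. i \<in> I \<Longrightarrow> openin X {x \<in> topspace X. \<Phi> i x < c}"
    and open_greater: "\<And>i c. i \<in> I \<Longrightarrow> openin X {x \<in> topspace X. c < \<Phi> i x}"
    and approx: "\<And>B \<epsilon>. finite B \<Longrightarrow> B \<subseteq> topspace X \<Longrightarrow> 0 < \<epsilon> \<Longrightarrow> \<exists>i\<in>I. \<forall>x\<in>B. \<bar>f x - \<Phi> i x\<bar> < \<epsilon>"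
    and "r < r'" "s' < s" and "osc X f r s m \<noteq> {}"
  shows "shatters \<Phi> I (topspace X) r' s' m"
proof -
  define Q where "Q m e \<W> \<longleftrightarrow> (\<forall>V\<in>\<W>. \<forall>J. \<exists>x\<in>V. \<forall>k<m. if k \<in> J then \<Phi> (e k) x < r' else s' < \<Phi> (e k) x)"
    for m :: nat and e and \<W> :: "'a set set"
  have "\<exists>e. (\<forall>k<m. e k \<in> I) \<and> Q m e \<W>"
    if "finite \<W>" "\<And>V. V \<in> \<W> \<Longrightarrow> openin X V \<and> V \<inter> osc X f r s m \<noteq> {}" for \<W>
    using that
  proof (induction m arbitrary: \<W>)
    case 0
    then show ?case by (auto simp: Q_def)
  next
    case (Suc m)
    have "\<exists>x y. x \<in> V \<inter> osc X f r s m \<and> y \<in> V \<inter> osc X f r s m \<and> f x \<le> r \<and> s \<le> f y" if V: "V \<in> \<W>" for V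
    proof -
      obtain z where "z \<in> V" "z \<in> osc X f r s (Suc m)" "openin X V" using Suc.prems(2)[OF V] by blast
      then show ?thesis unfolding osc.simps Int_iff in_closure_of by blast
    qed
    then obtain lo hi where lohi: "\<And>V. V \<in> \<W> \<Longrightarrow> lo V \<in> V \<inter> osc X f r s m \<and> hi V \<in> V \<inter> osc X f r s m \<and>
        f (lo V) \<le> r \<and> s \<le> f (hi V)"
      by metis
    have sub: "lo ` \<W> \<union> hi ` \<W> \<subseteq> topspace X"
      using lohi closedin_subset[OF closedin_osc[of X f r s m]] by blast
    obtain i where i: "i \<in> I" "\<And>x. x \<in> lo ` \<W> \<union> hi ` \<W> \<Longrightarrow> \<bar>f x - \<Phi> i x\<bar> < min (r' - r) (s - s')"
      using approx[OF _ sub, of "min (r' - r) (s - s')"] Suc.prems(1) assms(4,5) by auto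
    define lw hw where "lw V = V \<inter> {x \<in> topspace X. \<Phi> i x < r'}" and "hw V = V \<inter> {x \<in> topspace X. s' < \<Phi> i x}" for V
    have "\<exists>e. (\<forall>k<m. e k \<in> I) \<and> Q m e (lw ` \<W> \<union> hw ` \<W>)"
    proof (rule Suc.IH)
      fix W assume "W \<in> lw ` \<W> \<union> hw ` \<W>"
      then obtain V where V: "V \<in> \<W>" "W = lw V \<or> W = hw V" by blast
      have "\<Phi> i (lo V) < r'" "s' < \<Phi> i (hi V)"
        using i(2)[of "lo V"] i(2)[of "hi V"] lohi[OF V(1)] V(1) by auto
      then have "lo V \<in> lw V" "hi V \<in> hw V"
        using lohi[OF V(1)] sub V(1) by (auto simp: lw_def hw_def)
      moreover have "openin X (lw V)" "openin X (hw V)"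
        unfolding lw_def hw_def using Suc.prems(2)[OF V(1)] open_less[OF i(1)] open_greater[OF i(1)] by auto
      ultimately show "openin X W \<and> W \<inter> osc X f r s m \<noteq> {}"
        using V lohi[OF V(1)] by blast
    qed (use Suc.prems in auto)
    then obtain e where e: "\<And>k. k < m \<Longrightarrow> e k \<in> I" "Q m e (lw ` \<W> \<union> hw ` \<W>)" by blast
    have "Q (Suc m) (e(m := i)) \<W>"
      unfolding Q_def
    proof (intro ballI allI)
      fix V J assume V: "V \<in> \<W>"
      obtain x where "x \<in> (if m \<in> J then lw V else hw V)"
          "\<forall>k<m. if k \<in> J then \<Phi> (e k) x < r' else s' < \<Phi> (e k) x"
        using e(2) V unfolding Q_def by (metis UnCI image_eqI)
      then show "\<exists>x\<in>V. \<forall>k<Suc m. if k \<in> J then \<Phi> ((e(m := i)) k) x < r' else s' < \<Phi> ((e(m := i)) k) x"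
        by (intro bexI[of _ x]) (auto simp: lw_def hw_def less_Suc_eq split: if_splits)
    qed
    moreover have "\<forall>k<Suc m. (e(m := i)) k \<in> I" using e(1) i(1) by (auto simp: less_Suc_eq)
    ultimately show ?case by blast
  qed
  from this[of "{topspace X}"] assms(6) closedin_subset[OF closedin_osc[of X f r s m]]
  obtain e where "\<forall>k<m. e k \<in> I" "Q m e {topspace X}" by auto
  then show ?thesis unfolding shatters_def Q_def by blast
qed

text \<open>The indicator of a closed set is upper semicontinuous, and each point has a neighbourhood that
  meets no closed set of the finite family except those that contain the point.\<close>

lemma semicontinuous_sum_indicator:
  assumes "finite K" and "\<And>k. k \<in> K \<Longrightarrow> closedin X (C k)" and "0 \<le> c"
  shows "semicontinuous X (\<lambda>x. c * (\<Sum>k\<in>K. indicator (C k) x :: real))"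
    and "bounded ((\<lambda>x. c * (\<Sum>k\<in>K. indicator (C k) x :: real)) ` S)"
proof -
  let ?F = "\<lambda>x. c * (\<Sum>k\<in>K. indicator (C k) x :: real)"
  have "openin X {x \<in> topspace X. ?F x < d}" for d
  proof (subst openin_subopen, safe)
    fix x assume x: "x \<in> topspace X" "?F x < d"
    define W where "W = topspace X - \<Union>{C k | k. k \<in> K \<and> x \<notin> C k}"
    have "closedin X (\<Union>{C k | k. k \<in> K \<and> x \<notin> C k})"
      using assms(1,2) by (intro closedin_Union) auto
    then have "openin X W" unfolding W_def by (rule openin_diff[OF openin_topspace])
    moreover have "x \<in> W" using x(1) by (auto simp: W_def)
    moreover have "W \<subseteq> {x \<in> topspace X. ?F x < d}"
    proof
      fix y assume y: "y \<in> W"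
      have "?F y \<le> ?F x"
        using y by (intro mult_left_mono sum_mono assms(3)) (auto simp: W_def indicator_def)
      with x y show "y \<in> {x \<in> topspace X. ?F x < d}" by (auto simp: W_def)
    qed
    ultimately show "\<exists>T. openin X T \<and> x \<in> T \<and> T \<subseteq> {x \<in> topspace X. ?F x < d}" by blast
  qed
  then show "semicontinuous X ?F" unfolding semicontinuous_def by blast
  have "\<bar>?F x\<bar> \<le> c * card K" for x
    using sum_bounded_above[of K "\<lambda>k. indicator (C k) x :: real" 1] assms(3)
    by (auto simp: abs_mult sum_nonneg intro!: mult_left_mono)
  then show "bounded (?F ` S)" by (auto intro!: boundedI[of _ "c * card K"])
qed

text \<open>The function h is the indicator of a union of differences of closed sets.  At the step where
  x leaves the decreasing sequence it is in the closure of at most one of the two level sets, and h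
  tells which.  The sum telescopes to the single term of that step because the closures of the level
  sets lie between consecutive derived sets.\<close>

lemma osc_separates:
  assumes "osc X f r s m = {}" and "r < s" and x: "x \<in> topspace X"
  defines "C \<equiv> \<lambda>k. X closure_of (osc X f r s k \<inter> {x. s \<le> f x})"
  defines "h \<equiv> (\<Sum>k<m. indicator (C k) x - indicator (osc X f r s (Suc k)) x) :: real"
  shows "0 \<le> h" "h \<le> 1" "s \<le> f x \<Longrightarrow> h = 1" "f x \<le> r \<Longrightarrow> h = 0"
proof -
  have dec: "osc X f r s (k + d) \<subseteq> osc X f r s k" for k d
  proof (induction d)
    case (Suc d)
    have "osc X f r s (k + Suc d) \<subseteq> osc X f r s (k + d)"
      using closure_osc_subset[of X f r s "k + d" "{x. f x \<le> r}"] by auto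
    with Suc show ?case by blast
  qed simp
  define j where "j = (LEAST k. x \<notin> osc X f r s (Suc k))"
  have ex: "\<exists>k. x \<notin> osc X f r s (Suc k)"
    using assms(1) dec[of m 1] by (intro exI[of _ m]) auto
  have j: "x \<notin> osc X f r s (Suc j)" unfolding j_def using ex by (rule LeastI_ex)
  have in_osc: "x \<in> osc X f r s k" if "k \<le> j" for k
  proof (cases k)
    case (Suc k')
    with that have "k' < (LEAST k. x \<notin> osc X f r s (Suc k))" by (simp add: j_def)
    from not_less_Least[OF this] Suc show ?thesis by simp
  qed (use x in simp)
  have out: "x \<notin> osc X f r s k" if "j < k" for k
    using dec[of "Suc j" "k - Suc j"] that j by auto
  have "j < m" using in_osc[of m] assms(1) by (cases "j < m") auto
  have C1: "x \<in> C k" if "k < j" for k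
    using in_osc[of "Suc k"] that by (auto simp: C_def)
  have C2: "x \<notin> C k" if "j < k" for k
    using out[OF that] closure_osc_subset[of X f r s k "{x. s \<le> f x}"] by (auto simp: C_def)
  have term_eq: "indicator (C k) x - indicator (osc X f r s (Suc k)) x = (if k = j then indicator (C j) x else 0 :: real)" for k
    using C1[of k] C2[of k] in_osc[of "Suc k"] out[of "Suc k"] j by (cases k j rule: linorder_cases) auto
  have h: "h = indicator (C j) x"
    unfolding h_def term_eq using \<open>j < m\<close> by simp
  show "0 \<le> h" "h \<le> 1" by (auto simp: h indicator_def)
  have sub: "osc X f r s j \<inter> A \<subseteq> X closure_of (osc X f r s j \<inter> A)" for A
    using closedin_subset[OF closedin_osc[of X f r s j]] by (intro closure_of_subset) auto
  show "h = 1" if "s \<le> f x"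
  proof -
    have "x \<in> C j" unfolding C_def by (rule subsetD[OF sub]) (use in_osc[of j] that in auto)
    then show ?thesis by (simp add: h)
  qed
  show "h = 0" if "f x \<le> r"
  proof -
    have "x \<in> X closure_of (osc X f r s j \<inter> {x. f x \<le> r})"
      by (rule subsetD[OF sub]) (use in_osc[of j] that in auto)
    with j have "x \<notin> C j" by (simp add: C_def)
    then show ?thesis by (simp add: h)
  qed
qed

theorem Baire_half_of_no_shattering:
  fixes X :: "'a topology" and f :: "'a \<Rightarrow> real"
  assumes open_less: "\<And>i c. i \<in> I \<Longrightarrow> openin X {x \<in> topspace X. \<Phi> i x < c}"
    and open_greater: "\<And>i c. i \<in> I \<Longrightarrow> openin X {x \<in> topspace X. c < \<Phi> i x}"
    and approx: "\<And>B \<epsilon>. finite B \<Longrightarrow> B \<subseteq> topspace X \<Longrightarrow> 0 < \<epsilon> \<Longrightarrow> \<exists>i\<in>I. \<forall>x\<in>B. \<bar>f x - \<Phi> i x\<bar> < \<epsilon>"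
    and range: "\<And>x. x \<in> topspace X \<Longrightarrow> f x \<in> {0..1}"
    and tame: "\<And>r s. r < s \<Longrightarrow> \<exists>m. \<not> shatters \<Phi> I (topspace X) r s m"
  shows "Baire_half X f"
proof -
  have "\<exists>m. osc X f r s m = {}" if rs: "r < s" for r s
  proof -
    define \<delta> where "\<delta> = (s - r) / 3"
    have \<delta>: "0 < \<delta>" "r + \<delta> < s - \<delta>" using rs by (auto simp: \<delta>_def field_simps)
    obtain m where "\<not> shatters \<Phi> I (topspace X) (r + \<delta>) (s - \<delta>) m" using tame[OF \<delta>(2)] by blast
    then have "osc X f r s m = {}"
      using shatters_of_osc[OF open_less open_greater approx, of r "r + \<delta>" "s - \<delta>" s m] \<delta>(1) by auto
    then show ?thesis ..
  qed
  then obtain m where m: "\<And>r s. r < s \<Longrightarrow> osc X f r s (m r s) = {}" by metis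
  define C where "C r s k = X closure_of (osc X f r s k \<inter> {x. s \<le> f x})" for r s k
  \<comment> \<open>The i-th of n thresholds separates the points where f is at most i/n from those where it
    is at least (i+1)/n; the average of the n separating functions is 1/n-close to f.\<close>
  define R where "R n i = real i / real n" for n i :: nat
  define K where "K n = (SIGMA i:{..<n}. {..<m (R n i) (R n (Suc i))})" for n
  define h where "h n x = 1 / real n * (\<Sum>(i, k)\<in>K n. indicator (C (R n i) (R n (Suc i)) k) x)
       - 1 / real n * (\<Sum>(i, k)\<in>K n. indicator (osc X f (R n i) (R n (Suc i)) (Suc k)) x)" for n x
  have finK: "finite (K n)" for n by (simp add: K_def)
  have "h n \<in> DBSC X" for n
  proof -
    have clC: "closedin X (case p of (i, k) \<Rightarrow> C (R n i) (R n (Suc i)) k)" for p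
      by (cases p) (simp add: C_def)
    have clo: "closedin X (case p of (i, k) \<Rightarrow> osc X f (R n i) (R n (Suc i)) (Suc k))" for p
      by (cases p) (simp only: prod.case closedin_osc)
    have n: "0 \<le> 1 / real n" by simp
    show ?thesis
      unfolding DBSC_def mem_Collect_eq
      using semicontinuous_sum_indicator[OF finK[of n] clC n]
        semicontinuous_sum_indicator[OF finK[of n] clo n]
      by (intro exI conjI ballI; (assumption | simp only: h_def split_def))
  qed
  moreover have close: "\<bar>h (Suc n) x - f x\<bar> \<le> 1 / Suc n" if x: "x \<in> topspace X" for n x
  proof -
    let ?n = "Suc n"
    define t where "t i = (\<Sum>k<m (R ?n i) (R ?n (Suc i)). indicator (C (R ?n i) (R ?n (Suc i)) k) x
        - indicator (osc X f (R ?n i) (R ?n (Suc i)) (Suc k)) x :: real)" for i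
    have h: "h ?n x = (\<Sum>i<?n. t i) / ?n"
      unfolding h_def K_def t_def by (simp add: sum.Sigma[symmetric] sum_subtractf diff_divide_distrib)
    have R: "R ?n i < R ?n (Suc i)" for i by (simp add: R_def divide_strict_right_mono)
    note t = osc_separates[OF m[OF R] R x, folded C_def, folded t_def]
    define j where "j = nat \<lfloor>f x * ?n\<rfloor>"
    have fx: "0 \<le> f x" "f x \<le> 1" using range[OF x] by auto
    have j: "real j \<le> f x * ?n" "f x * ?n < real j + 1"
      using fx unfolding j_def by (auto simp: of_nat_nat)
    have "real j \<le> real ?n" using j(1) fx by (smt (verit) mult_left_le_one_le of_nat_0_le_iff mult.commute)
    then have "j \<le> ?n" by simp
    have t1: "t i = 1" if "i < j" for i
    proof (rule t(3))
      show "R ?n (Suc i) \<le> f x" using j(1) that by (simp add: R_def divide_le_eq)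
    qed
    have t0: "t i = 0" if "j < i" for i
    proof (rule t(4))
      show "f x \<le> R ?n i" using j(2) that by (simp add: R_def le_divide_eq)
    qed
    have "(\<Sum>i<?n. t i) \<ge> (\<Sum>i<?n. if i < j then 1 else 0)"
      by (intro sum_mono) (use t1 t(1) in auto)
    moreover have "(\<Sum>i<?n. t i) \<le> (\<Sum>i<?n. if i < Suc j then 1 else 0)"
      by (intro sum_mono) (use t0 t(2) not_less_eq in auto)
    moreover have "(\<Sum>i<?n. if i < j then 1 else 0 :: real) = real j"
    proof -
      have "{..<?n} \<inter> {i. i < j} = {..<j}" using \<open>j \<le> ?n\<close> by auto
      then show ?thesis by (simp add: sum.If_cases del: sum.lessThan_Suc)
    qed
    moreover have "(\<Sum>i<?n. if i < Suc j then 1 else 0 :: real) \<le> real j + 1"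
    proof -
      have "card ({..<?n} \<inter> {i. i < Suc j}) \<le> card {..<Suc j}" by (intro card_mono) auto
      then show ?thesis by (simp add: sum.If_cases del: sum.lessThan_Suc)
    qed
    ultimately have "\<bar>(\<Sum>i<?n. t i) - f x * ?n\<bar> \<le> 1" using j by linarith
    then have "\<bar>((\<Sum>i<?n. t i) - f x * ?n) / ?n\<bar> \<le> 1 / ?n"
      by (simp add: divide_right_mono del: sum.lessThan_Suc)
    then show ?thesis by (simp add: h diff_divide_distrib del: sum.lessThan_Suc)
  qed
  have "uniform_limit (topspace X) (\<lambda>n. h (Suc n)) f sequentially"
  proof (rule uniform_limitI)
    fix e :: real assume "0 < e"
    then have "\<forall>\<^sub>F n in sequentially. 1 / real (Suc n) < e"
      using LIMSEQ_inverse_real_of_nat by (auto simp: inverse_eq_divide dest!: order_tendstoD(2))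
    then show "\<forall>\<^sub>F n in sequentially. \<forall>x\<in>topspace X. dist (h (Suc n) x) (f x) < e"
      by eventually_elim (auto simp: dist_real_def intro: le_less_trans[OF close])
  qed
  ultimately show ?thesis unfolding Baire_half_def by (intro exI[of _ "\<lambda>n. h (Suc n)"]) auto
qed

section \<open>Generic sequences along an ultrafilter\<close>

text \<open>The m-fold iterated quantifier of the ultrafilter: almost all continuations of the list by m
  further elements, chosen one after the other, satisfy P.\<close>

fun generically :: "'a filter \<Rightarrow> ('a list \<Rightarrow> bool) \<Rightarrow> nat \<Rightarrow> 'a list \<Rightarrow> bool" where
  "generically D P 0 es = P es"
| "generically D P (Suc m) es = (\<forall>\<^sub>F x in D. generically D P m (es @ [x]))"

text \<open>Appending x to a list over S does not change the truth value of the iterated quantifier, where N is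
  the final length of the lists.  As an ultrafilter decides every property and S is finite, almost all x
  are generic over S.\<close>

definition generic_over :: "'a filter \<Rightarrow> ('a list \<Rightarrow> bool) \<Rightarrow> nat \<Rightarrow> 'a set \<Rightarrow> 'a \<Rightarrow> bool" where
  "generic_over D P N S x \<longleftrightarrow> (\<forall>es m. set es \<subseteq> S \<and> length es + Suc m = N \<longrightarrow>
     (generically D P m (es @ [x]) \<longleftrightarrow> generically D P (Suc m) es))"

lemma generic_over_mono: "generic_over D P N S x \<Longrightarrow> S' \<subseteq> S \<Longrightarrow> generic_over D P N S' x"
  unfolding generic_over_def by blast

lemma eventually_generic_over:
  assumes "ultrafilter D" and "finite S"
  shows "\<forall>\<^sub>F x in D. generic_over D P N S x"
proof -
  have "\<forall>\<^sub>F x in D. generically D P m (es @ [x]) \<longleftrightarrow> generically D P (Suc m) es" for es m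
  proof (cases "generically D P (Suc m) es")
    case True
    then show ?thesis by simp
  next
    case False
    then have "\<forall>\<^sub>F x in D. \<not> generically D P m (es @ [x])"
      by (simp add: ultrafilter_eventually_not[OF assms(1)])
    with False show ?thesis by (simp del: generically.simps)
  qed
  then have "\<forall>\<^sub>F x in D. \<forall>es\<in>{es. set es \<subseteq> S \<and> length es \<le> N}. \<forall>m\<in>{..N}.
      generically D P m (es @ [x]) \<longleftrightarrow> generically D P (Suc m) es"
    by (intro eventually_ball_finite finite_lists_length_le assms(2) ballI finite_atMost)
  then show ?thesis
    unfolding generic_over_def by eventually_elim auto
qed

text \<open>Along a subsequence of a generic sequence the truth value never changes, so that either all
  subsequences of length N satisfy P or none does.\<close>

lemma generic_subsequence:
  assumes generic: "\<And>i. i < length es \<Longrightarrow> generic_over D P N (set (take i es)) (es ! i)"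
    and "strict_mono_on {..<n} g" and "\<And>i. i < n \<Longrightarrow> g i < length es" and "n \<le> N"
  shows "generically D P (N - n) (map (\<lambda>i. es ! g i) [0..<n]) \<longleftrightarrow> generically D P N []"
  using assms(2-)
proof (induction n)
  case (Suc n)
  let ?l = "map (\<lambda>i. es ! g i) [0..<n]"
  have "set ?l \<subseteq> set (take (g n) es)"
  proof (clarsimp)
    fix i assume "i < n"
    then have "g i < g n" "g n < length es"
      using Suc.prems(1,2) by (auto simp: strict_mono_on_def)
    then show "es ! g i \<in> set (take (g n) es)" by (auto simp: in_set_conv_nth intro!: exI[of _ "g i"])
  qed
  moreover have "length ?l + Suc (N - Suc n) = N" using Suc.prems(3) by simp
  ultimately have "generically D P (N - Suc n) (?l @ [es ! g n]) \<longleftrightarrow> generically D P (Suc (N - Suc n)) ?l"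
    using generic[of "g n"] Suc.prems(2)[of n] unfolding generic_over_def by blast
  moreover have "Suc (N - Suc n) = N - n" using Suc.prems(3) by simp
  moreover have "generically D P (N - n) ?l \<longleftrightarrow> generically D P N []"
    using Suc.prems by (intro Suc.IH) (auto simp: strict_mono_on_def)
  ultimately show ?case by simp
qed simp

definition alternates :: "('i \<Rightarrow> 'y \<Rightarrow> real) \<Rightarrow> 'y set \<Rightarrow> real \<Rightarrow> real \<Rightarrow> 'i list \<Rightarrow> bool" where
  "alternates \<Phi> Y r s es \<longleftrightarrow>
     (\<exists>y\<in>Y. \<forall>i<length es. if even i then \<Phi> (es ! i) y < r else s < \<Phi> (es ! i) y)"

definition approximable :: "('i \<Rightarrow> 'y \<Rightarrow> real) \<Rightarrow> 'y set \<Rightarrow> ('i \<Rightarrow> real) \<Rightarrow> bool" where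
  "approximable \<Phi> Y h \<longleftrightarrow> (\<forall>B \<epsilon>. finite B \<and> 0 < \<epsilon> \<longrightarrow> (\<exists>y\<in>Y. \<forall>i\<in>B. \<bar>h i - \<Phi> i y\<bar> < \<epsilon>))"

lemma finite_gap:
  assumes "finite B" and "\<And>i. i \<in> B \<Longrightarrow> 0 < (g i :: real)"
  obtains \<epsilon> where "0 < \<epsilon>" "\<And>i. i \<in> B \<Longrightarrow> \<epsilon> \<le> g i"
  by (rule that[of "Min (insert 1 (g ` B))"]) (use assms in auto)

text \<open>A generic sequence on which h alternates between low and high has, since h is a limit of points
  of Y, an alternating point for its initial segment; by genericity every subsequence of this length has
  an alternating point.  Choosing subsequences turns alternation into shattering.\<close>

lemma shatters_of_generic_alternation:
  fixes \<Phi> :: "'i \<Rightarrow> 'y \<Rightarrow> real" and h :: "'i \<Rightarrow> real"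
  assumes "approximable \<Phi> Y h"
    and low: "\<And>S. finite S \<Longrightarrow> \<exists>x. generic_over D (alternates \<Phi> Y r s) (2 * m) S x \<and> h x < r"
    and high: "\<And>S. finite S \<Longrightarrow> \<exists>x. generic_over D (alternates \<Phi> Y r s) (2 * m) S x \<and> s < h x"
  shows "shatters \<Phi> UNIV Y r s m"
proof -
  let ?P = "alternates \<Phi> Y r s"
  let ?N = "2 * m"
  have "\<exists>es. length es = n \<and> (\<forall>i<n. generic_over D ?P ?N (set (take i es)) (es ! i)) \<and>
      (\<forall>i<n. if even i then h (es ! i) < r else s < h (es ! i))" for n
  proof (induction n)
    case (Suc n)
    then obtain es where es: "length es = n" "\<forall>i<n. generic_over D ?P ?N (set (take i es)) (es ! i)"
      "\<forall>i<n. if even i then h (es ! i) < r else s < h (es ! i)" by blast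
    obtain x where "generic_over D ?P ?N (set es) x" "if even n then h x < r else s < h x"
      using low[of "set es"] high[of "set es"] by (cases "even n") auto
    with es show ?case
      by (intro exI[of _ "es @ [x]"]) (auto simp: nth_append less_Suc_eq)
  qed simp
  from this[of "3 * m"] obtain es where es: "length es = 3 * m"
    "\<And>i. i < 3 * m \<Longrightarrow> generic_over D ?P ?N (set (take i es)) (es ! i)"
    "\<And>i. i < 3 * m \<Longrightarrow> if even i then h (es ! i) < r else s < h (es ! i)" by blast
  have iff: "?P (map (\<lambda>i. es ! g i) [0..<?N]) \<longleftrightarrow> generically D ?P ?N []"
    if "strict_mono_on {..<?N} g" "\<And>i. i < ?N \<Longrightarrow> g i < 3 * m" for g
    using generic_subsequence[of es D ?P ?N ?N g] es(1,2) that by simp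
  have "?P (map (\<lambda>i. es ! i) [0..<?N])"
  proof -
    define gap where "gap i = (if even i then r - h (es ! i) else h (es ! i) - s)" for i
    obtain \<epsilon> where \<epsilon>: "0 < \<epsilon>" "\<And>i. i \<in> {..<?N} \<Longrightarrow> \<epsilon> \<le> gap i"
      by (rule finite_gap[of "{..<?N}" gap]) (use es(3) in \<open>auto simp: gap_def split: if_splits\<close>)
    obtain y where y: "y \<in> Y" "\<And>i. i \<in> set es \<Longrightarrow> \<bar>h i - \<Phi> i y\<bar> < \<epsilon>"
      using assms(1) \<epsilon>(1) unfolding approximable_def by (meson List.finite_set)
    have "if even i then \<Phi> (es ! i) y < r else s < \<Phi> (es ! i) y" if "i < ?N" for i
      using \<epsilon>(2)[of i] y(2)[of "es ! i"] that es(1) by (auto simp: gap_def abs_less_iff split: if_splits)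
    with y(1) show ?thesis unfolding alternates_def by (intro bexI[of _ y] allI impI) simp_all
  qed
  then have gen: "generically D ?P ?N []" using iff[of "\<lambda>i. i"] by (auto simp: strict_mono_on_def)
  \<comment> \<open>The middle element of each of m consecutive triples is put at an even or an odd position of
    a subsequence by pairing it with its successor or with its predecessor.\<close>
  have "\<exists>y\<in>Y. \<forall>k<m. if k \<in> J then \<Phi> (es ! (3 * k + 1)) y < r else s < \<Phi> (es ! (3 * k + 1)) y" for J
  proof -
    define g where "g i = 3 * (i div 2) + (if i div 2 \<in> J then 1 else 0) + i mod 2" for i :: nat
    have lt: "g i < g j" if "i < j" for i j
    proof (cases "i div 2 = j div 2")
      case True
      with that have "i mod 2 < j mod 2" by (metis div_mult_mod_eq nat_add_left_cancel_less)
      with True show ?thesis by (simp add: g_def)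
    next
      case False
      with that have "i div 2 < j div 2" using div_le_mono[of i j 2] by linarith
      moreover have "g i \<le> 3 * (i div 2) + 2" unfolding g_def using mod_less_divisor[of 2 i] by auto
      moreover have "3 * (j div 2) \<le> g j" by (simp add: g_def)
      ultimately show ?thesis by linarith
    qed
    have "g i < 3 * m" if "i < ?N" for i
    proof -
      have "i div 2 < m" using that by linarith
      moreover have "g i \<le> 3 * (i div 2) + 2" unfolding g_def using mod_less_divisor[of 2 i] by auto
      ultimately show ?thesis by linarith
    qed
    with iff[of g] gen lt have "?P (map (\<lambda>i. es ! g i) [0..<?N])" by (auto simp: strict_mono_on_def)
    then obtain y where "y \<in> Y" and alt: "\<forall>i<length (map (\<lambda>i. es ! g i) [0..<?N]).
        if even i then \<Phi> (map (\<lambda>i. es ! g i) [0..<?N] ! i) y < r else s < \<Phi> (map (\<lambda>i. es ! g i) [0..<?N] ! i) y"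
      unfolding alternates_def by blast
    have y: "if even i then \<Phi> (es ! g i) y < r else s < \<Phi> (es ! g i) y" if "i < ?N" for i
    proof -
      have eq: "map (\<lambda>i. es ! g i) [0..<?N] ! i = es ! g i" using that by simp
      have "i < length (map (\<lambda>i. es ! g i) [0..<?N])" using that by simp
      with alt show ?thesis unfolding eq[symmetric] by blast
    qed
    have "if k \<in> J then \<Phi> (es ! (3 * k + 1)) y < r else s < \<Phi> (es ! (3 * k + 1)) y" if "k < m" for k
      using y[of "2 * k"] y[of "Suc (2 * k)"] that by (auto simp: g_def split: if_splits)
    with \<open>y \<in> Y\<close> show ?thesis by blast
  qed
  then show ?thesis unfolding shatters_def by (intro exI[of _ "\<lambda>k. es ! (3 * k + 1)"]) auto
qed

text \<open>The n-th element is generic over the numbers up to n for alternation between the pairs of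
  rationals numbered up to n, so that the choice does not refer to h.  If the values of h on this sequence stay away from
  its limit l along the ultrafilter, on one side infinitely often, then the sequence supplies the generic
  elements on that side of a rational gap, and the ultrafilter supplies those close to l on the other
  side.\<close>

theorem convergent_sequence_of_no_shattering:
  fixes \<Phi> :: "nat \<Rightarrow> 'y \<Rightarrow> real"
  assumes D: "ultrafilter D" and tame: "\<And>r s. r < s \<Longrightarrow> \<exists>m. \<not> shatters \<Phi> UNIV Y r s m"
  obtains x :: "nat \<Rightarrow> nat" where
    "\<And>h l. approximable \<Phi> Y h \<Longrightarrow> (h \<longlongrightarrow> l) D \<Longrightarrow> (\<lambda>n. h (x n)) \<longlonglongrightarrow> l"
proof -
  define P where "P k = (case from_nat k of (r, s) \<Rightarrow> alternates \<Phi> Y (of_rat r) (of_rat s))" for k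
  have "\<exists>x. \<forall>N\<in>{..n}. \<forall>k\<in>{..n}. generic_over D (P k) N {..n} x" for n
    by (intro eventually_happens'[OF ultrafilter_not_bot[OF D]] eventually_ball_finite ballI
        eventually_generic_over[OF D]) auto
  then obtain x where x: "\<And>n N k. N \<le> n \<Longrightarrow> k \<le> n \<Longrightarrow> generic_over D (P k) N {..n} (x n)"
    by (metis atMost_iff)
  have "(\<lambda>n. h (x n)) \<longlonglongrightarrow> l" if h: "approximable \<Phi> Y h" "(h \<longlongrightarrow> l) D" for h l
  proof -
    have no_alternation: False
      if rs: "r < s" and low: "\<And>N S. finite S \<Longrightarrow> \<exists>x. generic_over D (alternates \<Phi> Y (of_rat r) (of_rat s)) N S x \<and> h x < of_rat r"
        and high: "\<And>N S. finite S \<Longrightarrow> \<exists>x. generic_over D (alternates \<Phi> Y (of_rat r) (of_rat s)) N S x \<and> of_rat s < h x"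
      for r s
      using tame[of "of_rat r" "of_rat s"] shatters_of_generic_alternation[OF h(1) low high] rs
      by (auto simp: of_rat_less)
    have from_D: "\<exists>x. generic_over D Q N S x \<and> R (h x)" if "finite S" "\<forall>\<^sub>F x in D. R (h x)" for Q N S R
      by (rule eventually_happens'[OF ultrafilter_not_bot[OF D]])
        (intro eventually_conj eventually_generic_over[OF D] that)
    have from_x: "\<exists>y. generic_over D (alternates \<Phi> Y (of_rat r) (of_rat s)) N S y \<and> R (h y)"
      if "finite S" and freq: "\<exists>\<^sub>F n in sequentially. R (h (x n))" for r s N S R
    proof -
      obtain b where b: "S \<subseteq> {..b}" using \<open>finite S\<close> by (meson finite_nat_iff_bounded_le)
      define k where "k = to_nat (r, s)"
      obtain n where n: "n \<ge> max b (max N k)" "R (h (x n))"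
        using freq unfolding frequently_sequentially by blast
      have "generic_over D (P k) N {..n} (x n)" using x n(1) by simp
      moreover have "S \<subseteq> {..n}" using b n(1) by auto
      ultimately have "generic_over D (P k) N S (x n)" by (rule generic_over_mono)
      moreover have "P k = alternates \<Phi> Y (of_rat r) (of_rat s)" by (simp add: P_def k_def)
      ultimately show ?thesis using n(2) by auto
    qed
    show ?thesis
    proof (rule order_tendstoI)
      fix a assume "a < l"
      show "\<forall>\<^sub>F n in sequentially. a < h (x n)"
      proof (rule ccontr)
        assume "\<not> ?thesis"
        then have freq: "\<exists>\<^sub>F n in sequentially. h (x n) \<le> a" by (simp add: not_eventually not_less)
        obtain r where r: "a < of_rat r" "of_rat r < l" using of_rat_dense[OF \<open>a < l\<close>] by blast
        obtain s where s: "of_rat r < (of_rat s :: real)" "of_rat s < l" using of_rat_dense[OF r(2)] by blast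
        show False
        proof (rule no_alternation[of r s])
          show "r < s" using s(1) by (simp add: of_rat_less)
          show "\<exists>x. generic_over D (alternates \<Phi> Y (of_rat r) (of_rat s)) N S x \<and> of_rat s < h x"
            if "finite S" for N S using from_D[OF that order_tendstoD(1)[OF h(2) s(2)]] .
          show "\<exists>x. generic_over D (alternates \<Phi> Y (of_rat r) (of_rat s)) N S x \<and> h x < of_rat r"
            if "finite S" for N S
            using from_x[OF that freq, of r s N] r(1) le_less_trans by blast
        qed
      qed
    next
      fix a assume "l < a"
      show "\<forall>\<^sub>F n in sequentially. h (x n) < a"
      proof (rule ccontr)
        assume "\<not> ?thesis"
        then have freq: "\<exists>\<^sub>F n in sequentially. a \<le> h (x n)" by (simp add: not_eventually not_less)
        obtain s where s: "l < of_rat s" "of_rat s < a" using of_rat_dense[OF \<open>l < a\<close>] by blast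
        obtain r where r: "l < of_rat r" "of_rat r < (of_rat s :: real)" using of_rat_dense[OF s(1)] by blast
        show False
        proof (rule no_alternation[of r s])
          show "r < s" using r(2) by (simp add: of_rat_less)
          show "\<exists>x. generic_over D (alternates \<Phi> Y (of_rat r) (of_rat s)) N S x \<and> h x < of_rat r"
            if "finite S" for N S using from_D[OF that order_tendstoD(2)[OF h(2) r(1)]] .
          show "\<exists>x. generic_over D (alternates \<Phi> Y (of_rat r) (of_rat s)) N S x \<and> of_rat s < h x"
            if "finite S" for N S
            using from_x[OF that freq, of r s N] s(2) less_le_trans by blast
        qed
      qed
    qed
  qed
  with that show ?thesis by blast
qed

section \<open>Semantics of formulas\<close>

lemma metric_structureD:
  assumes "metric_structure L M"
  shows "carr M \<noteq> {}" "Metric_space (carr M) (mdist M)"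
    "Metric_space.mcomplete (carr M) (mdist M)"
    "\<And>x y. x \<in> carr M \<Longrightarrow> y \<in> carr M \<Longrightarrow> mdist M x y \<in> {0..1}"
    "\<And>f a. f \<in> sig_funs L \<Longrightarrow> a \<in> tuples M (fun_ar L f) \<Longrightarrow> fun_of M f a \<in> carr M"
    "\<And>f \<epsilon> a b. f \<in> sig_funs L \<Longrightarrow> 0 < \<epsilon> \<Longrightarrow> \<epsilon> \<le> 1 \<Longrightarrow> a \<in> tuples M (fun_ar L f) \<Longrightarrow> b \<in> tuples M (fun_ar L f) \<Longrightarrow>
        tuples_close M (fun_mod L f \<epsilon>) a b \<Longrightarrow> mdist M (fun_of M f a) (fun_of M f b) \<le> \<epsilon>"
    "\<And>P a. P \<in> sig_preds L \<Longrightarrow> a \<in> tuples M (pred_ar L P) \<Longrightarrow> pred_of M P a \<in> {0..1}"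
    "\<And>P \<epsilon> a b. P \<in> sig_preds L \<Longrightarrow> 0 < \<epsilon> \<Longrightarrow> \<epsilon> \<le> 1 \<Longrightarrow> a \<in> tuples M (pred_ar L P) \<Longrightarrow> b \<in> tuples M (pred_ar L P) \<Longrightarrow>
        tuples_close M (pred_mod L P \<epsilon>) a b \<Longrightarrow> \<bar>pred_of M P a - pred_of M P b\<bar> \<le> \<epsilon>"
  using assms unfolding metric_structure_def by (auto simp: Metric_space.nonneg)

lemma trm_val_in_carr:
  assumes "metric_structure L M" and "wf_trm L t" and "\<And>v. v \<in> fv_trm t \<Longrightarrow> \<rho> v \<in> carr M"
  shows "trm_val M \<rho> t \<in> carr M"
  using assms(2,3)
proof (induction t)
  case (Fn f ts)
  have "trm_val M \<rho> t \<in> carr M" if "t \<in> set ts" for t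
    by (rule Fn.IH[OF that]) (use Fn.prems that in auto)
  then show ?case
    using Fn.prems(1) by (auto simp: tuples_def intro!: metric_structureD(5)[OF assms(1)])
qed simp

lemma trm_val_cong: "(\<And>v. v \<in> fv_trm t \<Longrightarrow> \<rho> v = \<rho>' v) \<Longrightarrow> trm_val M \<rho> t = trm_val M \<rho>' t"
proof (induction t)
  case (Fn f ts)
  then have "map (trm_val M \<rho>) ts = map (trm_val M \<rho>') ts" by (intro map_cong) auto
  then show ?case by (simp only: trm_val.simps)
qed simp

lemma val_cong: "(\<And>v. v \<in> fv \<phi> \<Longrightarrow> \<rho> v = \<rho>' v) \<Longrightarrow> val M \<rho> \<phi> = val M \<rho>' \<phi>"
proof (induction \<phi> arbitrary: \<rho> \<rho>')
  case (Dist s t)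
  then show ?case using trm_val_cong[of s \<rho> \<rho>' M] trm_val_cong[of t \<rho> \<rho>' M] by simp
next
  case (Pred P ts)
  then have "map (trm_val M \<rho>) ts = map (trm_val M \<rho>') ts" by (intro map_cong trm_val_cong) auto
  then show ?case by (simp only: val.simps)
next
  case (Conn u \<phi>s)
  have "map (\<lambda>\<phi>. val M \<rho> \<phi>) \<phi>s = map (\<lambda>\<phi>. val M \<rho>' \<phi>) \<phi>s"
    by (intro map_cong refl Conn.IH Conn.prems) auto
  then show ?case by (simp only: val.simps)
next
  case (Sup_q v \<phi>)
  have "val M (\<rho>(v := a)) \<phi> = val M (\<rho>'(v := a)) \<phi>" for a
    by (rule Sup_q.IH) (use Sup_q.prems in auto)
  then show ?case by simp
next
  case (Inf_q v \<phi>)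
  have "val M (\<rho>(v := a)) \<phi> = val M (\<rho>'(v := a)) \<phi>" for a
    by (rule Inf_q.IH) (use Inf_q.prems in auto)
  then show ?case by simp
qed

lemma finite_fv: "finite (fv \<phi>)" for \<phi> :: "('f, 'p) fmla"
proof -
  have fin_trm: "finite (fv_trm t)" for t :: "'f trm" by (induction t) auto
  show ?thesis by (induction \<phi>) (auto simp: fin_trm)
qed

lemma pad_in_unit_cube: "set rs \<subseteq> {0..1} \<Longrightarrow> pad rs \<in> unit_cube (length rs)"
  by (auto simp: pad_def unit_cube_def subset_iff)

lemma cSUP_unit:
  assumes "A \<noteq> {}" "\<And>a. a \<in> A \<Longrightarrow> (f a :: real) \<in> {0..1}"
  shows "(SUP a\<in>A. f a) \<in> {0..1}" "(INF a\<in>A. f a) \<in> {0..1}"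
proof -
  obtain a where a: "a \<in> A" using assms(1) by blast
  have bdd: "bdd_above (f ` A)" "bdd_below (f ` A)" using assms(2) by (auto intro!: bdd_aboveI2 bdd_belowI2)
  have fa: "0 \<le> f a" "f a \<le> 1" using assms(2)[OF a] by auto
  have "0 \<le> (SUP a\<in>A. f a)" using cSUP_upper[OF a bdd(1)] fa by linarith
  moreover have "(SUP a\<in>A. f a) \<le> 1" using assms by (intro cSUP_least) auto
  moreover have "0 \<le> (INF a\<in>A. f a)" using assms by (intro cINF_greatest) auto
  moreover have "(INF a\<in>A. f a) \<le> 1" using cINF_lower[OF bdd(2) a] fa by linarith
  ultimately show "(SUP a\<in>A. f a) \<in> {0..1}" "(INF a\<in>A. f a) \<in> {0..1}" by auto
qed

lemma val_in_unit:
  assumes "metric_structure L M" and "wf_fmla L \<phi>" and "\<And>v. v \<in> fv \<phi> \<Longrightarrow> \<rho> v \<in> carr M"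
  shows "val M \<rho> \<phi> \<in> {0..1}"
  using assms(2,3)
proof (induction \<phi> arbitrary: \<rho>)
  case (Dist s t)
  then show ?case
    using metric_structureD(4)[OF assms(1)] trm_val_in_carr[OF assms(1)] by auto
next
  case (Pred P ts)
  then have "map (trm_val M \<rho>) ts \<in> tuples M (pred_ar L P)"
    by (auto simp: tuples_def intro!: trm_val_in_carr[OF assms(1)])
  then show ?case using metric_structureD(7)[OF assms(1)] Pred.prems(1) by simp
next
  case (Conn u \<phi>s)
  have "set (map (\<lambda>\<phi>. val M \<rho> \<phi>) \<phi>s) \<subseteq> {0..1}"
    using Conn by (auto simp del: atLeastAtMost_iff)
  from pad_in_unit_cube[OF this] show ?case
    using Conn.prems(1) by (auto simp: connective_def simp del: atLeastAtMost_iff)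
next
  case (Sup_q v \<phi>)
  show ?case unfolding val.simps
    by (rule cSUP_unit[OF metric_structureD(1)[OF assms(1)]], rule Sup_q.IH) (use Sup_q.prems in auto)
next
  case (Inf_q v \<phi>)
  show ?case unfolding val.simps
    by (rule cSUP_unit[OF metric_structureD(1)[OF assms(1)]], rule Inf_q.IH) (use Inf_q.prems in auto)
qed

lemma bdd_val:
  assumes "metric_structure L M" and "wf_fmla L \<phi>" and "\<And>w. w \<in> fv \<phi> - {v} \<Longrightarrow> \<rho> w \<in> carr M"
  shows "bdd_above ((\<lambda>a. val M (\<rho>(v := a)) \<phi>) ` carr M)" "bdd_below ((\<lambda>a. val M (\<rho>(v := a)) \<phi>) ` carr M)"
proof -
  have "val M (\<rho>(v := a)) \<phi> \<in> {0..1}" if "a \<in> carr M" for a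
    using that assms(3) by (intro val_in_unit[OF assms(1,2)]) auto
  then show "bdd_above ((\<lambda>a. val M (\<rho>(v := a)) \<phi>) ` carr M)" "bdd_below ((\<lambda>a. val M (\<rho>(v := a)) \<phi>) ` carr M)"
    by (auto intro!: bdd_aboveI2 bdd_belowI2)
qed

lemma continuous_on_coord: "continuous_on S (\<lambda>z :: nat \<Rightarrow> real. z i)"
  by (rule continuous_on_subset[OF continuous_on_product_coordinates]) simp

definition neg_fmla :: "('f, 'p) fmla \<Rightarrow> ('f, 'p) fmla" where
  "neg_fmla \<phi> = Conn (\<lambda>z. 1 - z 0) [\<phi>]"

lemma wf_neg [simp]: "wf_fmla L (neg_fmla \<phi>) = wf_fmla L \<phi>"
  by (auto simp: neg_fmla_def connective_def unit_cube_def intro!: continuous_intros continuous_on_coord)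

lemma fv_neg [simp]: "fv (neg_fmla \<phi>) = fv \<phi>"
  by (simp add: neg_fmla_def)

lemma val_neg [simp]: "val M \<rho> (neg_fmla \<phi>) = 1 - val M \<rho> \<phi>"
  by (simp add: neg_fmla_def pad_def)

lemma val_Inf_neg:
  assumes M: "metric_structure L M" and \<phi>: "wf_fmla L \<phi>" and \<rho>: "\<And>w. w \<in> fv \<phi> - {v} \<Longrightarrow> \<rho> w \<in> carr M"
  shows "val M \<rho> (Inf_q v \<phi>) = val M \<rho> (neg_fmla (Sup_q v (neg_fmla \<phi>)))"
proof -
  note ne = metric_structureD(1)[OF M]
  let ?f = "\<lambda>a. val M (\<rho>(v := a)) \<phi>"
  have up: "1 - ?f a \<le> (SUP a\<in>carr M. 1 - ?f a)" if "a \<in> carr M" for a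
    using cSUP_upper[OF that bdd_val(1)[OF M, of "neg_fmla \<phi>" v \<rho>]] \<phi> \<rho> by simp
  have low: "(INF a\<in>carr M. ?f a) \<le> ?f a" if "a \<in> carr M" for a
    using cINF_lower[OF bdd_val(2)[OF M \<phi> \<rho>] that] .
  have "(SUP a\<in>carr M. 1 - ?f a) \<le> 1 - (INF a\<in>carr M. ?f a)"
    by (rule cSUP_least[OF ne]) (use low in force)
  moreover have "1 - (SUP a\<in>carr M. 1 - ?f a) \<le> (INF a\<in>carr M. ?f a)"
    by (rule cINF_greatest[OF ne]) (use up in force)
  ultimately show ?thesis by simp
qed

text \<open>An infimum is the negation of a supremum of negations, so that inductions on formulas need
  an argument for suprema only.\<close>

lemma fmla_induct_Sup [case_names Dist Pred Conn Sup_q Inf_q]: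
  assumes dist: "\<And>s t. Q (Dist s t)" and pred: "\<And>P ts. Q (Pred P ts)"
    and conn: "\<And>u \<phi>s. (\<And>\<phi>. \<phi> \<in> set \<phi>s \<Longrightarrow> Q \<phi>) \<Longrightarrow> Q (Conn u \<phi>s)"
    and sup: "\<And>v \<phi>. Q \<phi> \<Longrightarrow> Q (Sup_q v \<phi>)"
    and inf: "\<And>v \<phi>. Q (neg_fmla (Sup_q v (neg_fmla \<phi>))) \<Longrightarrow> Q (Inf_q v \<phi>)"
  shows "Q \<phi>"
proof (induction \<phi>)
  case (Inf_q v \<phi>)
  then have "Q (neg_fmla (Sup_q v (neg_fmla \<phi>)))"
    unfolding neg_fmla_def by (auto intro!: conn sup)
  then show ?case by (rule inf)
qed (rule assms; assumption)+

text \<open>Bound variables are renamed as well, so that an injective renaming cannot capture.\<close>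

fun ren_trm :: "(nat \<Rightarrow> nat) \<Rightarrow> 'f trm \<Rightarrow> 'f trm" where
  "ren_trm \<sigma> (Var v) = Var (\<sigma> v)"
| "ren_trm \<sigma> (Fn f ts) = Fn f (map (ren_trm \<sigma>) ts)"

fun ren :: "(nat \<Rightarrow> nat) \<Rightarrow> ('f, 'p) fmla \<Rightarrow> ('f, 'p) fmla" where
  "ren \<sigma> (Dist s t) = Dist (ren_trm \<sigma> s) (ren_trm \<sigma> t)"
| "ren \<sigma> (Pred P ts) = Pred P (map (ren_trm \<sigma>) ts)"
| "ren \<sigma> (Conn u \<phi>s) = Conn u (map (ren \<sigma>) \<phi>s)"
| "ren \<sigma> (Sup_q v \<phi>) = Sup_q (\<sigma> v) (ren \<sigma> \<phi>)"
| "ren \<sigma> (Inf_q v \<phi>) = Inf_q (\<sigma> v) (ren \<sigma> \<phi>)"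

lemma trm_val_ren: "trm_val M \<rho> (ren_trm \<sigma> t) = trm_val M (\<rho> \<circ> \<sigma>) t"
  by (induction t) (auto simp: o_def cong: map_cong)

lemma wf_ren_trm: "wf_trm L (ren_trm \<sigma> t) = wf_trm L t"
  by (induction t) auto

lemma fv_ren_trm: "fv_trm (ren_trm \<sigma> t) = \<sigma> ` fv_trm t"
  by (induction t) auto

lemma val_ren: "inj \<sigma> \<Longrightarrow> val M \<rho> (ren \<sigma> \<phi>) = val M (\<rho> \<circ> \<sigma>) \<phi>"
proof (induction \<phi> arbitrary: \<rho>)
  case (Conn u \<phi>s)
  then show ?case by (simp add: o_def cong: map_cong)
next
  case (Sup_q v \<phi>)
  have "\<rho>(\<sigma> v := a) \<circ> \<sigma> = (\<rho> \<circ> \<sigma>)(v := a)" for a using Sup_q.prems by (auto simp: fun_eq_iff inj_eq)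
  then show ?case unfolding ren.simps val.simps Sup_q.IH[OF Sup_q.prems] by (simp only:)
next
  case (Inf_q v \<phi>)
  have "\<rho>(\<sigma> v := a) \<circ> \<sigma> = (\<rho> \<circ> \<sigma>)(v := a)" for a using Inf_q.prems by (auto simp: fun_eq_iff inj_eq)
  then show ?case unfolding ren.simps val.simps Inf_q.IH[OF Inf_q.prems] by (simp only:)
qed (auto simp: trm_val_ren o_def cong: map_cong)

lemma wf_ren: "wf_fmla L (ren \<sigma> \<phi>) = wf_fmla L \<phi>"
  by (induction \<phi>) (auto simp: wf_ren_trm)

lemma fv_ren: "inj \<sigma> \<Longrightarrow> fv (ren \<sigma> \<phi>) = \<sigma> ` fv \<phi>"
  by (induction \<phi>) (auto simp: fv_ren_trm image_iff inj_eq)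

text \<open>An infimum below c is witnessed by a value below c, one variable at a time.\<close>

lemma val_Inf_list:
  assumes M: "metric_structure L M" and wf: "wf_fmla L \<psi>" and "\<And>v. v \<in> fv \<psi> - set vs \<Longrightarrow> \<rho> v \<in> carr M"
  shows "val M \<rho> (foldr Inf_q vs \<psi>) < c \<longleftrightarrow>
    (\<exists>\<rho>'. (\<forall>v. v \<notin> set vs \<longrightarrow> \<rho>' v = \<rho> v) \<and> (\<forall>v\<in>set vs. \<rho>' v \<in> carr M) \<and> val M \<rho>' \<psi> < c)"
  using assms(3)
proof (induction vs arbitrary: \<rho>)
  case Nil
  have "\<rho>' = \<rho>" if "\<forall>v. \<rho>' v = \<rho> v" for \<rho>' using that by blast
  then show ?case by auto
next
  case (Cons a vs)
  have wf': "wf_fmla L (foldr Inf_q vs \<psi>)" using wf by (induction vs) auto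
  have fv': "fv (foldr Inf_q vs \<psi>) = fv \<psi> - set vs" by (induction vs) auto
  have IH: "val M (\<rho>(a := x)) (foldr Inf_q vs \<psi>) < c \<longleftrightarrow> (\<exists>\<rho>'. (\<forall>v. v \<notin> set vs \<longrightarrow> \<rho>' v = (\<rho>(a := x)) v) \<and>
      (\<forall>v\<in>set vs. \<rho>' v \<in> carr M) \<and> val M \<rho>' \<psi> < c)" if "x \<in> carr M" for x
    by (rule Cons.IH) (use that Cons.prems in auto)
  have "val M \<rho> (foldr Inf_q (a # vs) \<psi>) < c \<longleftrightarrow>
      (\<exists>x\<in>carr M. val M (\<rho>(a := x)) (foldr Inf_q vs \<psi>) < c)"
    unfolding foldr_Cons o_def val.simps
    by (intro cINF_less_iff metric_structureD(1)[OF M] bdd_val[OF M wf']) (use Cons.prems fv' in auto)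
  also have "\<dots> \<longleftrightarrow> (\<exists>\<rho>'. (\<forall>v. v \<notin> set (a # vs) \<longrightarrow> \<rho>' v = \<rho> v) \<and>
      (\<forall>v\<in>set (a # vs). \<rho>' v \<in> carr M) \<and> val M \<rho>' \<psi> < c)"
  proof
    assume "\<exists>x\<in>carr M. val M (\<rho>(a := x)) (foldr Inf_q vs \<psi>) < c"
    then obtain x \<rho>' where "x \<in> carr M" "\<forall>v. v \<notin> set vs \<longrightarrow> \<rho>' v = (\<rho>(a := x)) v"
      "\<forall>v\<in>set vs. \<rho>' v \<in> carr M" "val M \<rho>' \<psi> < c" using IH by blast
    then show "\<exists>\<rho>'. (\<forall>v. v \<notin> set (a # vs) \<longrightarrow> \<rho>' v = \<rho> v) \<and>
      (\<forall>v\<in>set (a # vs). \<rho>' v \<in> carr M) \<and> val M \<rho>' \<psi> < c"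
      by (intro exI[of _ \<rho>']) (auto split: if_splits)
  next
    assume "\<exists>\<rho>'. (\<forall>v. v \<notin> set (a # vs) \<longrightarrow> \<rho>' v = \<rho> v) \<and>
      (\<forall>v\<in>set (a # vs). \<rho>' v \<in> carr M) \<and> val M \<rho>' \<psi> < c"
    then obtain \<rho>' where \<rho>': "\<forall>v. v \<notin> set (a # vs) \<longrightarrow> \<rho>' v = \<rho> v"
      "\<forall>v\<in>set (a # vs). \<rho>' v \<in> carr M" "val M \<rho>' \<psi> < c" by blast
    then have "val M (\<rho>(a := \<rho>' a)) (foldr Inf_q vs \<psi>) < c"
      by (subst IH) (auto intro!: exI[of _ \<rho>'])
    then show "\<exists>x\<in>carr M. val M (\<rho>(a := x)) (foldr Inf_q vs \<psi>) < c" using \<rho>'(2) by auto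
  qed
  finally show ?case .
qed

text \<open>The value 0 of this formula says that the given formulas take the given values.\<close>

definition near_fmla :: "('f, 'p) fmla list \<Rightarrow> real list \<Rightarrow> ('f, 'p) fmla" where
  "near_fmla \<psi>s ts = Conn (\<lambda>z. min 1 (\<Sum>j<length ts. \<bar>z j - ts ! j\<bar>)) \<psi>s"

lemma wf_near: "(\<And>\<psi>. \<psi> \<in> set \<psi>s \<Longrightarrow> wf_fmla L \<psi>) \<Longrightarrow> wf_fmla L (near_fmla \<psi>s ts)"
  unfolding near_fmla_def
  by (auto simp: connective_def sum_nonneg intro!: continuous_intros continuous_on_coord)

lemma fv_near [simp]: "fv (near_fmla \<psi>s ts) = (\<Union>\<psi>\<in>set \<psi>s. fv \<psi>)"
  by (simp add: near_fmla_def)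

lemma val_near_self: "val M \<rho> (near_fmla \<psi>s (map (val M \<rho>) \<psi>s)) = 0"
  unfolding near_fmla_def by (auto simp: pad_def intro: sum.neutral)

lemma val_near_less:
  assumes "val M \<rho> (near_fmla \<psi>s (map t \<psi>s)) < \<epsilon>" and "\<epsilon> \<le> 1" and "\<psi> \<in> set \<psi>s"
  shows "\<bar>val M \<rho> \<psi> - t \<psi>\<bar> < \<epsilon>"
proof -
  obtain j where j: "j < length \<psi>s" "\<psi> = \<psi>s ! j" using assms(3) by (metis in_set_conv_nth)
  have "\<bar>pad (map (val M \<rho>) \<psi>s) j - map t \<psi>s ! j\<bar> \<le> (\<Sum>j<length \<psi>s. \<bar>pad (map (val M \<rho>) \<psi>s) j - map t \<psi>s ! j\<bar>)"
    by (rule member_le_sum) (use j in auto)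
  moreover have "(\<Sum>j<length \<psi>s. \<bar>pad (map (val M \<rho>) \<psi>s) j - map t \<psi>s ! j\<bar>) < \<epsilon>"
    using assms(1,2) by (simp add: near_fmla_def)
  ultimately show ?thesis using j by (simp add: pad_def)
qed

text \<open>
  The infimum, over the variables outside P, of the distance to the given values is a formula in the
  parameters.  So it is zero in N as it is in M, and is approximately attained.
\<close>

lemma approx_transfer:
  assumes M: "metric_structure L M" and N: "metric_structure L N"
    and agree: "\<And>\<theta>. wf_fmla L \<theta> \<Longrightarrow> fv \<theta> \<subseteq> P \<Longrightarrow> val N \<rho>N \<theta> = val M \<rho> \<theta>"
    and wf: "\<And>\<psi>. \<psi> \<in> set \<psi>s \<Longrightarrow> wf_fmla L \<psi>"
    and \<rho>: "\<And>v. \<rho> v \<in> carr M" and \<rho>N: "\<And>v. v \<in> P \<Longrightarrow> \<rho>N v \<in> carr N" and "0 < \<epsilon>"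
  obtains \<rho>' where "\<And>v. v \<in> P \<Longrightarrow> \<rho>' v = \<rho>N v" "\<And>v. \<rho>' v \<in> carr N"
    "\<And>\<psi>. \<psi> \<in> set \<psi>s \<Longrightarrow> \<bar>val N \<rho>' \<psi> - val M \<rho> \<psi>\<bar> < \<epsilon>"
proof -
  define \<theta> where "\<theta> = near_fmla \<psi>s (map (val M \<rho>) \<psi>s)"
  have wf\<theta>: "wf_fmla L \<theta>" unfolding \<theta>_def by (rule wf_near) (use wf in auto)
  have "finite (fv \<theta> - P)" by (simp add: finite_fv del: fv_near)
  then obtain vs where vs: "set vs = fv \<theta> - P" using finite_list by blast
  have wfI: "wf_fmla L (foldr Inf_q vs \<theta>)" using wf\<theta> by (induction vs) auto
  have "fv (foldr Inf_q vs \<theta>) = fv \<theta> - set vs" by (induction vs) auto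
  then have fvI: "fv (foldr Inf_q vs \<theta>) \<subseteq> P" using vs by auto
  have "val M \<rho> (foldr Inf_q vs \<theta>) < min 1 \<epsilon>"
    using \<rho> \<open>0 < \<epsilon>\<close> val_near_self[of M \<rho> \<psi>s]
    by (subst val_Inf_list[OF M wf\<theta>]) (auto simp: \<theta>_def intro!: exI[of _ \<rho>])
  then have "val N \<rho>N (foldr Inf_q vs \<theta>) < min 1 \<epsilon>" by (simp add: agree[OF wfI fvI])
  moreover have "\<rho>N v \<in> carr N" if "v \<in> fv \<theta> - set vs" for v using that vs \<rho>N by blast
  ultimately obtain \<rho>' where
    \<rho>': "\<forall>v. v \<notin> set vs \<longrightarrow> \<rho>' v = \<rho>N v" "\<forall>v\<in>set vs. \<rho>' v \<in> carr N" "val N \<rho>' \<theta> < min 1 \<epsilon>"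
    using val_Inf_list[OF N wf\<theta>, of vs \<rho>N] by blast
  obtain a where a: "a \<in> carr N" using metric_structureD(1)[OF N] by blast
  define \<rho>'' where "\<rho>'' v = (if v \<in> fv \<theta> \<union> P then \<rho>' v else a)" for v
  have "val N \<rho>'' \<psi> = val N \<rho>' \<psi>" if "\<psi> \<in> set \<psi>s" for \<psi>
    by (rule val_cong) (use that in \<open>auto simp: \<rho>''_def \<theta>_def\<close>)
  moreover have "\<bar>val N \<rho>' \<psi> - val M \<rho> \<psi>\<bar> < \<epsilon>" if "\<psi> \<in> set \<psi>s" for \<psi>
    using val_near_less[OF \<rho>'(3)[unfolded \<theta>_def] _ that] by simp
  ultimately show ?thesis using \<rho>' a vs \<rho>N by (intro that[of \<rho>'']) (auto simp: \<rho>''_def)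
qed

text \<open>A complete theory determines the value c of each sentence, through the condition that the distance
  of the value to c is zero.\<close>

lemma complete_theory_agree:
  fixes M :: "('f, 'p, 'u) mstruct" and N :: "('f, 'p, 'v) mstruct"
  assumes T: "complete_theory TYPE('w) L T" and M: "model_of L T M" and N: "model_of L T N"
    and \<sigma>: "wf_fmla L \<sigma>" "fv \<sigma> = {}"
  shows "val N \<rho>' \<sigma> = val M \<rho> \<sigma>"
proof -
  obtain K :: "('f, 'p, 'w) mstruct" where K: "metric_structure L K" "T = theory_of L K"
    using T unfolding complete_theory_def by blast
  define \<tau> where "\<tau> = near_fmla [\<sigma>] [val K undefined \<sigma>]"
  have const: "val K \<rho> \<sigma> = val K undefined \<sigma>" for \<rho> by (rule val_cong) (simp add: \<sigma>)
  have "val K \<rho> \<tau> = 0" for \<rho>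
    using val_near_self[of K \<rho> "[\<sigma>]"] by (simp add: \<tau>_def const[of \<rho>])
  moreover have "sentence L \<tau>" unfolding sentence_def \<tau>_def using \<sigma> wf_near[of "[\<sigma>]" L] by simp
  ultimately have "\<tau> \<in> T" by (simp add: K theory_of_def)
  then have eq: "val M \<rho> \<tau> = 0" "val N \<rho>' \<tau> = 0" using M N by (auto simp: model_of_def)
  have small: "\<bar>val A \<rho> \<sigma> - val K undefined \<sigma>\<bar> \<le> 0" if "val A \<rho> \<tau> = 0" for A :: "('f, 'p, 'x) mstruct" and \<rho>
  proof (rule field_le_epsilon)
    fix e :: real assume "0 < e"
    then have "\<bar>val A \<rho> \<sigma> - val K undefined \<sigma>\<bar> < min 1 e"
      using that by (intro val_near_less[of A \<rho> "[\<sigma>]" "\<lambda>_. val K undefined \<sigma>"]) (auto simp: \<tau>_def)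
    then show "\<bar>val A \<rho> \<sigma> - val K undefined \<sigma>\<bar> \<le> 0 + e" by simp
  qed
  show ?thesis using small[OF eq(1)] small[OF eq(2)] by simp
qed

section \<open>Uniform continuity, and a countable dense set of formulas\<close>

lemma compact_unit_cube: "compact (unit_cube n)"
proof -
  have "z \<in> unit_cube n \<longleftrightarrow> (\<forall>i. z i \<in> (if i < n then {0..1} else {0}))" for z
    unfolding unit_cube_def mem_Collect_eq by (metis not_less singletonD singletonI)
  then have "unit_cube n = (\<Pi>\<^sub>E i\<in>UNIV. if i < n then {0..1} else {0::real})"
    by (simp add: set_eq_iff PiE_UNIV_domain Pi_iff)
  moreover have "compactin (product_topology (\<lambda>_. euclidean) UNIV) (\<Pi>\<^sub>E i\<in>UNIV. if i < n then {0..1} else {0::real})"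
    unfolding compactin_PiE by (intro disjI2 ballI) (simp only: compactin_euclidean_iff split: if_split, simp)
  ultimately show ?thesis by (simp add: euclidean_product_topology)
qed

text \<open>The metric of the product space weights the coordinates geometrically, and the bound N cuts off
  the tail.\<close>

lemma dist_fun_le:
  assumes "\<And>i. \<bar>x i - y i\<bar> \<le> \<delta>"
  shows "dist (x :: nat \<Rightarrow> real) y \<le> 2 * \<delta> + (1/2) ^ N"
proof -
  have "Max {dist (x (from_nat n)) (y (from_nat n)) |n. n \<le> N} \<le> \<delta>"
    using assms by (subst Max_le_iff) (auto simp: dist_real_def)
  then show ?thesis using dist_fun_le_dist_first_terms[of x y N] by linarith
qed

lemma connective_uniform:
  assumes "connective n u" and "0 < \<epsilon>"
  obtains \<delta> where "0 < \<delta>" "\<And>z z'. z \<in> unit_cube n \<Longrightarrow> z' \<in> unit_cube n \<Longrightarrow> dist z z' < \<delta> \<Longrightarrow> \<bar>u z - u z'\<bar> < \<epsilon>"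
  using compact_uniformly_continuous[OF _ compact_unit_cube, of n u] assms
  unfolding connective_def uniformly_continuous_on_def by (metis dist_commute dist_real_def)

lemma connective_uniform_pad:
  assumes "connective n u" and "0 < \<epsilon>"
  obtains \<delta> where "0 < \<delta>" "\<And>rs rs'. length rs = n \<Longrightarrow> length rs' = n \<Longrightarrow> set rs \<subseteq> {0..1} \<Longrightarrow> set rs' \<subseteq> {0..1} \<Longrightarrow>
      (\<And>i. i < n \<Longrightarrow> \<bar>rs ! i - rs' ! i\<bar> < \<delta>) \<Longrightarrow> \<bar>u (pad rs) - u (pad rs')\<bar> < \<epsilon>"
proof -
  obtain \<delta> where \<delta>: "0 < \<delta>" "\<And>z z'. z \<in> unit_cube n \<Longrightarrow> z' \<in> unit_cube n \<Longrightarrow> dist z z' < \<delta> \<Longrightarrow> \<bar>u z - u z'\<bar> < \<epsilon>"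
    using connective_uniform[OF assms] by blast
  obtain N where N: "(1/2::real) ^ N < \<delta> / 2" using real_arch_pow_inv[of "\<delta> / 2" "1/2"] \<delta>(1) by auto
  have "\<bar>u (pad rs) - u (pad rs')\<bar> < \<epsilon>"
    if rs: "length rs = n" "length rs' = n" "set rs \<subseteq> {0..1}" "set rs' \<subseteq> {0..1}"
      "\<And>i. i < n \<Longrightarrow> \<bar>rs ! i - rs' ! i\<bar> < \<delta> / 4" for rs rs'
  proof (rule \<delta>(2))
    have "\<bar>pad rs i - pad rs' i\<bar> \<le> \<delta> / 4" for i
      using rs(1,2) rs(5)[of i] \<delta>(1) by (auto simp: pad_def)
    from dist_fun_le[of "pad rs" "pad rs'", OF this, of N] N
    show "dist (pad rs) (pad rs') < \<delta>" by simp
  qed (use pad_in_unit_cube[OF rs(3)] pad_in_unit_cube[OF rs(4)] rs(1,2) in simp_all)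
  then show ?thesis using that[of "\<delta> / 4"] \<delta>(1) by auto
qed

lemma common_delta:
  assumes "finite A" and "\<And>a. a \<in> A \<Longrightarrow> \<exists>\<delta>>0. Q a (\<delta>::real)"
    and "\<And>a \<delta> \<delta>'. Q a \<delta> \<Longrightarrow> 0 < \<delta>' \<Longrightarrow> \<delta>' \<le> \<delta> \<Longrightarrow> Q a \<delta>'"
  obtains \<delta> where "0 < \<delta>" "\<And>a. a \<in> A \<Longrightarrow> Q a \<delta>"
proof -
  obtain d where d: "\<And>a. a \<in> A \<Longrightarrow> 0 < d a \<and> Q a (d a)" using assms(2) by metis
  obtain \<delta> where "0 < \<delta>" "\<And>a. a \<in> A \<Longrightarrow> \<delta> \<le> d a" by (rule finite_gap[OF assms(1)]) (use d in blast)+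
  then show ?thesis using that assms(3) d by blast
qed

definition assignments_close :: "('f, 'p, 'u) mstruct \<Rightarrow> nat set \<Rightarrow> real \<Rightarrow> (nat \<Rightarrow> 'u) \<Rightarrow> (nat \<Rightarrow> 'u) \<Rightarrow> bool" where
  "assignments_close M V \<delta> \<rho> \<rho>' \<longleftrightarrow> (\<forall>v\<in>V. \<rho> v \<in> carr M \<and> \<rho>' v \<in> carr M \<and> mdist M (\<rho> v) (\<rho>' v) < \<delta>)"

lemma assignments_close_mono:
  "assignments_close M V \<delta>' \<rho> \<rho>' \<Longrightarrow> \<delta>' \<le> \<delta> \<Longrightarrow> W \<subseteq> V \<Longrightarrow> assignments_close M W \<delta> \<rho> \<rho>'"
  unfolding assignments_close_def by fastforce

lemma terms_uniform_step:
  assumes M: "metric_structure L M" and ts: "\<And>t. t \<in> set ts \<Longrightarrow> wf_trm L t"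
    and IH: "\<And>t \<epsilon>. t \<in> set ts \<Longrightarrow> 0 < \<epsilon> \<Longrightarrow> \<exists>\<delta>>0. \<forall>\<rho> \<rho>'. assignments_close M (fv_trm t) \<delta> \<rho> \<rho>' \<longrightarrow>
      mdist M (trm_val M \<rho> t) (trm_val M \<rho>' t) < \<epsilon>" and "0 < \<eta>"
  obtains \<delta> where "0 < \<delta>" "\<And>\<rho> \<rho>'. assignments_close M (\<Union>t\<in>set ts. fv_trm t) \<delta> \<rho> \<rho>' \<Longrightarrow>
    map (trm_val M \<rho>) ts \<in> tuples M (length ts) \<and> map (trm_val M \<rho>') ts \<in> tuples M (length ts) \<and>
    tuples_close M \<eta> (map (trm_val M \<rho>) ts) (map (trm_val M \<rho>') ts)"
proof -
  obtain \<delta> where \<delta>: "0 < \<delta>" "\<And>t. t \<in> set ts \<Longrightarrow> \<forall>\<rho> \<rho>'. assignments_close M (fv_trm t) \<delta> \<rho> \<rho>' \<longrightarrow>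
      mdist M (trm_val M \<rho> t) (trm_val M \<rho>' t) < \<eta>"
    by (rule common_delta[of "set ts" "\<lambda>t \<delta>. \<forall>\<rho> \<rho>'. assignments_close M (fv_trm t) \<delta> \<rho> \<rho>' \<longrightarrow>
      mdist M (trm_val M \<rho> t) (trm_val M \<rho>' t) < \<eta>"])
      (use IH[OF _ \<open>0 < \<eta>\<close>] assignments_close_mono in \<open>blast+\<close>)
  have "map (trm_val M \<rho>) ts \<in> tuples M (length ts) \<and> map (trm_val M \<rho>') ts \<in> tuples M (length ts) \<and>
    tuples_close M \<eta> (map (trm_val M \<rho>) ts) (map (trm_val M \<rho>') ts)"
    if *: "assignments_close M (\<Union>t\<in>set ts. fv_trm t) \<delta> \<rho> \<rho>'" for \<rho> \<rho>'
  proof -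
    have "trm_val M \<rho> t \<in> carr M \<and> trm_val M \<rho>' t \<in> carr M \<and> mdist M (trm_val M \<rho> t) (trm_val M \<rho>' t) < \<eta>"
      if "t \<in> set ts" for t
    proof -
      have "assignments_close M (fv_trm t) \<delta> \<rho> \<rho>'"
        by (rule assignments_close_mono[OF *]) (use that in auto)
      then show ?thesis using \<delta>(2)[OF that] trm_val_in_carr[OF M ts[OF that]]
        by (auto simp: assignments_close_def)
    qed
    then show ?thesis by (auto simp: tuples_def tuples_close_def)
  qed
  with \<delta>(1) that show ?thesis by blast
qed

lemma trm_uniform:
  assumes L: "signature L" and M: "metric_structure L M" and "wf_trm L t" and "0 < \<epsilon>"
  shows "\<exists>\<delta>>0. \<forall>\<rho> \<rho>'. assignments_close M (fv_trm t) \<delta> \<rho> \<rho>' \<longrightarrow> mdist M (trm_val M \<rho> t) (trm_val M \<rho>' t) < \<epsilon>"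
  using assms(3,4)
proof (induction t arbitrary: \<epsilon>)
  case (Var v)
  then show ?case by (auto simp: assignments_close_def)
next
  case (Fn f ts)
  define \<epsilon>' where "\<epsilon>' = min 1 (\<epsilon> / 2)"
  have \<epsilon>': "0 < \<epsilon>'" "\<epsilon>' \<le> 1" "\<epsilon>' < \<epsilon>" using Fn.prems(2) by (auto simp: \<epsilon>'_def)
  have f: "f \<in> sig_funs L" "length ts = fun_ar L f" "\<And>t. t \<in> set ts \<Longrightarrow> wf_trm L t" using Fn.prems(1) by auto
  then have "0 < fun_mod L f \<epsilon>'" using L \<epsilon>' by (auto simp: signature_def)
  then obtain \<delta> where "0 < \<delta>" "\<And>\<rho> \<rho>'. assignments_close M (\<Union>t\<in>set ts. fv_trm t) \<delta> \<rho> \<rho>' \<Longrightarrow>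
    map (trm_val M \<rho>) ts \<in> tuples M (length ts) \<and> map (trm_val M \<rho>') ts \<in> tuples M (length ts) \<and>
    tuples_close M (fun_mod L f \<epsilon>') (map (trm_val M \<rho>) ts) (map (trm_val M \<rho>') ts)"
    using terms_uniform_step[OF M f(3) Fn.IH[OF _ f(3)], where \<eta> = "fun_mod L f \<epsilon>'"] by blast
  moreover have "mdist M (fun_of M f (map (trm_val M \<rho>) ts)) (fun_of M f (map (trm_val M \<rho>') ts)) < \<epsilon>"
    if "map (trm_val M \<rho>) ts \<in> tuples M (length ts)" "map (trm_val M \<rho>') ts \<in> tuples M (length ts)"
      "tuples_close M (fun_mod L f \<epsilon>') (map (trm_val M \<rho>) ts) (map (trm_val M \<rho>') ts)" for \<rho> \<rho>'
    using metric_structureD(6)[OF M f(1) \<epsilon>'(1,2) that[unfolded f(2)]] \<epsilon>'(3) by linarith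
  ultimately show ?case unfolding trm_val.simps fv_trm.simps by blast
qed

lemma cSUP_near:
  assumes "A \<noteq> {}" and "\<And>a. a \<in> A \<Longrightarrow> (f a :: real) \<in> {0..1}" and "\<And>a. a \<in> A \<Longrightarrow> g a \<in> {0..1}"
    and "\<And>a. a \<in> A \<Longrightarrow> \<bar>f a - g a\<bar> \<le> \<epsilon>"
  shows "\<bar>(SUP a\<in>A. f a) - (SUP a\<in>A. g a)\<bar> \<le> \<epsilon>"
proof -
  have bdd: "bdd_above (f ` A)" "bdd_above (g ` A)" using assms(2,3) by (auto intro!: bdd_aboveI2)
  have 1: "f a \<le> g a + \<epsilon>" "g a \<le> f a + \<epsilon>" if "a \<in> A" for a using assms(4)[OF that] by linarith+
  have "(SUP a\<in>A. f a) \<le> (SUP a\<in>A. g a) + \<epsilon>"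
    using 1(1) cSUP_upper[OF _ bdd(2)] by (intro cSUP_least[OF assms(1)]) force
  moreover have "(SUP a\<in>A. g a) \<le> (SUP a\<in>A. f a) + \<epsilon>"
    using 1(2) cSUP_upper[OF _ bdd(1)] by (intro cSUP_least[OF assms(1)]) force
  ultimately show ?thesis by linarith
qed

lemma mdist_quadrilateral:
  assumes M: "metric_structure L M" and "a \<in> carr M" "b \<in> carr M" "a' \<in> carr M" "b' \<in> carr M"
  shows "\<bar>mdist M a b - mdist M a' b'\<bar> \<le> mdist M a a' + mdist M b b'"
proof -
  interpret Metric_space "carr M" "mdist M" by (rule metric_structureD(2)[OF M])
  have "mdist M a b \<le> mdist M a a' + (mdist M a' b' + mdist M b' b)"
    "mdist M a' b' \<le> mdist M a' a + (mdist M a b + mdist M b b')"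
    using triangle[of a a' b] triangle[of a' b' b] triangle[of a' a b'] triangle[of a b b'] assms by linarith+
  then show ?thesis using commute[of a a'] commute[of b b'] by linarith
qed

text \<open>The symbols and the connectives have moduli of uniform continuity, and a quantifier inherits the
  modulus, since the values for two assignments may be compared at the same witness.\<close>

lemma val_uniform:
  assumes L: "signature L" and M: "metric_structure L M" and "wf_fmla L \<phi>" and "0 < \<epsilon>"
  shows "\<exists>\<delta>>0. \<forall>\<rho> \<rho>'. assignments_close M (fv \<phi>) \<delta> \<rho> \<rho>' \<longrightarrow> \<bar>val M \<rho> \<phi> - val M \<rho>' \<phi>\<bar> < \<epsilon>"
  using assms(3,4)
proof (induction \<phi> arbitrary: \<epsilon> rule: fmla_induct_Sup)
  case (Dist s t)
  obtain d e where de: "0 < d" "0 < e"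
    "\<And>\<rho> \<rho>'. assignments_close M (fv_trm s) d \<rho> \<rho>' \<Longrightarrow> mdist M (trm_val M \<rho> s) (trm_val M \<rho>' s) < \<epsilon> / 2"
    "\<And>\<rho> \<rho>'. assignments_close M (fv_trm t) e \<rho> \<rho>' \<Longrightarrow> mdist M (trm_val M \<rho> t) (trm_val M \<rho>' t) < \<epsilon> / 2"
    using trm_uniform[OF L M, of s "\<epsilon> / 2"] trm_uniform[OF L M, of t "\<epsilon> / 2"] Dist.prems by auto
  have "\<bar>val M \<rho> (Dist s t) - val M \<rho>' (Dist s t)\<bar> < \<epsilon>"
    if *: "assignments_close M (fv (Dist s t)) (min d e) \<rho> \<rho>'" for \<rho> \<rho>'
  proof -
    have "assignments_close M (fv_trm s) d \<rho> \<rho>'" "assignments_close M (fv_trm t) e \<rho> \<rho>'"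
      by (rule assignments_close_mono[OF *]; simp)+
    note close = de(3)[OF this(1)] de(4)[OF this(2)]
    have "trm_val M \<rho> s \<in> carr M" "trm_val M \<rho>' s \<in> carr M" "trm_val M \<rho> t \<in> carr M" "trm_val M \<rho>' t \<in> carr M"
      using Dist.prems(1) * by (auto simp: assignments_close_def intro!: trm_val_in_carr[OF M])
    then show ?thesis using mdist_quadrilateral[OF M] close by fastforce
  qed
  with de(1,2) show ?case by (intro exI[of _ "min d e"]) auto
next
  case (Pred P ts)
  define \<epsilon>' where "\<epsilon>' = min 1 (\<epsilon> / 2)"
  have \<epsilon>': "0 < \<epsilon>'" "\<epsilon>' \<le> 1" "\<epsilon>' < \<epsilon>" using Pred.prems(2) by (auto simp: \<epsilon>'_def)
  have P: "P \<in> sig_preds L" "length ts = pred_ar L P" "\<And>t. t \<in> set ts \<Longrightarrow> wf_trm L t" using Pred.prems(1) by auto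
  then have "0 < pred_mod L P \<epsilon>'" using L \<epsilon>' by (auto simp: signature_def)
  then obtain \<delta> where "0 < \<delta>" "\<And>\<rho> \<rho>'. assignments_close M (\<Union>t\<in>set ts. fv_trm t) \<delta> \<rho> \<rho>' \<Longrightarrow>
    map (trm_val M \<rho>) ts \<in> tuples M (length ts) \<and> map (trm_val M \<rho>') ts \<in> tuples M (length ts) \<and>
    tuples_close M (pred_mod L P \<epsilon>') (map (trm_val M \<rho>) ts) (map (trm_val M \<rho>') ts)"
    using terms_uniform_step[OF M P(3) trm_uniform[OF L M P(3)], where \<eta> = "pred_mod L P \<epsilon>'"] by blast
  moreover have "\<bar>pred_of M P (map (trm_val M \<rho>) ts) - pred_of M P (map (trm_val M \<rho>') ts)\<bar> < \<epsilon>"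
    if "map (trm_val M \<rho>) ts \<in> tuples M (length ts)" "map (trm_val M \<rho>') ts \<in> tuples M (length ts)"
      "tuples_close M (pred_mod L P \<epsilon>') (map (trm_val M \<rho>) ts) (map (trm_val M \<rho>') ts)" for \<rho> \<rho>'
    using metric_structureD(8)[OF M P(1) \<epsilon>'(1,2) that[unfolded P(2)]] \<epsilon>'(3) by linarith
  ultimately show ?case unfolding val.simps fv.simps by blast
next
  case (Conn u \<psi>s)
  have wf: "connective (length \<psi>s) u" "\<And>\<psi>. \<psi> \<in> set \<psi>s \<Longrightarrow> wf_fmla L \<psi>" using Conn.prems(1) by auto
  obtain \<eta> where \<eta>: "0 < \<eta>" "\<And>rs rs'. length rs = length \<psi>s \<Longrightarrow> length rs' = length \<psi>s \<Longrightarrow> set rs \<subseteq> {0..1} \<Longrightarrow>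
      set rs' \<subseteq> {0..1} \<Longrightarrow> (\<And>i. i < length \<psi>s \<Longrightarrow> \<bar>rs ! i - rs' ! i\<bar> < \<eta>) \<Longrightarrow> \<bar>u (pad rs) - u (pad rs')\<bar> < \<epsilon>"
    using connective_uniform_pad[OF wf(1) Conn.prems(2)] by blast
  obtain \<delta> where \<delta>: "0 < \<delta>" "\<And>\<psi>. \<psi> \<in> set \<psi>s \<Longrightarrow>
      \<forall>\<rho> \<rho>'. assignments_close M (fv \<psi>) \<delta> \<rho> \<rho>' \<longrightarrow> \<bar>val M \<rho> \<psi> - val M \<rho>' \<psi>\<bar> < \<eta>"
    by (rule common_delta[of "set \<psi>s" "\<lambda>\<psi> \<delta>. \<forall>\<rho> \<rho>'. assignments_close M (fv \<psi>) \<delta> \<rho> \<rho>' \<longrightarrow> \<bar>val M \<rho> \<psi> - val M \<rho>' \<psi>\<bar> < \<eta>"])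
      (use Conn.IH[OF _ wf(2) \<open>0 < \<eta>\<close>] assignments_close_mono in \<open>blast+\<close>)
  have "\<bar>val M \<rho> (Conn u \<psi>s) - val M \<rho>' (Conn u \<psi>s)\<bar> < \<epsilon>"
    if *: "assignments_close M (fv (Conn u \<psi>s)) \<delta> \<rho> \<rho>'" for \<rho> \<rho>'
    unfolding val.simps
  proof (rule \<eta>(2))
    have range: "val M \<rho> \<psi> \<in> {0..1} \<and> val M \<rho>' \<psi> \<in> {0..1}" if "\<psi> \<in> set \<psi>s" for \<psi>
      using * that by (intro conjI val_in_unit[OF M wf(2)[OF that]]) (auto simp: assignments_close_def)
    then show "set (map (val M \<rho>) \<psi>s) \<subseteq> {0..1}" "set (map (val M \<rho>') \<psi>s) \<subseteq> {0..1}" by auto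
    fix i assume i: "i < length \<psi>s"
    have "assignments_close M (fv (\<psi>s ! i)) \<delta> \<rho> \<rho>'"
      by (rule assignments_close_mono[OF *]) (use nth_mem[OF i] in auto)
    then show "\<bar>map (val M \<rho>) \<psi>s ! i - map (val M \<rho>') \<psi>s ! i\<bar> < \<eta>" using \<delta>(2)[of "\<psi>s ! i"] i by simp
  qed simp_all
  with \<delta>(1) show ?case by blast
next
  case (Sup_q v \<phi>)
  then obtain \<delta> where \<delta>: "0 < \<delta>" "\<And>\<rho> \<rho>'. assignments_close M (fv \<phi>) \<delta> \<rho> \<rho>' \<Longrightarrow> \<bar>val M \<rho> \<phi> - val M \<rho>' \<phi>\<bar> < \<epsilon> / 2"
    using Sup_q.IH[of "\<epsilon> / 2"] by auto
  have "\<bar>val M \<rho> (Sup_q v \<phi>) - val M \<rho>' (Sup_q v \<phi>)\<bar> \<le> \<epsilon> / 2"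
    if *: "assignments_close M (fv (Sup_q v \<phi>)) \<delta> \<rho> \<rho>'" for \<rho> \<rho>'
    unfolding val.simps
  proof (rule cSUP_near[OF metric_structureD(1)[OF M]])
    fix a assume a: "a \<in> carr M"
    have "mdist M a a = 0" using Metric_space.mdist_zero[OF metric_structureD(2)[OF M] a] .
    then have "assignments_close M (fv \<phi>) \<delta> (\<rho>(v := a)) (\<rho>'(v := a))" using * a \<delta>(1) by (auto simp: assignments_close_def)
    from \<delta>(2)[OF this] show "\<bar>val M (\<rho>(v := a)) \<phi> - val M (\<rho>'(v := a)) \<phi>\<bar> \<le> \<epsilon> / 2" by simp
    show "val M (\<rho>(v := a)) \<phi> \<in> {0..1}" "val M (\<rho>'(v := a)) \<phi> \<in> {0..1}"
      using * a Sup_q.prems(1) by (intro val_in_unit[OF M]; auto simp: assignments_close_def)+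
  qed
  moreover have "\<epsilon> / 2 < \<epsilon>" using Sup_q.prems(2) by simp
  ultimately show ?case using \<delta>(1) le_less_trans by blast
next
  case (Inf_q v \<phi>)
  let ?\<psi> = "neg_fmla (Sup_q v (neg_fmla \<phi>))"
  have eq: "val M \<rho> (Inf_q v \<phi>) = val M \<rho> ?\<psi>" if "\<And>w. w \<in> fv \<phi> - {v} \<Longrightarrow> \<rho> w \<in> carr M" for \<rho>
    by (rule val_Inf_neg[OF M _ that]) (use Inf_q.prems(1) in auto)
  have "\<exists>\<delta>>0. \<forall>\<rho> \<rho>'. assignments_close M (fv ?\<psi>) \<delta> \<rho> \<rho>' \<longrightarrow> \<bar>val M \<rho> ?\<psi> - val M \<rho>' ?\<psi>\<bar> < \<epsilon>"
    by (rule Inf_q.IH) (use Inf_q.prems in auto)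
  moreover have "val M \<rho> (Inf_q v \<phi>) = val M \<rho> ?\<psi> \<and> val M \<rho>' (Inf_q v \<phi>) = val M \<rho>' ?\<psi>"
    if "assignments_close M (fv (Inf_q v \<phi>)) \<delta> \<rho> \<rho>'" for \<delta> \<rho> \<rho>'
    using that by (intro conjI eq) (auto simp: assignments_close_def)
  ultimately show ?case by (metis fv.simps(4,5) fv_neg)
qed

text \<open>The least set closed under countably many finitary operations is reached after countably many
  steps; the last clause is the corresponding induction principle.\<close>

lemma countable_closure:
  assumes "countable S\<^sub>0" and "countable (G :: ('a list \<Rightarrow> 'a) set)"
  obtains S where "countable S" "S\<^sub>0 \<subseteq> S" "\<And>g l. g \<in> G \<Longrightarrow> set l \<subseteq> S \<Longrightarrow> g l \<in> S"
    "\<And>A. S\<^sub>0 \<subseteq> A \<Longrightarrow> (\<And>g l. g \<in> G \<Longrightarrow> set l \<subseteq> A \<Longrightarrow> g l \<in> A) \<Longrightarrow> S \<subseteq> A"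
proof -
  define step where "step S = S \<union> (\<lambda>(g, l). g l) ` (G \<times> lists S)" for S
  define cl where "cl k = (step ^^ k) S\<^sub>0" for k
  have cl_Suc: "cl (Suc k) = step (cl k)" for k by (simp add: cl_def)
  have "countable (cl k)" for k
    by (induction k) (auto simp: cl_Suc step_def assms, simp add: cl_def assms)
  moreover have "cl i \<subseteq> cl j" if "i \<le> j" for i j
    by (rule lift_Suc_mono_le[OF _ that]) (auto simp: cl_Suc step_def)
  then have mono: "mono cl" by (simp add: monoI)
  have "g l \<in> (\<Union>k. cl k)" if g: "g \<in> G" and l: "set l \<subseteq> (\<Union>k. cl k)" for g l
  proof -
    obtain k where "set l \<subseteq> cl k"
    proof -
      have "\<exists>k. set l \<subseteq> cl k" using l
      proof (induction l)
        case (Cons a l)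
        then obtain k j where "set l \<subseteq> cl k" "a \<in> cl j" by auto
        then have "set (a # l) \<subseteq> cl (max k j)"
          using monoD[OF mono, of k "max k j"] monoD[OF mono, of j "max k j"] by auto
        then show ?case ..
      qed simp
      then show ?thesis using that by blast
    qed
    then have "g l \<in> cl (Suc k)" using g by (auto simp: cl_Suc step_def)
    then show ?thesis by blast
  qed
  moreover have "S\<^sub>0 \<subseteq> (\<Union>k. cl k)" using UN_upper[of 0 UNIV cl] by (simp add: cl_def)
  moreover have "(\<Union>k. cl k) \<subseteq> A" if "S\<^sub>0 \<subseteq> A" "\<And>g l. g \<in> G \<Longrightarrow> set l \<subseteq> A \<Longrightarrow> g l \<in> A" for A
  proof -
    have "cl k \<subseteq> A" for k
    proof (induction k)
      case (Suc k)
      then show ?case using that(2) by (auto simp: cl_Suc step_def in_lists_conv_set subset_iff)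
    qed (simp add: cl_def that(1))
    then show ?thesis by blast
  qed
  ultimately show ?thesis using that[of "\<Union>k. cl k"] by auto
qed

text \<open>Fixing approximate values on a finite net leaves only connectives that are close to each
  other, so one representative for each choice of a net and of rational values is enough.\<close>

lemma countable_dense_connectives:
  obtains C where "countable C" "\<And>u. u \<in> C \<Longrightarrow> connective n u"
    "\<And>u \<epsilon>. connective n u \<Longrightarrow> 0 < \<epsilon> \<Longrightarrow> \<exists>u'\<in>C. \<forall>z\<in>unit_cube n. \<bar>u z - u' z\<bar> < \<epsilon>"
proof -
  have "\<exists>zs. set zs \<subseteq> unit_cube n \<and> unit_cube n \<subseteq> (\<Union>c\<in>set zs. ball c (1 / Suc k))" for k
  proof -
    have "seq_compact (unit_cube n)" using compact_unit_cube by (simp add: compact_eq_seq_compact_metric)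
    then obtain Z where "finite Z" "Z \<subseteq> unit_cube n" "unit_cube n \<subseteq> (\<Union>c\<in>Z. ball c (1 / Suc k))"
      using seq_compact_imp_totally_bounded[of "unit_cube n"] by (metis of_nat_0_less_iff zero_less_Suc zero_less_divide_1_iff)
    then show ?thesis using finite_list[of Z] by auto
  qed
  then obtain zs where zs: "\<And>k. set (zs k) \<subseteq> unit_cube n" "\<And>k. unit_cube n \<subseteq> (\<Union>c\<in>set (zs k). ball c (1 / Suc k))"
    by metis
  define Q where "Q = (\<lambda>(k, m, g :: rat list) u. connective n u \<and> (\<forall>i<length (zs k). \<forall>z\<in>unit_cube n.
      dist (zs k ! i) z < 1 / Suc k \<longrightarrow> \<bar>u z - of_rat (g ! i)\<bar> < 1 / Suc m))"
  define C where "C = (\<lambda>d. SOME u. Q d u) ` {d. \<exists>u. Q d u}"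
  have "countable C" by (simp add: C_def)
  moreover have some: "Q d (SOME u. Q d u)" if "Q d u" for d u using that by (rule someI[where P = "Q d"])
  then have "connective n u" if "u \<in> C" for u
    using that by (auto simp: C_def Q_def split: prod.splits)
  moreover have "\<exists>u'\<in>C. \<forall>z\<in>unit_cube n. \<bar>u z - u' z\<bar> < \<epsilon>" if u: "connective n u" and "0 < \<epsilon>" for u \<epsilon>
  proof -
    obtain m where m: "1 / real (Suc m) < \<epsilon> / 2"
      using reals_Archimedean[of "\<epsilon> / 2"] \<open>0 < \<epsilon>\<close> by (auto simp: inverse_eq_divide)
    define \<eta> where "\<eta> = 1 / real (Suc m) / 2"
    have "0 < \<eta>" by (simp add: \<eta>_def)
    obtain \<delta> where \<delta>: "0 < \<delta>" "\<And>z z'. z \<in> unit_cube n \<Longrightarrow> z' \<in> unit_cube n \<Longrightarrow> dist z z' < \<delta> \<Longrightarrow> \<bar>u z - u z'\<bar> < \<eta>"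
      using connective_uniform[OF u \<open>0 < \<eta>\<close>] by blast
    obtain k where k: "1 / real (Suc k) < \<delta>"
      using reals_Archimedean[of \<delta>] \<delta>(1) by (auto simp: inverse_eq_divide)
    have "\<exists>q. \<bar>y - of_rat q\<bar> < \<eta>" for y :: real
    proof -
      obtain q where "y - \<eta> < of_rat q" "of_rat q < y" using of_rat_dense[of "y - \<eta>" y] \<open>0 < \<eta>\<close> by auto
      then have "\<bar>y - of_rat q\<bar> < \<eta>" by linarith
      then show ?thesis ..
    qed
    then obtain rt where rt: "\<And>y. \<bar>y - of_rat (rt y)\<bar> < \<eta>" by metis
    define d where "d = (k, m, map (\<lambda>z. rt (u z)) (zs k))"
    have Q: "Q d u"
      unfolding Q_def d_def prod.case
    proof (intro conjI u allI ballI impI)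
      fix i z assume i: "i < length (zs k)" and z: "z \<in> unit_cube n" "dist (zs k ! i) z < 1 / real (Suc k)"
      have "zs k ! i \<in> unit_cube n" using zs(1) nth_mem[OF i] by blast
      then have "\<bar>u (zs k ! i) - u z\<bar> < \<eta>" using \<delta>(2) z k by auto
      then have "\<bar>u z - of_rat (rt (u (zs k ! i)))\<bar> < 2 * \<eta>" using rt[of "u (zs k ! i)"] by linarith
      then show "\<bar>u z - of_rat (map (\<lambda>z. rt (u z)) (zs k) ! i)\<bar> < 1 / real (Suc m)"
        using i by (simp add: \<eta>_def del: of_nat_Suc)
    qed
    define u' where "u' = (SOME u. Q d u)"
    have "u' \<in> C" using Q by (auto simp: C_def u'_def)
    moreover have "\<bar>u z - u' z\<bar> < \<epsilon>" if z: "z \<in> unit_cube n" for z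
    proof -
      obtain c where "c \<in> set (zs k)" "dist c z < 1 / real (Suc k)" using zs(2)[of k] z by auto
      then obtain i where i: "i < length (zs k)" "dist (zs k ! i) z < 1 / real (Suc k)" by (metis in_set_conv_nth)
      have "\<bar>u z - of_rat (map (\<lambda>z. rt (u z)) (zs k) ! i)\<bar> < 1 / real (Suc m)"
        "\<bar>u' z - of_rat (map (\<lambda>z. rt (u z)) (zs k) ! i)\<bar> < 1 / real (Suc m)"
        using Q some[OF Q] i z unfolding Q_def d_def u'_def by auto
      then show ?thesis using m by linarith
    qed
    ultimately show ?thesis by blast
  qed
  ultimately show ?thesis using that by blast
qed

lemma countable_wf_trms:
  assumes "countable (sig_funs L)"
  shows "countable {t. wf_trm L t}"
proof -
  have "countable ((\<lambda>f. Fn f) ` sig_funs L)" "countable (range Var)" using assms by auto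
  then obtain S where S: "countable S" "range Var \<subseteq> S"
    "\<And>g l. g \<in> (\<lambda>f. Fn f) ` sig_funs L \<Longrightarrow> set l \<subseteq> S \<Longrightarrow> g l \<in> S"
    by (metis countable_closure)
  have "t \<in> S" if "wf_trm L t" for t
    using that
  proof (induction t)
    case (Fn f ts)
    then have "set ts \<subseteq> S" "f \<in> sig_funs L" by auto
    then show ?case using S(3)[of "Fn f"] by blast
  qed (use S(2) in auto)
  then show ?thesis by (intro countable_subset[OF _ S(1)]) auto
qed

text \<open>Connectives range over an uncountable set, so that formulas can only be counted up to
  uniform approximation.\<close>

lemma countable_dense_formulas:
  assumes L: "countable_signature L" and M: "metric_structure L M"
  obtains F where "countable F" "\<And>\<psi>. \<psi> \<in> F \<Longrightarrow> wf_fmla L \<psi>"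
    "\<And>\<phi> \<epsilon>. wf_fmla L \<phi> \<Longrightarrow> 0 < \<epsilon> \<Longrightarrow> \<exists>\<psi>\<in>F. fv \<psi> \<subseteq> fv \<phi> \<and>
       (\<forall>\<rho>. (\<forall>v\<in>fv \<phi>. \<rho> v \<in> carr M) \<longrightarrow> \<bar>val M \<rho> \<phi> - val M \<rho> \<psi>\<bar> < \<epsilon>)"
proof -
  have "\<exists>C. countable C \<and> (\<forall>u\<in>C. connective n u) \<and>
      (\<forall>u \<epsilon>. connective n u \<and> 0 < \<epsilon> \<longrightarrow> (\<exists>u'\<in>C. \<forall>z\<in>unit_cube n. \<bar>u z - u' z\<bar> < \<epsilon>))" for n
    using countable_dense_connectives[of n] by metis
  then obtain C where C: "\<And>n. countable (C n)" "\<And>n u. u \<in> C n \<Longrightarrow> connective n u"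
    "\<And>n u \<epsilon>. connective n u \<Longrightarrow> 0 < \<epsilon> \<Longrightarrow> \<exists>u'\<in>C n. \<forall>z\<in>unit_cube n. \<bar>u z - u' z\<bar> < \<epsilon>"
    by metis
  define Tm where "Tm = {t. wf_trm L t}"
  have Tm: "countable Tm" using L by (simp add: Tm_def countable_wf_trms countable_signature_def)
  define A where "A = (\<lambda>(s, t). Dist s t) ` (Tm \<times> Tm) \<union> (\<lambda>(P, ts). Pred P ts) ` {(P, ts). P \<in> sig_preds L \<and> set ts \<subseteq> Tm \<and> length ts = pred_ar L P}"
  have "countable {(P, ts). P \<in> sig_preds L \<and> set ts \<subseteq> Tm \<and> length ts = pred_ar L P}"
    by (rule countable_subset[of _ "sig_preds L \<times> lists Tm"])
      (use L Tm in \<open>auto simp: countable_signature_def in_lists_conv_set\<close>)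
  then have "countable A" unfolding A_def using Tm by (intro countable_Un countable_image countable_SIGMA)
  define triv :: "('a, 'b) fmla" where "triv = Dist (Var 0) (Var 0)"
  define con where "con = (\<lambda>(n, u) l. if length l = n then Conn u l else triv)"
  define supq where "supq v l = Sup_q v (hd (l @ [triv]))" for v l
  define G where "G = con ` (SIGMA n:UNIV. C n) \<union> range supq"
  have "countable G" unfolding G_def using C(1) by (intro countable_Un countable_image countable_SIGMA) auto
  obtain F where F: "countable F" "A \<subseteq> F" "\<And>g l. g \<in> G \<Longrightarrow> set l \<subseteq> F \<Longrightarrow> g l \<in> F"
    and least: "\<And>B. A \<subseteq> B \<Longrightarrow> (\<And>g l. g \<in> G \<Longrightarrow> set l \<subseteq> B \<Longrightarrow> g l \<in> B) \<Longrightarrow> F \<subseteq> B"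
    using countable_closure[OF \<open>countable A\<close> \<open>countable G\<close>] by metis
  have wf: "F \<subseteq> {\<psi>. wf_fmla L \<psi>}"
  proof (rule least)
    show "A \<subseteq> {\<psi>. wf_fmla L \<psi>}" by (auto simp: A_def Tm_def)
    have triv: "wf_fmla L triv" by (simp add: triv_def)
    then have hd: "wf_fmla L (hd (l @ [triv]))" if "set l \<subseteq> {\<psi>. wf_fmla L \<psi>}" for l
      using that by (cases l) auto
    fix g l assume "g \<in> G" "set l \<subseteq> {\<psi>. wf_fmla L \<psi>}"
    then show "g l \<in> {\<psi>. wf_fmla L \<psi>}"
      using triv C(2) hd unfolding G_def con_def supq_def by fastforce
  qed
  have "\<exists>\<psi>\<in>F. fv \<psi> \<subseteq> fv \<phi> \<and> (\<forall>\<rho>. (\<forall>v\<in>fv \<phi>. \<rho> v \<in> carr M) \<longrightarrow> \<bar>val M \<rho> \<phi> - val M \<rho> \<psi>\<bar> < \<epsilon>)"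
    if "wf_fmla L \<phi>" "0 < \<epsilon>" for \<phi> \<epsilon>
    using that
  proof (induction \<phi> arbitrary: \<epsilon> rule: fmla_induct_Sup)
    case (Dist s t)
    then have "Dist s t \<in> F" using F(2) by (auto simp: A_def Tm_def)
    then show ?case using Dist.prems(2) by (intro bexI[of _ "Dist s t"]) auto
  next
    case (Pred P ts)
    then have "(P, ts) \<in> {(P, ts). P \<in> sig_preds L \<and> set ts \<subseteq> Tm \<and> length ts = pred_ar L P}"
      by (auto simp: Tm_def)
    then have "Pred P ts \<in> A" unfolding A_def by (intro UnI2) (erule rev_image_eqI, simp)
    then have "Pred P ts \<in> F" using F(2) by blast
    then show ?case using Pred.prems(2) by (intro bexI[of _ "Pred P ts"]) auto
  next
    case (Conn u \<phi>s)
    define n where "n = length \<phi>s"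
    have wfs: "\<And>\<phi>. \<phi> \<in> set \<phi>s \<Longrightarrow> wf_fmla L \<phi>" and u: "connective n u" using Conn.prems(1) by (auto simp: n_def)
    obtain u' where u': "u' \<in> C n" "\<And>z. z \<in> unit_cube n \<Longrightarrow> \<bar>u z - u' z\<bar> < \<epsilon> / 2"
      using C(3)[OF u, of "\<epsilon> / 2"] Conn.prems(2) by auto
    obtain \<delta> where \<delta>: "0 < \<delta>" "\<And>rs rs'. length rs = n \<Longrightarrow> length rs' = n \<Longrightarrow> set rs \<subseteq> {0..1} \<Longrightarrow> set rs' \<subseteq> {0..1} \<Longrightarrow>
        (\<And>i. i < n \<Longrightarrow> \<bar>rs ! i - rs' ! i\<bar> < \<delta>) \<Longrightarrow> \<bar>u' (pad rs) - u' (pad rs')\<bar> < \<epsilon> / 2"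
      using connective_uniform_pad[OF C(2)[OF u'(1)], of "\<epsilon> / 2"] Conn.prems(2) by (metis half_gt_zero)
    have "\<forall>\<phi>\<in>set \<phi>s. \<exists>\<psi>. \<psi> \<in> F \<and> fv \<psi> \<subseteq> fv \<phi> \<and> (\<forall>\<rho>. (\<forall>v\<in>fv \<phi>. \<rho> v \<in> carr M) \<longrightarrow> \<bar>val M \<rho> \<phi> - val M \<rho> \<psi>\<bar> < \<delta>)"
      using Conn.IH[OF _ wfs \<open>0 < \<delta>\<close>] by blast
    then obtain f where f: "\<And>\<phi>. \<phi> \<in> set \<phi>s \<Longrightarrow> f \<phi> \<in> F" "\<And>\<phi>. \<phi> \<in> set \<phi>s \<Longrightarrow> fv (f \<phi>) \<subseteq> fv \<phi>"
      "\<And>\<phi> \<rho>. \<phi> \<in> set \<phi>s \<Longrightarrow> (\<And>v. v \<in> fv \<phi> \<Longrightarrow> \<rho> v \<in> carr M) \<Longrightarrow> \<bar>val M \<rho> \<phi> - val M \<rho> (f \<phi>)\<bar> < \<delta>"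
      by metis
    have "con (n, u') (map f \<phi>s) \<in> F" by (rule F(3)) (use u'(1) f(1) in \<open>auto simp: G_def\<close>)
    then have mem: "Conn u' (map f \<phi>s) \<in> F" by (simp add: con_def n_def)
    have "\<bar>val M \<rho> (Conn u \<phi>s) - val M \<rho> (Conn u' (map f \<phi>s))\<bar> < \<epsilon>"
      if \<rho>: "\<And>v. v \<in> fv (Conn u \<phi>s) \<Longrightarrow> \<rho> v \<in> carr M" for \<rho>
    proof -
      define rs where "rs = map (val M \<rho>) \<phi>s"
      define rs' where "rs' = map (val M \<rho>) (map f \<phi>s)"
      have \<rho>': "\<rho> v \<in> carr M" if "\<phi> \<in> set \<phi>s" "v \<in> fv \<phi>" for v \<phi> using \<rho>[of v] that by auto
      have "val M \<rho> \<phi> \<in> {0..1}" if "\<phi> \<in> set \<phi>s" for \<phi>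
        by (rule val_in_unit[OF M wfs[OF that] \<rho>'[OF that]])
      then have rs: "set rs \<subseteq> {0..1}" unfolding rs_def by auto
      have "val M \<rho> (f \<phi>) \<in> {0..1}" if "\<phi> \<in> set \<phi>s" for \<phi>
        by (rule val_in_unit[OF M]) (use f(1,2)[OF that] wf \<rho>'[OF that] in auto)
      then have rs': "set rs' \<subseteq> {0..1}" unfolding rs'_def by auto
      have "\<bar>u (pad rs) - u' (pad rs)\<bar> < \<epsilon> / 2"
        using u'(2) pad_in_unit_cube[OF rs] by (simp add: rs_def n_def)
      moreover have "\<bar>u' (pad rs) - u' (pad rs')\<bar> < \<epsilon> / 2"
      proof (rule \<delta>(2)[OF _ _ rs rs'])
        fix i assume "i < n"
        then show "\<bar>rs ! i - rs' ! i\<bar> < \<delta>"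
          using f(3)[of "\<phi>s ! i" \<rho>] \<rho>'[of "\<phi>s ! i"] by (auto simp: rs_def rs'_def n_def)
      qed (auto simp: rs_def rs'_def n_def)
      moreover have "val M \<rho> (Conn u \<phi>s) = u (pad rs)" "val M \<rho> (Conn u' (map f \<phi>s)) = u' (pad rs')"
        by (simp_all only: rs_def rs'_def val.simps)
      ultimately show ?thesis by linarith
    qed
    moreover have "fv (Conn u' (map f \<phi>s)) \<subseteq> fv (Conn u \<phi>s)" using f(2) by auto
    ultimately show ?case using mem by blast
  next
    case (Sup_q v \<phi>)
    then obtain \<psi> where \<psi>: "\<psi> \<in> F" "fv \<psi> \<subseteq> fv \<phi>"
      "\<And>\<rho>. (\<forall>v\<in>fv \<phi>. \<rho> v \<in> carr M) \<Longrightarrow> \<bar>val M \<rho> \<phi> - val M \<rho> \<psi>\<bar> < \<epsilon> / 2"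
      using Sup_q.IH[of "\<epsilon> / 2"] by auto
    have "supq v [\<psi>] \<in> F" by (rule F(3)) (use \<psi>(1) in \<open>auto simp: G_def\<close>)
    then have mem: "Sup_q v \<psi> \<in> F" by (simp add: supq_def)
    have "\<bar>val M \<rho> (Sup_q v \<phi>) - val M \<rho> (Sup_q v \<psi>)\<bar> \<le> \<epsilon> / 2"
      if \<rho>: "\<forall>w\<in>fv (Sup_q v \<phi>). \<rho> w \<in> carr M" for \<rho>
      unfolding val.simps
    proof (rule cSUP_near[OF metric_structureD(1)[OF M]])
      fix a assume "a \<in> carr M"
      with \<rho> have *: "\<forall>w\<in>fv \<phi>. (\<rho>(v := a)) w \<in> carr M" by auto
      from \<psi>(3)[OF this] show "\<bar>val M (\<rho>(v := a)) \<phi> - val M (\<rho>(v := a)) \<psi>\<bar> \<le> \<epsilon> / 2" by linarith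
      show "val M (\<rho>(v := a)) \<phi> \<in> {0..1}"
        by (rule val_in_unit[OF M]) (use * Sup_q.prems(1) in auto)
      have "wf_fmla L \<psi>" using wf \<psi>(1) by blast
      then show "val M (\<rho>(v := a)) \<psi> \<in> {0..1}"
        by (rule val_in_unit[OF M]) (use * \<psi>(2) in blast)
    qed
    moreover have "\<epsilon> / 2 < \<epsilon>" using Sup_q.prems(2) by simp
    moreover have "fv (Sup_q v \<psi>) \<subseteq> fv (Sup_q v \<phi>)" using \<psi>(2) by auto
    ultimately show ?case using mem le_less_trans by blast
  next
    case (Inf_q v \<phi>)
    let ?\<psi> = "neg_fmla (Sup_q v (neg_fmla \<phi>))"
    have "val M \<rho> (Inf_q v \<phi>) = val M \<rho> ?\<psi>" if "\<forall>w\<in>fv (Inf_q v \<phi>). \<rho> w \<in> carr M" for \<rho>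
      by (rule val_Inf_neg[OF M]) (use that Inf_q.prems(1) in auto)
    moreover have "\<exists>\<psi>\<in>F. fv \<psi> \<subseteq> fv ?\<psi> \<and>
        (\<forall>\<rho>. (\<forall>w\<in>fv ?\<psi>. \<rho> w \<in> carr M) \<longrightarrow> \<bar>val M \<rho> ?\<psi> - val M \<rho> \<psi>\<bar> < \<epsilon>)"
      by (rule Inf_q.IH) (use Inf_q.prems in auto)
    moreover have "fv ?\<psi> = fv (Inf_q v \<phi>)" by simp
    ultimately show ?case by (simp only: simp_thms) metis
  qed
  note dense = this
  show ?thesis
  proof (rule that[OF F(1)])
    show "wf_fmla L \<psi>" if "\<psi> \<in> F" for \<psi> using that wf by blast
  qed (rule dense)
qed

section \<open>Separable elementary substructures\<close>

lemma trm_val_carr [simp]: "trm_val (M\<lparr>carr := C\<rparr>) \<rho> = trm_val M \<rho>"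
proof
  show "trm_val (M\<lparr>carr := C\<rparr>) \<rho> t = trm_val M \<rho> t" for t
    by (induction t) (auto cong: map_cong)
qed

definition close_in :: "('f, 'p, 'u) mstruct \<Rightarrow> 'u set \<Rightarrow> 'u set" where
  "close_in M S = {x \<in> carr M. \<forall>\<epsilon>>0. \<exists>s\<in>S. s \<in> carr M \<and> mdist M x s < \<epsilon>}"

lemma close_in_closure_of:
  assumes "metric_structure L M"
  shows "close_in M S = Metric_space.mtopology (carr M) (mdist M) closure_of S"
proof -
  interpret Metric_space "carr M" "mdist M" by (rule metric_structureD(2)[OF assms])
  show ?thesis unfolding metric_closure_of close_in_def by auto
qed

lemma tuples_close_approx:
  assumes "metric_structure L M" and "S \<subseteq> carr M" and "a \<in> tuples (M\<lparr>carr := close_in M S\<rparr>) n" and "0 < \<delta>"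
  obtains s where "set s \<subseteq> S" "s \<in> tuples M n" "tuples_close M \<delta> a s"
proof -
  have a: "length a = n" "set a \<subseteq> close_in M S" using assms(3) by (auto simp: tuples_def)
  then have "\<exists>s\<in>S. mdist M x s < \<delta>" if "x \<in> set a" for x
    using that assms(4) unfolding close_in_def by blast
  then obtain f where f: "\<And>x. x \<in> set a \<Longrightarrow> f x \<in> S \<and> mdist M x (f x) < \<delta>" by metis
  show ?thesis
    by (rule that[of "map f a"]) (use f a(1) assms(2) in \<open>auto simp: tuples_def tuples_close_def\<close>)
qed

text \<open>Uniform continuity extends closure under the function symbols from S to its closure, which is
  complete as a closed subset.\<close>

lemma closed_substructure:
  assumes L: "signature L" and U: "metric_structure L U" and S: "S \<subseteq> carr U" "S \<noteq> {}"
    and funs: "\<And>f a. f \<in> sig_funs L \<Longrightarrow> a \<in> tuples U (fun_ar L f) \<Longrightarrow> set a \<subseteq> S \<Longrightarrow> fun_of U f a \<in> S"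
  defines "M \<equiv> U\<lparr>carr := close_in U S\<rparr>"
  shows "metric_structure L M" and "countable S \<Longrightarrow> separable M" and "S \<subseteq> carr M" and "carr M \<subseteq> carr U"
proof -
  interpret Metric_space "carr U" "mdist U" by (rule metric_structureD(2)[OF U])
  have sub: "carr M \<subseteq> carr U" by (auto simp: M_def close_in_def)
  interpret sub: Submetric "carr U" "mdist U" "carr M" by unfold_locales (rule sub)
  have S_sub: "S \<subseteq> carr M" using S(1) mdist_zero by (force simp: M_def close_in_def)
  have cl: "carr M = mtopology closure_of S" using close_in_closure_of[OF U] by (simp add: M_def)
  have tup: "a \<in> tuples U n" if "a \<in> tuples M n" for a n using that sub by (auto simp: tuples_def)
  have "fun_of U f a \<in> carr M" if f: "f \<in> sig_funs L" and a: "a \<in> tuples M (fun_ar L f)" for f a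
  proof -
    have "\<exists>s\<in>S. s \<in> carr U \<and> mdist U (fun_of U f a) s < \<epsilon>" if "0 < \<epsilon>" for \<epsilon>
    proof -
      define \<epsilon>' where "\<epsilon>' = min 1 (\<epsilon> / 2)"
      have \<epsilon>': "0 < \<epsilon>'" "\<epsilon>' \<le> 1" "\<epsilon>' < \<epsilon>" using \<open>0 < \<epsilon>\<close> by (auto simp: \<epsilon>'_def)
      have "0 < fun_mod L f \<epsilon>'" using L \<epsilon>' f by (auto simp: signature_def)
      then obtain s where s: "set s \<subseteq> S" "s \<in> tuples U (fun_ar L f)" "tuples_close U (fun_mod L f \<epsilon>') a s"
        using tuples_close_approx[OF U S(1) a[unfolded M_def]] by blast
      then have "mdist U (fun_of U f a) (fun_of U f s) < \<epsilon>"
        using metric_structureD(6)[OF U f \<epsilon>'(1,2) tup[OF a] s(2,3)] \<epsilon>'(3) by linarith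
      with funs[OF f s(2,1)] S(1) show ?thesis by blast
    qed
    then show ?thesis using metric_structureD(5)[OF U f tup[OF a]] by (auto simp: M_def close_in_def)
  qed
  moreover have "sub.sub.mcomplete"
    using sub.closedin_eq_mcomplete metric_structureD(3)[OF U] cl by simp
  moreover have "carr M \<noteq> {}" using S(2) S_sub by blast
  ultimately show M: "metric_structure L M"
    using U sub tup sub.sub.Metric_space_axioms unfolding metric_structure_def
    by (auto simp: M_def tuples_close_def subset_iff)
  show "separable M" if "countable S"
  proof -
    have "(subtopology mtopology (carr M)) closure_of S = carr M"
      using S_sub cl by (simp add: closure_of_subtopology Int_absorb1)
    then show ?thesis
      unfolding separable_def separable_space_def
      using that S_sub sub sub.mtopology_submetric by (intro exI[of _ S]) (auto simp: M_def)
  qed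
  show "S \<subseteq> carr M" "carr M \<subseteq> carr U" by (fact S_sub sub)+
qed

text \<open>
  A countable set is closed under the functions and under approximate witnesses for the formulas
  of a countable dense set; by uniform continuity this is enough for the Tarski-Vaught test on
  its closure.
\<close>

theorem separable_elementary_substructure:
  fixes U :: "('f, 'p, 'u) mstruct"
  assumes L: "signature L" "countable_signature L" and U: "metric_structure L U"
    and A: "countable A" "A \<subseteq> carr U"
  obtains M :: "('f, 'p, 'u) mstruct" where "metric_structure L M" "separable M" "A \<subseteq> carr M" "elementary_map L M (carr M) U id"
proof -
  obtain a\<^sub>0 where a\<^sub>0: "a\<^sub>0 \<in> carr U" using metric_structureD(1)[OF U] by blast
  obtain F where F: "countable F" "\<And>\<psi>. \<psi> \<in> F \<Longrightarrow> wf_fmla L \<psi>"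
    "\<And>\<phi> \<epsilon>. wf_fmla L \<phi> \<Longrightarrow> 0 < \<epsilon> \<Longrightarrow> \<exists>\<psi>\<in>F. fv \<psi> \<subseteq> fv \<phi> \<and>
       (\<forall>\<rho>. (\<forall>v\<in>fv \<phi>. \<rho> v \<in> carr U) \<longrightarrow> \<bar>val U \<rho> \<phi> - val U \<rho> \<psi>\<bar> < \<epsilon>)"
    using countable_dense_formulas[OF L(2) U] by metis
  define asg where "asg l v = (if v < length l then l ! v else a\<^sub>0)" for l and v :: nat
  define good where "good = (\<lambda>(\<psi>, v, t, k) l a. a \<in> carr U \<and>
      \<bar>val U ((asg l)(v := a)) \<psi> - real_of_rat t\<bar> < 1 / real (Suc k))"
  define wit where "wit d l = (if \<exists>a. good d l a then SOME a. good d l a else a\<^sub>0)" for d l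
  define fop where "fop f l = (if l \<in> tuples U (fun_ar L f) then fun_of U f l else a\<^sub>0)" for f l
  define G where "G = wit ` (F \<times> UNIV) \<union> fop ` sig_funs L"
  have wit: "good d l (wit d l)" if "good d l a" for d l a
    unfolding wit_def using that someI[of "good d l"] by auto
  have "countable G" using F(1) L(2) unfolding G_def countable_signature_def
    by (intro countable_Un countable_image countable_SIGMA) auto
  moreover have "countable (insert a\<^sub>0 A)" using A(1) by simp
  ultimately obtain S where S: "countable S" "insert a\<^sub>0 A \<subseteq> S" "\<And>g l. g \<in> G \<Longrightarrow> set l \<subseteq> S \<Longrightarrow> g l \<in> S"
    and least: "\<And>B. insert a\<^sub>0 A \<subseteq> B \<Longrightarrow> (\<And>g l. g \<in> G \<Longrightarrow> set l \<subseteq> B \<Longrightarrow> g l \<in> B) \<Longrightarrow> S \<subseteq> B"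
    by (metis countable_closure)
  have "wit d l \<in> carr U" for d l
  proof (cases "\<exists>a. good d l a")
    case True
    then show ?thesis using wit by (auto simp: good_def split: prod.splits)
  qed (simp add: wit_def a\<^sub>0)
  then have SU: "S \<subseteq> carr U"
    using A(2) a\<^sub>0 metric_structureD(5)[OF U] by (intro least) (auto simp: G_def fop_def)
  define M where "M = U\<lparr>carr := close_in U S\<rparr>"
  have funs: "fun_of U f a \<in> S" if "f \<in> sig_funs L" "a \<in> tuples U (fun_ar L f)" "set a \<subseteq> S" for f a
    using S(3)[of "fop f" a] that by (auto simp: G_def fop_def)
  have "S \<noteq> {}" using S(2) by blast
  have M: "metric_structure L M" "countable S \<Longrightarrow> separable M" "S \<subseteq> carr M" "carr M \<subseteq> carr U"
    unfolding M_def by (rule closed_substructure[OF L(1) U SU \<open>S \<noteq> {}\<close>]; use funs in blast)+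
  have UM: "metric_structure L M" by (rule M(1))
  interpret Metric_space "carr U" "mdist U" by (rule metric_structureD(2)[OF U])
  have near: "\<exists>s\<in>S. mdist U x s < \<delta>" if "x \<in> carr M" "0 < \<delta>" for x \<delta>
    using that unfolding M_def close_in_def by auto
  \<comment> \<open>Every value attained in U is approximately attained in M: replace the formula by one of the dense
    set and the parameters by nearby ones, and take the witness that was put into S.\<close>
  have witness: "\<exists>a\<in>carr M. \<bar>val U (\<rho>(v := a)) \<phi> - val U (\<rho>(v := b)) \<phi>\<bar> < \<epsilon>"
    if \<phi>: "wf_fmla L \<phi>" and \<rho>: "\<And>w. w \<in> fv \<phi> - {v} \<Longrightarrow> \<rho> w \<in> carr M" and b: "b \<in> carr U" and "0 < \<epsilon>" for \<phi> v \<rho> b \<epsilon>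
  proof -
    obtain k where k: "1 / real (Suc k) < \<epsilon> / 2"
      using reals_Archimedean[of "\<epsilon> / 2"] \<open>0 < \<epsilon>\<close> by (auto simp: inverse_eq_divide)
    define \<eta> where "\<eta> = 1 / real (Suc k) / 3"
    have "0 < \<eta>" and \<eta>3: "3 * \<eta> = 1 / real (Suc k)" by (simp_all add: \<eta>_def del: of_nat_Suc)
    obtain \<psi> where \<psi>: "\<psi> \<in> F" "fv \<psi> \<subseteq> fv \<phi>"
      "\<And>\<rho>. (\<forall>v\<in>fv \<phi>. \<rho> v \<in> carr U) \<Longrightarrow> \<bar>val U \<rho> \<phi> - val U \<rho> \<psi>\<bar> < \<eta>"
      using F(3)[OF \<phi> \<open>0 < \<eta>\<close>] by blast
    obtain \<delta> where \<delta>: "0 < \<delta>" "\<And>\<rho> \<rho>'. assignments_close U (fv \<phi>) \<delta> \<rho> \<rho>' \<Longrightarrow> \<bar>val U \<rho> \<phi> - val U \<rho>' \<phi>\<bar> < \<eta>"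
      using val_uniform[OF L(1) U \<phi> \<open>0 < \<eta>\<close>] by blast
    obtain q where q: "\<bar>val U (\<rho>(v := b)) \<phi> - of_rat q\<bar> < \<eta>"
    proof -
      obtain q where "val U (\<rho>(v := b)) \<phi> - \<eta> < of_rat q" "of_rat q < val U (\<rho>(v := b)) \<phi>"
        using of_rat_dense[of "val U (\<rho>(v := b)) \<phi> - \<eta>"] \<open>0 < \<eta>\<close> by (metis diff_gt_0_iff_gt diff_diff_eq2 add_diff_cancel_left')
      then show ?thesis using that[of q] by linarith
    qed
    have "\<forall>w. \<exists>s\<in>S. w \<in> fv \<phi> - {v} \<longrightarrow> mdist U (\<rho> w) s < \<delta>"
      using near[OF \<rho> \<open>0 < \<delta>\<close>] S(2) by blast
    then obtain r where r: "\<And>w. r w \<in> S" "\<And>w. w \<in> fv \<phi> - {v} \<Longrightarrow> mdist U (\<rho> w) (r w) < \<delta>" by metis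
    obtain n where n: "\<And>w. w \<in> fv \<phi> \<Longrightarrow> w < n" using finite_fv[of \<phi>] by (meson finite_nat_set_iff_bounded)
    define l where "l = map r [0..<n]"
    have l: "set l \<subseteq> S" using r(1) by (auto simp: l_def)
    have close: "assignments_close U (fv \<phi>) \<delta> (\<rho>(v := a)) ((asg l)(v := a))" if a: "a \<in> carr U" for a
      unfolding assignments_close_def
    proof (intro ballI)
      fix w assume w: "w \<in> fv \<phi>"
      show "(\<rho>(v := a)) w \<in> carr U \<and> ((asg l)(v := a)) w \<in> carr U \<and> mdist U ((\<rho>(v := a)) w) (((asg l)(v := a)) w) < \<delta>"
      proof (cases "w = v")
        case False
        then have "asg l w = r w" using n[OF w] by (simp add: asg_def l_def)
        then show ?thesis using False w r \<rho> SU M(4) by auto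
      qed (use a \<delta>(1) mdist_zero in auto)
    qed
    have near\<psi>: "\<bar>val U (\<rho>(v := a)) \<phi> - val U ((asg l)(v := a)) \<psi>\<bar> < 2 * \<eta>" if a: "a \<in> carr U" for a
    proof -
      have "\<forall>w\<in>fv \<phi>. ((asg l)(v := a)) w \<in> carr U" using close[OF a] by (auto simp: assignments_close_def)
      from \<psi>(3)[OF this] \<delta>(2)[OF close[OF a]] show ?thesis by linarith
    qed
    have "good (\<psi>, v, q, k) l b"
      using near\<psi>[OF b] q b \<eta>3 unfolding good_def by auto
    then have "good (\<psi>, v, q, k) l (wit (\<psi>, v, q, k) l)" by (rule wit)
    moreover have "wit (\<psi>, v, q, k) l \<in> S" by (rule S(3)[OF _ l]) (use \<psi>(1) in \<open>auto simp: G_def\<close>)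
    ultimately obtain a where a: "a \<in> S" "\<bar>val U ((asg l)(v := a)) \<psi> - of_rat q\<bar> < 1 / real (Suc k)"
      by (auto simp: good_def)
    have "\<bar>val U (\<rho>(v := a)) \<phi> - val U (\<rho>(v := b)) \<phi>\<bar> < \<epsilon>"
      using near\<psi>[of a] a SU q \<eta>3 k by auto
    then show ?thesis using a(1) M(3) by blast
  qed
  have val_eq: "val M \<rho> \<phi> = val U \<rho> \<phi>" if "wf_fmla L \<phi>" "\<And>v. v \<in> fv \<phi> \<Longrightarrow> \<rho> v \<in> carr M" for \<phi> \<rho>
    using that
  proof (induction \<phi> arbitrary: \<rho> rule: fmla_induct_Sup)
    case (Dist s t)
    then show ?case by (simp add: M_def)
  next
    case (Pred P ts)
    then show ?case by (simp add: M_def)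
  next
    case (Conn u \<phi>s)
    have "map (\<lambda>\<phi>. val M \<rho> \<phi>) \<phi>s = map (\<lambda>\<phi>. val U \<rho> \<phi>) \<phi>s"
      using Conn by (intro map_cong refl Conn.IH) auto
    then show ?case by (simp only: val.simps)
  next
    case (Sup_q v \<phi>)
    have wf: "wf_fmla L \<phi>" using Sup_q.prems(1) by simp
    have IH: "val M (\<rho>(v := a)) \<phi> = val U (\<rho>(v := a)) \<phi>" if "a \<in> carr M" for a
      by (rule Sup_q.IH[OF wf]) (use Sup_q.prems that in auto)
    have bdd: "bdd_above ((\<lambda>a. val U (\<rho>(v := a)) \<phi>) ` carr U)"
      by (rule bdd_val[OF U wf]) (use Sup_q.prems M(4) in auto)
    have "(SUP a\<in>carr M. val U (\<rho>(v := a)) \<phi>) = (SUP a\<in>carr U. val U (\<rho>(v := a)) \<phi>)"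
    proof (rule antisym)
      show "(SUP a\<in>carr M. val U (\<rho>(v := a)) \<phi>) \<le> (SUP a\<in>carr U. val U (\<rho>(v := a)) \<phi>)"
        by (rule cSUP_subset_mono[OF metric_structureD(1)[OF UM] bdd M(4)]) (rule order_refl)
      show "(SUP a\<in>carr U. val U (\<rho>(v := a)) \<phi>) \<le> (SUP a\<in>carr M. val U (\<rho>(v := a)) \<phi>)"
      proof (rule cSUP_least[OF metric_structureD(1)[OF U]], rule field_le_epsilon)
        fix b and \<epsilon> :: real assume "b \<in> carr U" "0 < \<epsilon>"
        then obtain a where a: "a \<in> carr M" "\<bar>val U (\<rho>(v := a)) \<phi> - val U (\<rho>(v := b)) \<phi>\<bar> < \<epsilon>"
          using witness[OF wf, of v \<rho> b \<epsilon>] Sup_q.prems(2) by auto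
        have "val U (\<rho>(v := a)) \<phi> \<le> (SUP a\<in>carr M. val U (\<rho>(v := a)) \<phi>)"
          by (rule cSUP_upper[OF a(1)]) (rule bdd_above_mono[OF bdd], use M(4) in blast)
        with a(2) show "val U (\<rho>(v := b)) \<phi> \<le> (SUP a\<in>carr M. val U (\<rho>(v := a)) \<phi>) + \<epsilon>" by linarith
      qed
    qed
    then show ?case using IH by simp
  next
    case (Inf_q v \<phi>)
    have "val M \<rho> (neg_fmla (Sup_q v (neg_fmla \<phi>))) = val U \<rho> (neg_fmla (Sup_q v (neg_fmla \<phi>)))"
      by (rule Inf_q.IH) (use Inf_q.prems in auto)
    moreover have "val M \<rho> (Inf_q v \<phi>) = val M \<rho> (neg_fmla (Sup_q v (neg_fmla \<phi>)))"
      by (rule val_Inf_neg[OF UM]) (use Inf_q.prems in auto)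
    moreover have "val U \<rho> (Inf_q v \<phi>) = val U \<rho> (neg_fmla (Sup_q v (neg_fmla \<phi>)))"
      by (rule val_Inf_neg[OF U]) (use Inf_q.prems M(4) in auto)
    ultimately show ?case by simp
  qed
  have "elementary_map L M (carr M) U id"
    unfolding elementary_map_def using val_eq M(4) by auto
  then show ?thesis using that[of M] M(1,2,3) S(1,2) by auto
qed

section \<open>Metric ultrapowers\<close>

text \<open>The distance from s k to the limit is bounded by the tail of the geometric series.\<close>

lemma halving_sequence_converges:
  assumes M: "Metric_space M d" "Metric_space.mcomplete M d" and s: "\<And>k. s k \<in> M"
    and step: "\<And>k. d (s k) (s (Suc k)) \<le> (1/2) ^ k"
  obtains z where "z \<in> M" "\<And>k. d (s k) z \<le> 2 * (1/2) ^ k"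
proof -
  interpret Metric_space M d by (rule M(1))
  have dist: "d (s k) (s (k + j)) \<le> 2 * (1/2) ^ k - 2 * (1/2) ^ (k + j)" for k j
  proof (induction j)
    case (Suc j)
    have "d (s k) (s (k + Suc j)) \<le> d (s k) (s (k + j)) + d (s (k + j)) (s (Suc (k + j)))"
      using triangle[OF s s s] by simp
    also have "\<dots> \<le> 2 * (1/2) ^ k - 2 * (1/2) ^ (k + j) + (1/2) ^ (k + j)"
      using Suc step[of "k + j"] by linarith
    finally show ?case by simp
  qed (simp add: s)
  have dist': "d (s k) (s n) \<le> 2 * (1/2) ^ k" if "k \<le> n" for k n
  proof -
    have "d (s k) (s n) \<le> 2 * (1/2) ^ k - 2 * (1/2) ^ n" using dist[of k "n - k"] that by simp
    moreover have "0 \<le> (1/2::real) ^ n" by simp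
    ultimately show ?thesis by linarith
  qed
  have "MCauchy s"
    unfolding MCauchy_def
  proof (intro conjI allI impI)
    fix \<epsilon> :: real assume "0 < \<epsilon>"
    then obtain N where N: "(1/2::real) ^ N < \<epsilon> / 4" using real_arch_pow_inv[of "\<epsilon> / 4" "1/2"] by auto
    have "d (s n) (s n') < \<epsilon>" if "N \<le> n" "N \<le> n'" for n n'
      using triangle[OF s[of n] s[of N] s[of n']] dist'[OF that(1)] dist'[OF that(2)] commute[of "s n" "s N"] N by linarith
    then show "\<exists>N. \<forall>n n'. N \<le> n \<longrightarrow> N \<le> n' \<longrightarrow> d (s n) (s n') < \<epsilon>" by blast
  qed (use s in auto)
  then obtain z where z: "limitin mtopology s z sequentially" using M(2) unfolding mcomplete_def by blast
  then have zM: "z \<in> M" and lim: "\<And>\<epsilon>. 0 < \<epsilon> \<Longrightarrow> \<exists>N. \<forall>n\<ge>N. s n \<in> M \<and> d (s n) z < \<epsilon>"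
    by (auto simp: limit_metric_sequentially)
  have "d (s k) z \<le> 2 * (1/2) ^ k" for k
  proof (rule field_le_epsilon)
    fix \<epsilon> :: real assume "0 < \<epsilon>"
    then obtain N where "\<forall>n\<ge>N. d (s n) z < \<epsilon>" using lim by blast
    then have "d (s (max k N)) z < \<epsilon>" by simp
    then show "d (s k) z \<le> 2 * (1/2) ^ k + \<epsilon>"
      using triangle[OF s s zM, of k "max k N"] dist'[of k "max k N"] by simp
  qed
  with zM that show ?thesis by blast
qed

definition seqs :: "('f, 'p, 'u) mstruct \<Rightarrow> (nat \<Rightarrow> 'u) set" where
  "seqs V = {x. \<forall>i. x i \<in> carr V}"

text \<open>The truncation at 1 changes nothing on sequences of the structure; it makes the limit exist and
  be nonnegative for all sequences, as a metric is required to be nonnegative also outside its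
  carrier.\<close>

definition udist :: "nat filter \<Rightarrow> ('f, 'p, 'u) mstruct \<Rightarrow> (nat \<Rightarrow> 'u) \<Rightarrow> (nat \<Rightarrow> 'u) \<Rightarrow> real" where
  "udist D V x y = ulim D (\<lambda>i. min 1 (mdist V (x i) (y i)))"

definition rep :: "nat filter \<Rightarrow> ('f, 'p, 'u) mstruct \<Rightarrow> (nat \<Rightarrow> 'u) \<Rightarrow> (nat \<Rightarrow> 'u)" where
  "rep D V x = (SOME z. z \<in> seqs V \<and> udist D V x z = 0)"

text \<open>The elements are chosen representatives of the classes of sequences at distance zero, so that
  the ultrapower lives on the type of sequences.\<close>

definition ultrapower :: "nat filter \<Rightarrow> ('f, 'p, 'u) mstruct \<Rightarrow> ('f, 'p, nat \<Rightarrow> 'u) mstruct" where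
  "ultrapower D V = \<lparr>carr = rep D V ` seqs V, mdist = udist D V,
     fun_of = (\<lambda>f a. rep D V (\<lambda>i. fun_of V f (map (\<lambda>x. x i) a))),
     pred_of = (\<lambda>P a. ulim D (\<lambda>i. pred_of V P (map (\<lambda>x. x i) a)))\<rparr>"

context
  fixes D :: "nat filter" and L :: "('f, 'p) msig" and V :: "('f, 'p, 'u) mstruct"
  assumes D: "ultrafilter D" and L: "signature L" and V: "metric_structure L V"
begin

interpretation V: Metric_space "carr V" "mdist V" by (rule metric_structureD(2)[OF V])

abbreviation (input) "R \<equiv> rep D V"

lemma D_not_bot: "D \<noteq> bot"
  by (rule ultrafilter_not_bot[OF D])

lemma udist_unit: "udist D V x y \<in> {0..1}"
  unfolding udist_def by (rule ulim_tendsto(2)[OF D]) simp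

lemma udist_tendsto:
  assumes "x \<in> seqs V" "y \<in> seqs V"
  shows "((\<lambda>i. mdist V (x i) (y i)) \<longlongrightarrow> udist D V x y) D"
proof -
  have "mdist V (x i) (y i) = min 1 (mdist V (x i) (y i))" for i
    using metric_structureD(4)[OF V, of "x i" "y i"] assms by (simp add: seqs_def)
  moreover have "((\<lambda>i. min 1 (mdist V (x i) (y i))) \<longlongrightarrow> udist D V x y) D"
    unfolding udist_def by (rule ulim_tendsto(1)[OF D]) simp
  ultimately show ?thesis by presburger
qed

lemma udist_refl: "x \<in> seqs V \<Longrightarrow> udist D V x x = 0"
  using udist_tendsto[of x x] by (auto simp: seqs_def intro: tendsto_unique[OF D_not_bot])

lemma udist_commute: "udist D V x y = udist D V y x"
  by (simp add: udist_def V.commute)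

lemma udist_triangle:
  assumes "x \<in> seqs V" "y \<in> seqs V" "z \<in> seqs V"
  shows "udist D V x z \<le> udist D V x y + udist D V y z"
proof (rule tendsto_le[OF D_not_bot tendsto_add])
  show "\<forall>\<^sub>F i in D. mdist V (x i) (z i) \<le> mdist V (x i) (y i) + mdist V (y i) (z i)"
    using assms by (intro always_eventually allI V.triangle) (auto simp: seqs_def)
qed (rule udist_tendsto; fact assms)+

lemma udist_le:
  assumes "x \<in> seqs V" "y \<in> seqs V" "\<forall>\<^sub>F i in D. mdist V (x i) (y i) \<le> c"
  shows "udist D V x y \<le> c"
  using tendsto_upperbound[OF udist_tendsto[OF assms(1,2)] assms(3) D_not_bot] .

lemma rep_seqs:
  assumes "x \<in> seqs V"
  shows "R x \<in> seqs V" "udist D V x (R x) = 0"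
proof -
  have "\<exists>z. z \<in> seqs V \<and> udist D V x z = 0" using assms udist_refl by blast
  from someI_ex[OF this] show "R x \<in> seqs V" "udist D V x (R x) = 0" by (simp_all add: rep_def)
qed

lemma udist_zero_cong:
  assumes "x \<in> seqs V" "x' \<in> seqs V" "y \<in> seqs V" "udist D V x x' = 0"
  shows "udist D V x y = udist D V x' y"
  using udist_triangle[of x x' y] udist_triangle[of x' x y] udist_commute[of x x'] assms by simp

lemma rep_eq:
  assumes "x \<in> seqs V" "y \<in> seqs V" "udist D V x y = 0"
  shows "R x = R y"
proof -
  have "z \<in> seqs V \<and> udist D V x z = 0 \<longleftrightarrow> z \<in> seqs V \<and> udist D V y z = 0" for z
    using udist_zero_cong[OF assms(1,2) _ assms(3), of z] by auto
  then show ?thesis by (simp add: rep_def)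
qed

lemma udist_rep:
  assumes "x \<in> seqs V" "y \<in> seqs V"
  shows "udist D V (R x) (R y) = udist D V x y"
proof -
  have "udist D V x (R y) = udist D V (R x) (R y)"
    by (rule udist_zero_cong) (use rep_seqs assms in auto)
  moreover have "udist D V y x = udist D V (R y) x"
    by (rule udist_zero_cong) (use rep_seqs assms in auto)
  ultimately show ?thesis by (simp add: udist_commute[of y] udist_commute[of "R y" x])
qed

lemma ultrapower_simps [simp]:
  "carr (ultrapower D V) = R ` seqs V" "mdist (ultrapower D V) = udist D V"
  "fun_of (ultrapower D V) f a = R (\<lambda>i. fun_of V f (map (\<lambda>x. x i) a))"
  "pred_of (ultrapower D V) P a = ulim D (\<lambda>i. pred_of V P (map (\<lambda>x. x i) a))"
  by (simp_all add: ultrapower_def)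

lemma coord_tuples: "set a \<subseteq> seqs V \<Longrightarrow> map (\<lambda>x. x i) a \<in> tuples V (length a)"
  by (auto simp: tuples_def seqs_def)

lemma eventually_tuples_close:
  assumes "set a \<subseteq> seqs V" "set b \<subseteq> seqs V" "length a = length b"
    and "\<And>j. j < length a \<Longrightarrow> udist D V (a ! j) (b ! j) < \<delta>"
  shows "\<forall>\<^sub>F i in D. tuples_close V \<delta> (map (\<lambda>x. x i) a) (map (\<lambda>x. x i) b)"
proof -
  have "\<forall>\<^sub>F i in D. \<forall>j\<in>{..<length a}. mdist V ((a ! j) i) ((b ! j) i) < \<delta>"
  proof (intro eventually_ball_finite ballI)
    fix j assume "j \<in> {..<length a}"
    then show "\<forall>\<^sub>F i in D. mdist V ((a ! j) i) ((b ! j) i) < \<delta>"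
      using assms by (intro order_tendstoD(2)[OF udist_tendsto]) (auto simp: subset_iff)
  qed simp
  then show ?thesis by eventually_elim (use assms(3) in \<open>auto simp: tuples_close_def\<close>)
qed

lemma fun_seqs:
  "f \<in> sig_funs L \<Longrightarrow> set a \<subseteq> seqs V \<Longrightarrow> length a = fun_ar L f \<Longrightarrow> (\<lambda>i. fun_of V f (map (\<lambda>x. x i) a)) \<in> seqs V"
  using metric_structureD(5)[OF V, of f] coord_tuples[of a] by (simp add: seqs_def)

lemma fun_close:
  assumes "f \<in> sig_funs L" "0 < \<epsilon>" "\<epsilon> \<le> 1" "set a \<subseteq> seqs V" "set b \<subseteq> seqs V" "length a = fun_ar L f" "length b = fun_ar L f"
    and "\<And>j. j < length a \<Longrightarrow> udist D V (a ! j) (b ! j) < fun_mod L f \<epsilon>"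
  shows "udist D V (\<lambda>i. fun_of V f (map (\<lambda>x. x i) a)) (\<lambda>i. fun_of V f (map (\<lambda>x. x i) b)) \<le> \<epsilon>"
proof (rule udist_le)
  have "\<forall>\<^sub>F i in D. tuples_close V (fun_mod L f \<epsilon>) (map (\<lambda>x. x i) a) (map (\<lambda>x. x i) b)"
    using assms by (intro eventually_tuples_close) auto
  then show "\<forall>\<^sub>F i in D. mdist V (fun_of V f (map (\<lambda>x. x i) a)) (fun_of V f (map (\<lambda>x. x i) b)) \<le> \<epsilon>"
  proof eventually_elim
    case (elim i)
    then show ?case using coord_tuples[OF assms(4)] coord_tuples[OF assms(5)] assms(6,7)
      by (intro metric_structureD(6)[OF V assms(1-3)]) auto
  qed
qed (use fun_seqs assms in auto)

lemma pred_tendsto: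
  assumes "P \<in> sig_preds L" "set a \<subseteq> seqs V" "length a = pred_ar L P"
  shows "((\<lambda>i. pred_of V P (map (\<lambda>x. x i) a)) \<longlongrightarrow> ulim D (\<lambda>i. pred_of V P (map (\<lambda>x. x i) a))) D"
    "ulim D (\<lambda>i. pred_of V P (map (\<lambda>x. x i) a)) \<in> {0..1}"
  using metric_structureD(7)[OF V assms(1)] coord_tuples[OF assms(2)] assms(3)
  by (intro ulim_tendsto[OF D]; simp)+

lemma pred_close:
  assumes "P \<in> sig_preds L" "0 < \<epsilon>" "\<epsilon> \<le> 1" "set a \<subseteq> seqs V" "set b \<subseteq> seqs V" "length a = pred_ar L P" "length b = pred_ar L P"
    and "\<And>j. j < length a \<Longrightarrow> udist D V (a ! j) (b ! j) < pred_mod L P \<epsilon>"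
  shows "\<bar>ulim D (\<lambda>i. pred_of V P (map (\<lambda>x. x i) a)) - ulim D (\<lambda>i. pred_of V P (map (\<lambda>x. x i) b))\<bar> \<le> \<epsilon>"
proof (rule tendsto_upperbound[OF tendsto_rabs[OF tendsto_diff] _ D_not_bot])
  have "\<forall>\<^sub>F i in D. tuples_close V (pred_mod L P \<epsilon>) (map (\<lambda>x. x i) a) (map (\<lambda>x. x i) b)"
    using assms by (intro eventually_tuples_close) auto
  then show "\<forall>\<^sub>F i in D. \<bar>pred_of V P (map (\<lambda>x. x i) a) - pred_of V P (map (\<lambda>x. x i) b)\<bar> \<le> \<epsilon>"
  proof eventually_elim
    case (elim i)
    then show ?case using coord_tuples[OF assms(4)] coord_tuples[OF assms(5)] assms(6,7)
      by (intro metric_structureD(8)[OF V assms(1-3)]) auto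
  qed
qed (rule pred_tendsto; fact assms)+

lemma ultrapower_Metric_space: "Metric_space (R ` seqs V) (udist D V)"
proof
  have carr: "x \<in> seqs V" "R x = x" if x: "x \<in> R ` seqs V" for x
  proof -
    obtain z where z: "z \<in> seqs V" "x = R z" using x by blast
    then show "x \<in> seqs V" using rep_seqs(1) by simp
    have "udist D V (R z) z = 0" using rep_seqs(2)[OF z(1)] by (simp add: udist_commute[of "R z"])
    then show "R x = x" using rep_eq[OF rep_seqs(1)[OF z(1)] z(1)] z(2) by simp
  qed
  show "udist D V x y = udist D V y x" for x y by (rule udist_commute)
  show "0 \<le> udist D V x y" for x y using udist_unit[of x y] by simp
  show "udist D V x y = 0 \<longleftrightarrow> x = y" if "x \<in> R ` seqs V" "y \<in> R ` seqs V" for x y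
  proof
    assume "udist D V x y = 0"
    then have "R x = R y" by (rule rep_eq[OF carr(1)[OF that(1)] carr(1)[OF that(2)]])
    then show "x = y" using carr(2)[OF that(1)] carr(2)[OF that(2)] by simp
  next
    assume "x = y"
    then show "udist D V x y = 0" using udist_refl[OF carr(1)[OF that(1)]] by simp
  qed
  show "udist D V x z \<le> udist D V x y + udist D V y z"
    if "x \<in> R ` seqs V" "y \<in> R ` seqs V" "z \<in> R ` seqs V" for x y z
    by (rule udist_triangle[OF carr(1)[OF that(1)] carr(1)[OF that(2)] carr(1)[OF that(3)]])
qed

text \<open>A rapidly converging sequence of classes has rapidly converging representatives, whose limit
  may be taken coordinatewise.\<close>

lemma ultrapower_mcomplete: "Metric_space.mcomplete (R ` seqs V) (udist D V)"
proof -
  interpret N: Metric_space "R ` seqs V" "udist D V" by (rule ultrapower_Metric_space)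
  have "\<exists>x. limitin N.mtopology \<sigma> x sequentially" if \<sigma>: "N.MCauchy \<sigma>" for \<sigma>
  proof -
    have \<sigma>_carr: "\<sigma> n \<in> R ` seqs V" for n using \<sigma> unfolding N.MCauchy_def by blast
    have \<sigma>_seqs: "\<sigma> n \<in> seqs V" for n using \<sigma>_carr[of n] rep_seqs(1) by (elim imageE) simp
    have cauchy: "\<exists>N. \<forall>n n'. N \<le> n \<longrightarrow> N \<le> n' \<longrightarrow> udist D V (\<sigma> n) (\<sigma> n') < \<epsilon>" if "0 < \<epsilon>" for \<epsilon>
      using \<sigma> that unfolding N.MCauchy_def by blast
    have "\<exists>N. \<forall>n n'. N \<le> n \<longrightarrow> N \<le> n' \<longrightarrow> udist D V (\<sigma> n) (\<sigma> n') < (1/2) ^ k" for k :: nat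
      by (rule cauchy) simp
    then obtain r' where r': "\<And>k n n'. r' k \<le> n \<Longrightarrow> r' k \<le> n' \<Longrightarrow> udist D V (\<sigma> n) (\<sigma> n') < (1/2) ^ k" by metis
    define r where "r k = (\<Sum>j\<le>k. Suc (r' j))" for k
    have r: "strict_mono r" by (rule strict_monoI_Suc) (simp add: r_def)
    have r'_le: "r' k \<le> r k" for k
    proof -
      have "Suc (r' k) \<le> r k" unfolding r_def by (rule member_le_sum) auto
      then show ?thesis by simp
    qed
    have step: "udist D V (\<sigma> (r k)) (\<sigma> n) < (1/2) ^ k" if "r k \<le> n" for k n
      by (rule r') (use r'_le[of k] that in auto)
    \<comment> \<open>Representatives that agree with the given classes but move by less than 1/2^k at step k in every
      coordinate: where the next representative is too far away, keep the old value.\<close>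
    define y where "y = rec_nat (\<sigma> (r 0)) (\<lambda>k yk i. if mdist V (yk i) (\<sigma> (r (Suc k)) i) < (1/2) ^ k then \<sigma> (r (Suc k)) i else yk i)"
    have y_Suc: "y (Suc k) i = (if mdist V (y k i) (\<sigma> (r (Suc k)) i) < (1/2) ^ k then \<sigma> (r (Suc k)) i else y k i)" for k i
      by (simp add: y_def)
    have y_seqs: "y k \<in> seqs V" for k
    proof (induction k)
      case (Suc k)
      then show ?case using \<sigma>_seqs[of "r (Suc k)"] unfolding seqs_def by (simp add: y_Suc)
    qed (simp add: y_def \<sigma>_seqs)
    have y_eq: "\<forall>\<^sub>F i in D. y k i = \<sigma> (r k) i" for k
    proof (induction k)
      case (Suc k)
      have "r k \<le> r (Suc k)" using r by (simp add: strict_mono_less_eq)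
      then have "\<forall>\<^sub>F i in D. mdist V (\<sigma> (r k) i) (\<sigma> (r (Suc k)) i) < (1/2) ^ k"
        by (intro order_tendstoD(2)[OF udist_tendsto[OF \<sigma>_seqs \<sigma>_seqs] step])
      with Suc show ?case by eventually_elim (simp add: y_Suc)
    qed (simp add: y_def)
    have "\<exists>z. z \<in> carr V \<and> (\<forall>k. mdist V (y k i) z \<le> 2 * (1/2) ^ k)" for i
    proof -
      have "mdist V (y k i) (y (Suc k) i) \<le> (1/2) ^ k" for k
        using y_seqs[of k] by (auto simp: y_Suc seqs_def)
      moreover have "y k i \<in> carr V" for k using y_seqs[of k] by (simp add: seqs_def)
      ultimately show ?thesis
        using halving_sequence_converges[OF metric_structureD(2,3)[OF V], of "\<lambda>k. y k i"] by blast
    qed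
    then obtain z where z: "\<And>i. z i \<in> carr V" "\<And>i k. mdist V (y k i) (z i) \<le> 2 * (1/2) ^ k" by metis
    have z_seqs: "z \<in> seqs V" using z(1) by (simp add: seqs_def)
    have close: "udist D V (\<sigma> (r k)) (R z) \<le> 2 * (1/2) ^ k" for k
    proof -
      have "\<forall>\<^sub>F i in D. mdist V (\<sigma> (r k) i) (z i) \<le> 2 * (1/2) ^ k"
        using y_eq[of k]
      proof eventually_elim
        case (elim i)
        with z(2)[of k i] show ?case by simp
      qed
      then have "udist D V (\<sigma> (r k)) z \<le> 2 * (1/2) ^ k" by (rule udist_le[OF \<sigma>_seqs z_seqs])
      then show ?thesis
        using udist_zero_cong[OF z_seqs rep_seqs(1)[OF z_seqs] \<sigma>_seqs[of "r k"] rep_seqs(2)[OF z_seqs]]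
        by (simp add: udist_commute[of z] udist_commute[of "R z"])
    qed
    have "limitin N.mtopology \<sigma> (R z) sequentially"
      unfolding N.limit_metric_sequentially
    proof (intro conjI allI impI)
      show "R z \<in> R ` seqs V" using z_seqs by blast
      fix \<epsilon> :: real assume "0 < \<epsilon>"
      then obtain k where k: "(1/2::real) ^ k < \<epsilon> / 3" using real_arch_pow_inv[of "\<epsilon> / 3" "1/2"] by auto
      have "udist D V (\<sigma> n) (R z) < \<epsilon>" if "r k \<le> n" for n
        using udist_triangle[OF \<sigma>_seqs[of n] \<sigma>_seqs[of "r k"] rep_seqs(1)[OF z_seqs]] step[OF that] close[of k] k
          udist_commute[of "\<sigma> n" "\<sigma> (r k)"] by linarith
      with \<sigma>_carr show "\<exists>N. \<forall>n\<ge>N. \<sigma> n \<in> R ` seqs V \<and> udist D V (\<sigma> n) (R z) < \<epsilon>" by blast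
    qed
    then show ?thesis by blast
  qed
  then show ?thesis unfolding N.mcomplete_def by blast
qed

lemma carr_ultrapower_seqs: "x \<in> carr (ultrapower D V) \<Longrightarrow> x \<in> seqs V"
  using rep_seqs(1) by auto

lemma ultrapower_metric_structure: "metric_structure L (ultrapower D V)"
proof -
  have tup: "set a \<subseteq> seqs V" "length a = n" if "a \<in> tuples (ultrapower D V) n" for a n
    using that carr_ultrapower_seqs unfolding tuples_def by auto
  have "seqs V \<noteq> {}" using metric_structureD(1)[OF V] by (auto simp: seqs_def)
  moreover have "udist D V x y \<le> 1" for x y using udist_unit[of x y] by simp
  moreover have "fun_of (ultrapower D V) f a \<in> carr (ultrapower D V)"
    if "f \<in> sig_funs L" "a \<in> tuples (ultrapower D V) (fun_ar L f)" for f a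
    using fun_seqs[OF that(1) tup[OF that(2)]] by simp
  moreover have "udist D V (fun_of (ultrapower D V) f a) (fun_of (ultrapower D V) f b) \<le> \<epsilon>"
    if "f \<in> sig_funs L" "\<epsilon> \<in> {0<..1}" "a \<in> tuples (ultrapower D V) (fun_ar L f)" "b \<in> tuples (ultrapower D V) (fun_ar L f)"
      "tuples_close (ultrapower D V) (fun_mod L f \<epsilon>) a b" for f \<epsilon> a b
    using fun_close[OF that(1) _ _ tup(1)[OF that(3)] tup(1)[OF that(4)] tup(2)[OF that(3)] tup(2)[OF that(4)], of \<epsilon>] that(2,5)
      udist_rep[OF fun_seqs[OF that(1) tup[OF that(3)]] fun_seqs[OF that(1) tup[OF that(4)]]]
    by (simp add: tuples_close_def)
  moreover have "pred_of (ultrapower D V) P a \<in> {0..1}"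
    if "P \<in> sig_preds L" "a \<in> tuples (ultrapower D V) (pred_ar L P)" for P a
    using pred_tendsto(2)[OF that(1) tup[OF that(2)]] by simp
  moreover have "\<bar>pred_of (ultrapower D V) P a - pred_of (ultrapower D V) P b\<bar> \<le> \<epsilon>"
    if "P \<in> sig_preds L" "\<epsilon> \<in> {0<..1}" "a \<in> tuples (ultrapower D V) (pred_ar L P)" "b \<in> tuples (ultrapower D V) (pred_ar L P)"
      "tuples_close (ultrapower D V) (pred_mod L P \<epsilon>) a b" for P \<epsilon> a b
    using pred_close[OF that(1) _ _ tup(1)[OF that(3)] tup(1)[OF that(4)] tup(2)[OF that(3)] tup(2)[OF that(4)], of \<epsilon>] that(2,5)
    by (simp add: tuples_close_def)
  ultimately show ?thesis
    unfolding metric_structure_def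
    using ultrapower_Metric_space ultrapower_mcomplete by (simp del: ultrapower_simps(3,4))
qed

lemma fun_cong_zero:
  assumes "f \<in> sig_funs L" "set a \<subseteq> seqs V" "set b \<subseteq> seqs V" "length a = fun_ar L f" "length b = fun_ar L f"
    and "\<And>j. j < length a \<Longrightarrow> udist D V (a ! j) (b ! j) = 0"
  shows "udist D V (\<lambda>i. fun_of V f (map (\<lambda>x. x i) a)) (\<lambda>i. fun_of V f (map (\<lambda>x. x i) b)) = 0"
proof (rule antisym)
  let ?d = "udist D V (\<lambda>i. fun_of V f (map (\<lambda>x. x i) a)) (\<lambda>i. fun_of V f (map (\<lambda>x. x i) b))"
  show "0 \<le> ?d" using udist_unit by simp
  show "?d \<le> 0"
  proof (rule field_le_epsilon)
    fix e :: real assume "0 < e"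
    then have "?d \<le> min 1 e"
      using assms L by (intro fun_close) (auto simp: signature_def)
    then show "?d \<le> 0 + e" by simp
  qed
qed

lemma pred_cong_zero:
  assumes "P \<in> sig_preds L" "set a \<subseteq> seqs V" "set b \<subseteq> seqs V" "length a = pred_ar L P" "length b = pred_ar L P"
    and "\<And>j. j < length a \<Longrightarrow> udist D V (a ! j) (b ! j) = 0"
  shows "ulim D (\<lambda>i. pred_of V P (map (\<lambda>x. x i) a)) = ulim D (\<lambda>i. pred_of V P (map (\<lambda>x. x i) b))"
proof -
  let ?d = "\<bar>ulim D (\<lambda>i. pred_of V P (map (\<lambda>x. x i) a)) - ulim D (\<lambda>i. pred_of V P (map (\<lambda>x. x i) b))\<bar>"
  have "?d \<le> 0"
  proof (rule field_le_epsilon)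
    fix e :: real assume "0 < e"
    then have "?d \<le> min 1 e"
      using assms L by (intro pred_close) (auto simp: signature_def)
    then show "?d \<le> 0 + e" by simp
  qed
  then show ?thesis by simp
qed

lemma trm_seqs:
  assumes "\<And>v. \<rho> v \<in> seqs V" and "wf_trm L t"
  shows "(\<lambda>i. trm_val V (\<lambda>v. \<rho> v i) t) \<in> seqs V"
  unfolding seqs_def using assms by (auto simp: seqs_def intro!: trm_val_in_carr[OF V])

lemma ultrapower_trm:
  assumes \<rho>: "\<And>v. \<rho> v \<in> seqs V"
  shows "wf_trm L t \<Longrightarrow> trm_val (ultrapower D V) (\<lambda>v. R (\<rho> v)) t = R (\<lambda>i. trm_val V (\<lambda>v. \<rho> v i) t)"
proof (induction t)
  case (Fn f ts)
  let ?tv = "\<lambda>t i. trm_val V (\<lambda>v. \<rho> v i) t"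
  have ts: "f \<in> sig_funs L" "length ts = fun_ar L f" "\<And>t. t \<in> set ts \<Longrightarrow> wf_trm L t" using Fn.prems by auto
  have tv: "?tv t \<in> seqs V" if "t \<in> set ts" for t using trm_seqs[OF \<rho> ts(3)[OF that]] .
  have "map (trm_val (ultrapower D V) (\<lambda>v. R (\<rho> v))) ts = map (\<lambda>t. R (?tv t)) ts"
    using Fn.IH ts(3) by (intro map_cong) auto
  then have "trm_val (ultrapower D V) (\<lambda>v. R (\<rho> v)) (Fn f ts) =
      R (\<lambda>i. fun_of V f (map (\<lambda>x. x i) (map (\<lambda>t. R (?tv t)) ts)))"
    by (simp only: trm_val.simps ultrapower_simps)
  also have "\<dots> = R (\<lambda>i. fun_of V f (map (\<lambda>x. x i) (map ?tv ts)))"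
  proof (rule rep_eq)
    have 1: "set (map (\<lambda>t. R (?tv t)) ts) \<subseteq> seqs V" "set (map ?tv ts) \<subseteq> seqs V"
      using tv rep_seqs(1)[OF tv] by auto
    show "(\<lambda>i. fun_of V f (map (\<lambda>x. x i) (map (\<lambda>t. R (?tv t)) ts))) \<in> seqs V"
      "(\<lambda>i. fun_of V f (map (\<lambda>x. x i) (map ?tv ts))) \<in> seqs V"
      by (rule fun_seqs[OF ts(1)]; use 1 ts(2) in simp)+
    show "udist D V (\<lambda>i. fun_of V f (map (\<lambda>x. x i) (map (\<lambda>t. R (?tv t)) ts)))
        (\<lambda>i. fun_of V f (map (\<lambda>x. x i) (map ?tv ts))) = 0"
    proof (rule fun_cong_zero[OF ts(1) 1])
      fix j assume "j < length (map (\<lambda>t. R (?tv t)) ts)"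
      then have j: "j < length ts" by simp
      then show "udist D V (map (\<lambda>t. R (?tv t)) ts ! j) (map ?tv ts ! j) = 0"
        using rep_seqs(2)[OF tv[OF nth_mem[OF j]]] udist_commute by simp
    qed (use ts(2) in simp_all)
  qed
  finally show ?case by (simp add: o_def)
qed simp

text \<open>The theorem of Los for continuous logic.  For a supremum, a sequence of witnesses is an element
  of the ultrapower, and approximate witnesses are enough for the supremum of the values.\<close>

theorem ultrapower_val:
  assumes "\<And>v. \<rho> v \<in> seqs V" and "wf_fmla L \<phi>"
  shows "((\<lambda>i. val V (\<lambda>v. \<rho> v i) \<phi>) \<longlongrightarrow> val (ultrapower D V) (\<lambda>v. R (\<rho> v)) \<phi>) D"
  using assms
proof (induction \<phi> arbitrary: \<rho> rule: fmla_induct_Sup)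
  case (Dist s t)
  then have wf: "wf_trm L s" "wf_trm L t" by auto
  show ?case
    using udist_tendsto[OF trm_seqs[OF Dist.prems(1) wf(1)] trm_seqs[OF Dist.prems(1) wf(2)]]
    by (simp add: ultrapower_trm[OF Dist.prems(1) wf(1)] ultrapower_trm[OF Dist.prems(1) wf(2)]
        udist_rep[OF trm_seqs[OF Dist.prems(1) wf(1)] trm_seqs[OF Dist.prems(1) wf(2)]])
next
  case (Pred P ts)
  let ?tv = "\<lambda>t i. trm_val V (\<lambda>v. \<rho> v i) t"
  have ts: "P \<in> sig_preds L" "length ts = pred_ar L P" "\<And>t. t \<in> set ts \<Longrightarrow> wf_trm L t" using Pred.prems by auto
  have tv: "?tv t \<in> seqs V" if "t \<in> set ts" for t using trm_seqs[OF Pred.prems(1) ts(3)[OF that]] .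
  have 1: "set (map (\<lambda>t. R (?tv t)) ts) \<subseteq> seqs V" "set (map ?tv ts) \<subseteq> seqs V"
    using tv rep_seqs(1)[OF tv] by auto
  have "map (trm_val (ultrapower D V) (\<lambda>v. R (\<rho> v))) ts = map (\<lambda>t. R (?tv t)) ts"
    using ultrapower_trm[OF Pred.prems(1) ts(3)] by (intro map_cong) auto
  then have "val (ultrapower D V) (\<lambda>v. R (\<rho> v)) (Pred P ts) =
      ulim D (\<lambda>i. pred_of V P (map (\<lambda>x. x i) (map (\<lambda>t. R (?tv t)) ts)))"
    by (simp only: val.simps ultrapower_simps)
  also have "\<dots> = ulim D (\<lambda>i. pred_of V P (map (\<lambda>x. x i) (map ?tv ts)))"
  proof (rule pred_cong_zero[OF ts(1) 1])
    fix j assume "j < length (map (\<lambda>t. R (?tv t)) ts)"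
    then have j: "j < length ts" by simp
    then show "udist D V (map (\<lambda>t. R (?tv t)) ts ! j) (map ?tv ts ! j) = 0"
      using rep_seqs(2)[OF tv[OF nth_mem[OF j]]] udist_commute by simp
  qed (use ts(2) in simp_all)
  finally have eq: "val (ultrapower D V) (\<lambda>v. R (\<rho> v)) (Pred P ts) =
      ulim D (\<lambda>i. pred_of V P (map (\<lambda>x. x i) (map ?tv ts)))" .
  have "length (map ?tv ts) = pred_ar L P" using ts(2) by simp
  from pred_tendsto(1)[OF ts(1) 1(2) this] show ?case unfolding eq by (simp add: o_def)
next
  case (Conn u \<phi>s)
  let ?N = "ultrapower D V"
  have wf: "connective (length \<phi>s) u" "\<And>\<phi>. \<phi> \<in> set \<phi>s \<Longrightarrow> wf_fmla L \<phi>" using Conn.prems(2) by auto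
  have \<rho>V: "\<rho> v i \<in> carr V" for v i using Conn.prems(1)[of v] by (simp add: seqs_def)
  have IH: "((\<lambda>i. val V (\<lambda>v. \<rho> v i) \<phi>) \<longlongrightarrow> val ?N (\<lambda>v. R (\<rho> v)) \<phi>) D" if "\<phi> \<in> set \<phi>s" for \<phi>
    by (rule Conn.IH[OF that Conn.prems(1) wf(2)[OF that]])
  have unitV: "set (map (val V (\<lambda>v. \<rho> v i)) \<phi>s) \<subseteq> {0..1}" for i
    using val_in_unit[OF V wf(2) \<rho>V] by auto
  have "val ?N (\<lambda>v. R (\<rho> v)) \<phi> \<in> {0..1}" if "\<phi> \<in> set \<phi>s" for \<phi>
    by (rule val_in_unit[OF ultrapower_metric_structure wf(2)[OF that]]) (use Conn.prems(1) in simp)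
  then have unitN: "set (map (val ?N (\<lambda>v. R (\<rho> v))) \<phi>s) \<subseteq> {0..1}" by auto
  show ?case
  proof (rule tendstoI)
    fix \<epsilon> :: real assume "0 < \<epsilon>"
    obtain \<delta> where \<delta>: "0 < \<delta>" "\<And>rs rs'. length rs = length \<phi>s \<Longrightarrow> length rs' = length \<phi>s \<Longrightarrow> set rs \<subseteq> {0..1} \<Longrightarrow>
      set rs' \<subseteq> {0..1} \<Longrightarrow> (\<And>i. i < length \<phi>s \<Longrightarrow> \<bar>rs ! i - rs' ! i\<bar> < \<delta>) \<Longrightarrow> \<bar>u (pad rs) - u (pad rs')\<bar> < \<epsilon>"
      using connective_uniform_pad[OF wf(1) \<open>0 < \<epsilon>\<close>] by blast
    have "\<forall>\<^sub>F i in D. \<forall>\<phi>\<in>set \<phi>s. \<bar>val V (\<lambda>v. \<rho> v i) \<phi> - val ?N (\<lambda>v. R (\<rho> v)) \<phi>\<bar> < \<delta>"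
      using tendstoD[OF IH \<delta>(1)] by (intro eventually_ball_finite) (auto simp: dist_real_def)
    then show "\<forall>\<^sub>F i in D. dist (val V (\<lambda>v. \<rho> v i) (Conn u \<phi>s)) (val ?N (\<lambda>v. R (\<rho> v)) (Conn u \<phi>s)) < \<epsilon>"
    proof eventually_elim
      case (elim i)
      show ?case unfolding dist_real_def val.simps
        by (rule \<delta>(2)) (use unitV[of i] unitN elim in auto)
    qed
  qed
next
  case (Sup_q v \<phi>)
  let ?N = "ultrapower D V"
  have wf: "wf_fmla L \<phi>" using Sup_q.prems(2) by simp
  have \<rho>V: "\<rho> w i \<in> carr V" for w i using Sup_q.prems(1)[of w] by (simp add: seqs_def)
  have IH: "((\<lambda>i. val V ((\<lambda>w. \<rho> w i)(v := z i)) \<phi>) \<longlongrightarrow> val ?N ((\<lambda>w. R (\<rho> w))(v := R z)) \<phi>) D" if "z \<in> seqs V" for z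
  proof -
    have "((\<lambda>i. val V (\<lambda>w. (\<rho>(v := z)) w i) \<phi>) \<longlongrightarrow> val ?N (\<lambda>w. R ((\<rho>(v := z)) w)) \<phi>) D"
      by (rule Sup_q.IH[OF _ wf]) (use Sup_q.prems(1) that in auto)
    moreover have "(\<lambda>w. (\<rho>(v := z)) w i) = (\<lambda>w. \<rho> w i)(v := z i)" for i by auto
    moreover have "(\<lambda>w. R ((\<rho>(v := z)) w)) = (\<lambda>w. R (\<rho> w))(v := R z)" by auto
    ultimately show ?thesis by simp
  qed
  have bddV: "bdd_above ((\<lambda>a. val V ((\<lambda>w. \<rho> w i)(v := a)) \<phi>) ` carr V)" for i
    by (rule bdd_val[OF V wf]) (rule \<rho>V)
  have bddN: "bdd_above ((\<lambda>a. val ?N ((\<lambda>w. R (\<rho> w))(v := a)) \<phi>) ` carr ?N)"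
    by (rule bdd_val[OF ultrapower_metric_structure wf]) (use Sup_q.prems(1) in simp)
  show ?case unfolding val.simps
  proof (rule order_tendstoI)
    fix c assume "c < (SUP a\<in>carr ?N. val ?N ((\<lambda>w. R (\<rho> w))(v := a)) \<phi>)"
    then obtain z where z: "z \<in> seqs V" "c < val ?N ((\<lambda>w. R (\<rho> w))(v := R z)) \<phi>"
      using less_cSUP_iff[OF metric_structureD(1)[OF ultrapower_metric_structure] bddN] by auto
    from order_tendstoD(1)[OF IH[OF z(1)] z(2)]
    show "\<forall>\<^sub>F i in D. c < (SUP a\<in>carr V. val V ((\<lambda>w. \<rho> w i)(v := a)) \<phi>)"
    proof eventually_elim
      case (elim i)
      have "z i \<in> carr V" using z(1) by (simp add: seqs_def)
      from cSUP_upper[OF this bddV[of i]] elim show ?case by linarith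
    qed
  next
    fix c assume c: "(SUP a\<in>carr ?N. val ?N ((\<lambda>w. R (\<rho> w))(v := a)) \<phi>) < c"
    define \<epsilon> where "\<epsilon> = (c - (SUP a\<in>carr ?N. val ?N ((\<lambda>w. R (\<rho> w))(v := a)) \<phi>)) / 2"
    have "0 < \<epsilon>" using c by (simp add: \<epsilon>_def)
    have "\<exists>a\<in>carr V. (SUP a\<in>carr V. val V ((\<lambda>w. \<rho> w i)(v := a)) \<phi>) - \<epsilon> < val V ((\<lambda>w. \<rho> w i)(v := a)) \<phi>" for i
      using \<open>0 < \<epsilon>\<close> by (intro less_cSUP_iff[OF metric_structureD(1)[OF V] bddV[of i], THEN iffD1]) simp
    then obtain z where z: "\<And>i. z i \<in> carr V"
      "\<And>i. (SUP a\<in>carr V. val V ((\<lambda>w. \<rho> w i)(v := a)) \<phi>) - \<epsilon> < val V ((\<lambda>w. \<rho> w i)(v := z i)) \<phi>" by metis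
    have z_seqs: "z \<in> seqs V" using z(1) by (simp add: seqs_def)
    have "val ?N ((\<lambda>w. R (\<rho> w))(v := R z)) \<phi> \<le> (SUP a\<in>carr ?N. val ?N ((\<lambda>w. R (\<rho> w))(v := a)) \<phi>)"
      by (rule cSUP_upper[OF _ bddN]) (use z_seqs in simp)
    then have "val ?N ((\<lambda>w. R (\<rho> w))(v := R z)) \<phi> < c - \<epsilon>" using c by (simp add: \<epsilon>_def field_simps)
    from order_tendstoD(2)[OF IH[OF z_seqs] this]
    show "\<forall>\<^sub>F i in D. (SUP a\<in>carr V. val V ((\<lambda>w. \<rho> w i)(v := a)) \<phi>) < c"
    proof eventually_elim
      case (elim i)
      with z(2)[of i] show ?case by linarith
    qed
  qed
next
  case (Inf_q v \<phi>)
  let ?\<psi> = "neg_fmla (Sup_q v (neg_fmla \<phi>))"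
  have "((\<lambda>i. val V (\<lambda>w. \<rho> w i) ?\<psi>) \<longlongrightarrow> val (ultrapower D V) (\<lambda>w. R (\<rho> w)) ?\<psi>) D"
    by (rule Inf_q.IH) (use Inf_q.prems in auto)
  moreover have "val V (\<lambda>w. \<rho> w i) (Inf_q v \<phi>) = val V (\<lambda>w. \<rho> w i) ?\<psi>" for i
    by (rule val_Inf_neg[OF V]) (use Inf_q.prems in \<open>auto simp: seqs_def\<close>)
  moreover have "val (ultrapower D V) (\<lambda>w. R (\<rho> w)) (Inf_q v \<phi>) = val (ultrapower D V) (\<lambda>w. R (\<rho> w)) ?\<psi>"
    by (rule val_Inf_neg[OF ultrapower_metric_structure]) (use Inf_q.prems in auto)
  ultimately show ?case by (simp only:)
qed

lemma diagonal_elementary: "elementary_embedding L V (ultrapower D V) (\<lambda>a. R (\<lambda>_. a))"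
  unfolding elementary_embedding_def elementary_map_def
proof (intro conjI allI impI)
  show "(\<lambda>a. R (\<lambda>_. a)) ` carr V \<subseteq> carr (ultrapower D V)" by (auto simp: seqs_def)
  fix \<phi> \<rho> assume *: "wf_fmla L \<phi> \<and> (\<forall>v\<in>fv \<phi>. \<rho> v \<in> carr V)"
  obtain c where c: "c \<in> carr V" using metric_structureD(1)[OF V] by blast
  define \<rho>' where "\<rho>' v = (if v \<in> fv \<phi> then \<rho> v else c)" for v
  have "((\<lambda>i. val V (\<lambda>v. (\<lambda>_. \<rho>' v) i) \<phi>) \<longlongrightarrow> val (ultrapower D V) (\<lambda>v. R (\<lambda>_. \<rho>' v)) \<phi>) D"
    by (rule ultrapower_val) (use * c in \<open>auto simp: \<rho>'_def seqs_def\<close>)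
  then have "val (ultrapower D V) (\<lambda>v. R (\<lambda>_. \<rho>' v)) \<phi> = val V \<rho>' \<phi>"
    by (rule tendsto_unique[OF D_not_bot _ tendsto_const])
  moreover have "val V \<rho>' \<phi> = val V \<rho> \<phi>"
    "val (ultrapower D V) (\<lambda>v. R (\<lambda>_. \<rho>' v)) \<phi> = val (ultrapower D V) ((\<lambda>a. R (\<lambda>_. a)) \<circ> \<rho>) \<phi>"
    by (rule val_cong; simp add: \<rho>'_def)+
  ultimately show "val (ultrapower D V) ((\<lambda>a. R (\<lambda>_. a)) \<circ> \<rho>) \<phi> = val V \<rho> \<phi>" by simp
qed simp

end

section \<open>Tuples, saturation and compactness\<close>

definition position :: "nat list \<Rightarrow> nat \<Rightarrow> nat" where
  "position xs v = (SOME j. j < length xs \<and> xs ! j = v)"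

lemma position:
  assumes "v \<in> set xs"
  shows "position xs v < length xs" "xs ! position xs v = v"
proof -
  have "\<exists>j. j < length xs \<and> xs ! j = v" using assms by (auto simp: in_set_conv_nth)
  from someI_ex[OF this] show "position xs v < length xs" "xs ! position xs v = v"
    unfolding position_def by auto
qed

lemma position_inject: "v \<in> set xs \<Longrightarrow> w \<in> set xs \<Longrightarrow> position xs v = position xs w \<longleftrightarrow> v = w"
  using position(2)[of v xs] position(2)[of w xs] by metis

lemma position_nth: "distinct xs \<Longrightarrow> j < length xs \<Longrightarrow> position xs (xs ! j) = j"
  using position[of "xs ! j" xs] by (simp add: nth_eq_iff_index_eq)

lemma pval_eq:
  assumes \<phi>: "partitioned_formula L \<phi> xs ys" and "length a = length xs" "length b = length ys"
    and x: "\<And>j. j < length xs \<Longrightarrow> \<rho> (xs ! j) = a ! j" and y: "\<And>j. j < length ys \<Longrightarrow> \<rho> (ys ! j) = b ! j"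
  shows "pval M \<phi> xs ys a b = val M \<rho> \<phi>"
  unfolding pval_def
proof (rule val_cong)
  fix v assume "v \<in> fv \<phi>"
  then have "v \<in> set (xs @ ys)" using \<phi> by (auto simp: partitioned_formula_def)
  then obtain k where k: "k < length (xs @ ys)" "v = (xs @ ys) ! k" by (metis in_set_conv_nth)
  have "map_of (zip (xs @ ys) (a @ b)) ((xs @ ys) ! k) = Some ((a @ b) ! k)"
    using \<phi> k assms(2,3) by (intro map_of_zip_nth) (auto simp: partitioned_formula_def)
  moreover have "(a @ b) ! k = \<rho> ((xs @ ys) ! k)"
    using k(1) assms(2,3) x[of k] y[of "k - length xs"] by (auto simp: nth_append)
  ultimately show "the (map_of (zip (xs @ ys) (a @ b)) v) = \<rho> v" using k(2) by simp
qed

lemma partitioned_swap: "partitioned_formula L \<phi> xs ys \<Longrightarrow> partitioned_formula L \<phi> ys xs"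
  by (auto simp: partitioned_formula_def)

lemma pval_swap:
  assumes \<phi>: "partitioned_formula L \<phi> xs ys" and "length a = length xs" "length b = length ys"
  shows "pval M \<phi> ys xs b a = pval M \<phi> xs ys a b"
proof -
  define \<rho> where "\<rho> v = (if v \<in> set xs then a ! position xs v else b ! position ys v)" for v
  have d: "distinct xs" "distinct ys" "set xs \<inter> set ys = {}" using \<phi> by (auto simp: partitioned_formula_def)
  have x: "\<rho> (xs ! j) = a ! j" if "j < length xs" for j using that d by (simp add: \<rho>_def position_nth)
  have y: "\<rho> (ys ! j) = b ! j" if "j < length ys" for j
    using nth_mem[OF that] d that by (auto simp: \<rho>_def position_nth)
  show ?thesis
    using pval_eq[OF \<phi> assms(2,3) x y, of M] pval_eq[OF partitioned_swap[OF \<phi>] assms(3,2) y x, of M] by simp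
qed

text \<open>
  Assignments code countably many x-tuples and y-tuples: the variables congruent to 0 and 1
  modulo 3 stand for the coordinates of the former and of the latter.
\<close>

text \<open>Renames the variables of a formula so that it speaks of the i-th x-tuple and the k-th y-tuple
  of an assignment; all other variables are moved to the numbers congruent to 2 modulo 3.\<close>

definition place :: "nat list \<Rightarrow> nat list \<Rightarrow> nat \<Rightarrow> nat \<Rightarrow> nat \<Rightarrow> nat" where
  "place xs ys i k v =
     (if v \<in> set xs then 3 * prod_encode (i, position xs v)
      else if v \<in> set ys then 3 * prod_encode (k, position ys v) + 1 else 3 * v + 2)"

lemma inj_place: "inj (place xs ys i k)"
proof (rule injI)
  fix v w assume eq: "place xs ys i k v = place xs ys i k w"
  have mod3: "place xs ys i k v mod 3 = (if v \<in> set xs then 0 else if v \<in> set ys then 1 else 2)" for v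
  proof -
    have "(3 * x + 1) mod 3 = 1" "(3 * x + 2) mod 3 = 2" for x :: nat by presburger+
    then show ?thesis by (simp add: place_def)
  qed
  have "(v \<in> set xs \<longleftrightarrow> w \<in> set xs) \<and> (v \<notin> set xs \<longrightarrow> (v \<in> set ys \<longleftrightarrow> w \<in> set ys))"
    using arg_cong[OF eq, of "\<lambda>x. x mod 3"] unfolding mod3 by (auto split: if_splits)
  with eq show "v = w"
    unfolding place_def by (cases "v \<in> set xs"; cases "v \<in> set ys") (simp_all add: position_inject)
qed

definition xtuple :: "(nat \<Rightarrow> 'u) \<Rightarrow> nat \<Rightarrow> nat \<Rightarrow> 'u list" where
  "xtuple \<rho> n i = map (\<lambda>j. \<rho> (3 * prod_encode (i, j))) [0..<n]"

definition ytuple :: "(nat \<Rightarrow> 'u) \<Rightarrow> nat \<Rightarrow> nat \<Rightarrow> 'u list" where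
  "ytuple \<rho> n k = map (\<lambda>j. \<rho> (3 * prod_encode (k, j) + 1)) [0..<n]"

lemma val_place:
  assumes \<phi>: "partitioned_formula L \<phi> xs ys"
  shows "val M \<rho> (ren (place xs ys i k) \<phi>) = pval M \<phi> xs ys (xtuple \<rho> (length xs) i) (ytuple \<rho> (length ys) k)"
proof -
  have d: "distinct xs" "distinct ys" "set xs \<inter> set ys = {}" using \<phi> by (auto simp: partitioned_formula_def)
  have "ys ! j \<notin> set xs" if "j < length ys" for j using nth_mem[OF that] d(3) by blast
  then have "pval M \<phi> xs ys (xtuple \<rho> (length xs) i) (ytuple \<rho> (length ys) k) = val M (\<rho> \<circ> place xs ys i k) \<phi>"
    using d by (intro pval_eq[OF \<phi>]) (auto simp: xtuple_def ytuple_def place_def position_nth)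
  then show ?thesis by (simp add: val_ren[OF inj_place])
qed

definition code_tuples :: "'u \<Rightarrow> nat \<Rightarrow> (nat \<Rightarrow> 'u list) \<Rightarrow> nat \<Rightarrow> (nat \<Rightarrow> 'u list) \<Rightarrow> nat \<Rightarrow> 'u" where
  "code_tuples c n a m b v = (case prod_decode (v div 3) of (i, j) \<Rightarrow>
     if v mod 3 = 0 \<and> j < n then a i ! j else if v mod 3 = 1 \<and> j < m then b i ! j else c)"

lemma xtuple_code: "length (a i) = n \<Longrightarrow> xtuple (code_tuples c n a m b) n i = a i"
  by (auto simp: xtuple_def code_tuples_def intro!: nth_equalityI)

lemma ytuple_code: "length (b i) = m \<Longrightarrow> ytuple (code_tuples c n a m b) m i = b i"
proof -
  have "(3 * x + 1) div 3 = x" "(3 * x + 1) mod 3 = 1" for x :: nat by presburger+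
  then show "length (b i) = m \<Longrightarrow> ytuple (code_tuples c n a m b) m i = b i"
    by (auto simp: ytuple_def code_tuples_def intro!: nth_equalityI)
qed

lemma code_tuples_carr:
  assumes "c \<in> carr M" "\<And>i. a i \<in> tuples M n" "\<And>i. b i \<in> tuples M m"
  shows "code_tuples c n a m b v \<in> carr M"
proof -
  have "a i ! j \<in> carr M" if "j < n" for i j using assms(2)[of i] that unfolding tuples_def by auto
  moreover have "b i ! j \<in> carr M" if "j < m" for i j using assms(3)[of i] that unfolding tuples_def by auto
  ultimately show ?thesis using assms(1) by (simp add: code_tuples_def split: prod.split)
qed

lemma tuples_nonempty: "metric_structure L M \<Longrightarrow> \<exists>t. t \<in> tuples M n"
proof -
  assume "metric_structure L M"
  then obtain c where "c \<in> carr M" using metric_structureD(1) by blast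
  then have "replicate n c \<in> tuples M n" by (auto simp: tuples_def)
  then show ?thesis ..
qed

lemma pval_unit:
  assumes M: "metric_structure L M" and \<phi>: "partitioned_formula L \<phi> xs ys"
    and "a \<in> tuples M (length xs)" "b \<in> tuples M (length ys)"
  shows "pval M \<phi> xs ys a b \<in> {0..1}"
proof -
  obtain c where c: "c \<in> carr M" using metric_structureD(1)[OF M] by blast
  let ?\<rho> = "code_tuples c (length xs) (\<lambda>_. a) (length ys) (\<lambda>_. b)"
  have "val M ?\<rho> (ren (place xs ys 0 0) \<phi>) \<in> {0..1}"
    by (rule val_in_unit[OF M]) (use \<phi> code_tuples_carr[OF c] assms(3,4) in \<open>auto simp: wf_ren partitioned_formula_def\<close>)
  then show ?thesis
    using assms(3,4) by (simp add: val_place[OF \<phi>] xtuple_code ytuple_code tuples_def)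
qed

text \<open>A type over M realized in an elementary extension is approximately realized in M, for finitely many
  parameters: the parameters are kept and the y-tuple is transferred.\<close>

lemma tuple_approx_in_submodel:
  assumes M: "metric_structure L M" and N: "metric_structure L N" and j: "elementary_embedding L M N j"
    and \<phi>: "partitioned_formula L \<phi> xs ys"
    and b: "b \<in> tuples N (length ys)" and B: "finite B" "B \<subseteq> tuples M (length xs)" and "0 < \<epsilon>"
  obtains b' where "b' \<in> tuples M (length ys)"
    "\<And>a. a \<in> B \<Longrightarrow> \<bar>pval M \<phi> xs ys a b' - pval N \<phi> xs ys (map j a) b\<bar> < \<epsilon>"
proof -
  obtain c where c: "c \<in> carr M" using metric_structureD(1)[OF M] by blast
  have j_carr: "j x \<in> carr N" if "x \<in> carr M" for x
    using j that by (auto simp: elementary_embedding_def elementary_map_def)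
  have j_val: "val N (j \<circ> \<rho>) \<theta> = val M \<rho> \<theta>" if "wf_fmla L \<theta>" "\<And>v. v \<in> fv \<theta> \<Longrightarrow> \<rho> v \<in> carr M" for \<theta> \<rho>
    using j that by (auto simp: elementary_embedding_def elementary_map_def)
  obtain l where l: "set l = B" using finite_list[OF B(1)] by blast
  obtain t where t: "t \<in> tuples M (length xs)" using tuples_nonempty[OF M] by blast
  obtain y where y: "y \<in> tuples M (length ys)" using tuples_nonempty[OF M] by blast
  define a where "a i = (if i < length l then l ! i else t)" for i
  have a: "a i \<in> tuples M (length xs)" for i using l B(2) t by (auto simp: a_def)
  then have ja: "map j (a i) \<in> tuples N (length xs)" for i
    using j_carr by (fastforce simp: tuples_def)
  define \<rho>M where "\<rho>M = code_tuples c (length xs) a (length ys) (\<lambda>_. y)"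
  define \<rho>N where "\<rho>N = code_tuples (j c) (length xs) (\<lambda>i. map j (a i)) (length ys) (\<lambda>_. b)"
  have \<rho>M: "\<rho>M v \<in> carr M" for v unfolding \<rho>M_def by (rule code_tuples_carr[OF c a y])
  have \<rho>N: "\<rho>N v \<in> carr N" for v unfolding \<rho>N_def by (rule code_tuples_carr[OF j_carr[OF c] ja b])
  have eq: "\<rho>N v = j (\<rho>M v)" if "v mod 3 = 0" for v
    using that a by (auto simp: \<rho>M_def \<rho>N_def code_tuples_def tuples_def split: prod.split)
  have agree: "val M \<rho>M \<theta> = val N \<rho>N \<theta>" if "wf_fmla L \<theta>" "fv \<theta> \<subseteq> {v. v mod 3 = 0}" for \<theta>
  proof -
    have "val N \<rho>N \<theta> = val N (j \<circ> \<rho>M) \<theta>" by (rule val_cong) (use that(2) eq in auto)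
    then show ?thesis using j_val[OF that(1), of \<rho>M] \<rho>M by simp
  qed
  have wf: "wf_fmla L \<psi>" if "\<psi> \<in> set (map (\<lambda>i. ren (place xs ys i 0) \<phi>) [0..<length l])" for \<psi>
    using that \<phi> by (auto simp: wf_ren partitioned_formula_def)
  obtain \<rho>' where \<rho>': "\<And>v. v \<in> {v. v mod 3 = 0} \<Longrightarrow> \<rho>' v = \<rho>M v" "\<And>v. \<rho>' v \<in> carr M"
    "\<And>\<psi>. \<psi> \<in> set (map (\<lambda>i. ren (place xs ys i 0) \<phi>) [0..<length l]) \<Longrightarrow> \<bar>val M \<rho>' \<psi> - val N \<rho>N \<psi>\<bar> < \<epsilon>"
    using approx_transfer[OF N M agree wf \<rho>N \<rho>M \<open>0 < \<epsilon>\<close>] by blast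
  have xt: "xtuple \<rho>' (length xs) i = a i" for i
  proof -
    have "xtuple \<rho>' (length xs) i = xtuple \<rho>M (length xs) i" unfolding xtuple_def by (simp add: \<rho>'(1))
    then show ?thesis using a[of i] by (simp add: \<rho>M_def xtuple_code tuples_def)
  qed
  have yt: "ytuple \<rho>' (length ys) 0 \<in> tuples M (length ys)" using \<rho>'(2) by (auto simp: ytuple_def tuples_def)
  have "\<bar>pval M \<phi> xs ys a' (ytuple \<rho>' (length ys) 0) - pval N \<phi> xs ys (map j a') b\<bar> < \<epsilon>" if "a' \<in> B" for a'
  proof -
    obtain i where i: "i < length l" "l ! i = a'" using \<open>a' \<in> B\<close> l by (metis in_set_conv_nth)
    then have "ren (place xs ys i 0) \<phi> \<in> set (map (\<lambda>i. ren (place xs ys i 0) \<phi>) [0..<length l])" by auto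
    from \<rho>'(3)[OF this] show ?thesis
      using i b ja[of i] by (simp add: val_place[OF \<phi>] xt) (simp add: \<rho>N_def xtuple_code ytuple_code tuples_def a_def)
  qed
  with yt that show ?thesis by blast
qed

text \<open>A finite shattering configuration is described, up to a small error, by a sentence.  The y-tuples
  are indexed by the codes of the finitely many relevant subsets.\<close>

lemma shatters_transfer:
  fixes M :: "('f, 'p, 'u) mstruct" and N :: "('f, 'p, 'v) mstruct"
  assumes M: "metric_structure L M" and N: "metric_structure L N" and \<phi>: "partitioned_formula L \<phi> xs ys"
    and agree: "\<And>\<sigma> \<rho> \<rho>'. wf_fmla L \<sigma> \<Longrightarrow> fv \<sigma> = {} \<Longrightarrow> val N \<rho>' \<sigma> = val M \<rho> \<sigma>"
    and sh: "shatters (pval M \<phi> xs ys) (tuples M (length xs)) (tuples M (length ys)) r s m" and "0 < \<epsilon>"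
  shows "shatters (pval N \<phi> xs ys) (tuples N (length xs)) (tuples N (length ys)) (r + \<epsilon>) (s - \<epsilon>) m"
proof -
  obtain e y where e: "\<And>k. k < m \<Longrightarrow> e k \<in> tuples M (length xs)" and y: "\<And>J. y J \<in> tuples M (length ys)"
    and ey: "\<And>J k. k < m \<Longrightarrow> if k \<in> J then pval M \<phi> xs ys (e k) (y J) < r else s < pval M \<phi> xs ys (e k) (y J)"
    using sh unfolding shatters_def by metis
  obtain c where c: "c \<in> carr M" using metric_structureD(1)[OF M] by blast
  obtain t where t: "t \<in> tuples M (length xs)" using tuples_nonempty[OF M] by blast
  define a where "a i = (if i < m then e i else t)" for i
  have a: "a i \<in> tuples M (length xs)" for i using e t by (simp add: a_def)
  define \<rho> where "\<rho> = code_tuples c (length xs) a (length ys) (\<lambda>k. y (set_decode k))"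
  have \<rho>: "\<rho> v \<in> carr M" for v unfolding \<rho>_def by (rule code_tuples_carr[OF c a y])
  define \<Psi> where "\<Psi> = (\<lambda>(i, k). ren (place xs ys i k) \<phi>) ` ({..<m} \<times> set_encode ` Pow {..<m})"
  have "finite \<Psi>" by (simp add: \<Psi>_def)
  then obtain \<psi>s where \<psi>s: "set \<psi>s = \<Psi>" using finite_list by blast
  have wf: "wf_fmla L \<psi>" if "\<psi> \<in> set \<psi>s" for \<psi>
    using that \<phi> \<psi>s by (auto simp: \<Psi>_def wf_ren partitioned_formula_def)
  obtain d where d: "d \<in> carr N" using metric_structureD(1)[OF N] by blast
  obtain \<rho>' where \<rho>': "\<And>v. \<rho>' v \<in> carr N" "\<And>\<psi>. \<psi> \<in> set \<psi>s \<Longrightarrow> \<bar>val N \<rho>' \<psi> - val M \<rho> \<psi>\<bar> < \<epsilon>"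
    using approx_transfer[OF M N, of "{}" "\<lambda>_. d" \<rho> \<psi>s \<epsilon>] agree wf \<rho> \<open>0 < \<epsilon>\<close> by auto
  have "if k \<in> J then pval N \<phi> xs ys (xtuple \<rho>' (length xs) k) (ytuple \<rho>' (length ys) (set_encode (J \<inter> {..<m}))) < r + \<epsilon>
      else s - \<epsilon> < pval N \<phi> xs ys (xtuple \<rho>' (length xs) k) (ytuple \<rho>' (length ys) (set_encode (J \<inter> {..<m})))"
    if k: "k < m" for k J
  proof -
    let ?J = "J \<inter> {..<m}"
    have "ren (place xs ys k (set_encode ?J)) \<phi> \<in> set \<psi>s" using k \<psi>s by (auto simp: \<Psi>_def)
    from \<rho>'(2)[OF this] have "\<bar>pval N \<phi> xs ys (xtuple \<rho>' (length xs) k) (ytuple \<rho>' (length ys) (set_encode ?J))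
        - pval M \<phi> xs ys (e k) (y ?J)\<bar> < \<epsilon>"
      using k a[of k] y by (simp add: val_place[OF \<phi>]) (simp add: \<rho>_def xtuple_code ytuple_code tuples_def a_def)
    then show ?thesis using ey[OF k, of ?J] k by (auto split: if_splits)
  qed
  moreover have "xtuple \<rho>' (length xs) k \<in> tuples N (length xs)" "ytuple \<rho>' (length ys) k \<in> tuples N (length ys)" for k
    using \<rho>'(1) by (auto simp: xtuple_def ytuple_def tuples_def)
  ultimately show ?thesis unfolding shatters_def by (intro exI[of _ "xtuple \<rho>' (length xs)"]) blast
qed

text \<open>Saturation is about exact values 0, and this formula expresses that a value lies in a closed
  interval.\<close>

definition interval_fmla :: "real \<Rightarrow> real \<Rightarrow> ('f, 'p) fmla \<Rightarrow> ('f, 'p) fmla" where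
  "interval_fmla lo hi \<psi> = Conn (\<lambda>z. min 1 (max 0 (max (lo - z 0) (z 0 - hi)))) [\<psi>]"

lemma wf_interval: "wf_fmla L \<psi> \<Longrightarrow> wf_fmla L (interval_fmla lo hi \<psi>)"
  unfolding interval_fmla_def by (auto simp: connective_def intro!: continuous_intros continuous_on_coord)

lemma val_interval: "val M \<rho> (interval_fmla lo hi \<psi>) = 0 \<longleftrightarrow> val M \<rho> \<psi> \<in> {lo..hi}"
  by (auto simp: interval_fmla_def pad_def min_def max_def)

lemma saturated_realize:
  assumes sat: "saturated_over L M A" and wf: "\<And>i. i \<in> I \<Longrightarrow> wf_fmla L (\<psi> i)"
    and par: "\<And>i v. i \<in> I \<Longrightarrow> v \<in> fv (\<psi> i) \<Longrightarrow> n \<le> v \<Longrightarrow> \<rho> i v \<in> A"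
    and fin: "\<And>J. finite J \<Longrightarrow> J \<subseteq> I \<Longrightarrow>
      \<exists>c\<in>tuples M n. \<forall>i\<in>J. val M (\<lambda>v. if v < n then c ! v else \<rho> i v) (\<psi> i) \<in> {lo i..hi i}"
  shows "\<exists>c\<in>tuples M n. \<forall>i\<in>I. val M (\<lambda>v. if v < n then c ! v else \<rho> i v) (\<psi> i) \<in> {lo i..hi i}"
proof -
  define g where "g i = (interval_fmla (lo i) (hi i) (\<psi> i), \<rho> i)" for i
  have g: "satisfies M c (g i) \<longleftrightarrow> val M (\<lambda>v. if v < n then c ! v else \<rho> i v) (\<psi> i) \<in> {lo i..hi i}"
    if "c \<in> tuples M n" for c i
    using that by (simp add: g_def satisfies_def tuples_def val_interval del: atLeastAtMost_iff)
  have "\<forall>\<gamma>\<in>g ` I. condition_over L A n \<gamma>"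
    using wf par by (auto simp: g_def condition_over_def intro!: wf_interval) (auto simp: interval_fmla_def)
  moreover have "\<exists>c\<in>tuples M n. \<forall>\<gamma>\<in>\<Delta>. satisfies M c \<gamma>" if \<Delta>: "finite \<Delta>" "\<Delta> \<subseteq> g ` I" for \<Delta>
  proof -
    obtain J where J: "J \<subseteq> I" "finite J" "\<Delta> = g ` J" using finite_subset_image[OF \<Delta>] by blast
    then show ?thesis using fin[OF J(2,1)] g by auto
  qed
  ultimately obtain c where "c \<in> tuples M n" "\<forall>\<gamma>\<in>g ` I. satisfies M c \<gamma>"
    using sat[unfolded saturated_over_def, rule_format, of "g ` I" n] by blast
  then show ?thesis using g by auto
qed

lemma realize_tuple:
  assumes sat: "saturated_over L M A" and \<phi>: "partitioned_formula L \<phi> xs ys"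
    and a: "\<And>i. i \<in> I \<Longrightarrow> a i \<in> tuples M (length xs) \<and> set (a i) \<subseteq> A"
    and fin: "\<And>J. finite J \<Longrightarrow> J \<subseteq> I \<Longrightarrow>
      \<exists>b\<in>tuples M (length ys). \<forall>i\<in>J. pval M \<phi> xs ys (a i) b \<in> {lo i..hi i}"
  shows "\<exists>b\<in>tuples M (length ys). \<forall>i\<in>I. pval M \<phi> xs ys (a i) b \<in> {lo i..hi i}"
proof -
  have d: "distinct xs" "distinct ys" "set xs \<inter> set ys = {}" "wf_fmla L \<phi>" "fv \<phi> \<subseteq> set xs \<union> set ys"
    using \<phi> by (auto simp: partitioned_formula_def)
  define n where "n = length ys"
  define \<sigma> where "\<sigma> v = (if v \<in> set ys then position ys v
      else if v \<in> set xs then n + 2 * position xs v else n + 2 * v + 1)" for v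
  have inj: "inj \<sigma>"
  proof (rule injI)
    fix v w assume eq: "\<sigma> v = \<sigma> w"
    have in_ys: "v \<in> set ys \<longleftrightarrow> \<sigma> v < n" for v using position(1)[of v ys] by (simp add: \<sigma>_def n_def)
    have in_xs: "v \<notin> set ys \<Longrightarrow> v \<in> set xs \<longleftrightarrow> even (\<sigma> v - n)" for v by (simp add: \<sigma>_def)
    have "v \<in> set ys \<longleftrightarrow> w \<in> set ys" by (simp only: in_ys eq)
    moreover from this have "v \<notin> set ys \<longrightarrow> (v \<in> set xs \<longleftrightarrow> w \<in> set xs)" using in_xs[of v] in_xs[of w] eq by metis
    ultimately show "v = w"
      using eq unfolding \<sigma>_def by (cases "v \<in> set ys"; cases "v \<in> set xs") (simp_all add: position_inject)
  qed
  define \<rho> where "\<rho> i v = a i ! ((v - n) div 2)" for i v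
  have val_eq: "val M (\<lambda>v. if v < n then b ! v else \<rho> i v) (ren \<sigma> \<phi>) = pval M \<phi> xs ys (a i) b"
    if "i \<in> I" "b \<in> tuples M n" for i b
  proof -
    have "xs ! j \<notin> set ys" if "j < length xs" for j using nth_mem[OF that] d(3) by blast
    then have "pval M \<phi> xs ys (a i) b = val M ((\<lambda>v. if v < n then b ! v else \<rho> i v) \<circ> \<sigma>) \<phi>"
      using a[OF that(1)] that(2) d by (intro pval_eq[OF \<phi>]) (auto simp: \<sigma>_def \<rho>_def n_def position_nth tuples_def)
    then show ?thesis by (simp add: val_ren[OF inj])
  qed
  have "\<exists>c\<in>tuples M n. \<forall>i\<in>I. val M (\<lambda>v. if v < n then c ! v else \<rho> i v) (ren \<sigma> \<phi>) \<in> {lo i..hi i}"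
  proof (rule saturated_realize[OF sat])
    show "wf_fmla L (ren \<sigma> \<phi>)" by (simp add: wf_ren d(4))
    show "\<rho> i v \<in> A" if "i \<in> I" and v: "v \<in> fv (ren \<sigma> \<phi>)" "n \<le> v" for i v
    proof -
      obtain w where w: "w \<in> fv \<phi>" "v = \<sigma> w" using v(1) by (auto simp: fv_ren[OF inj])
      have "w \<notin> set ys" using position(1)[of w ys] v(2) w(2) by (auto simp: \<sigma>_def n_def)
      then have "w \<in> set xs" "v = n + 2 * position xs w" using w d(5) by (auto simp: \<sigma>_def)
      then have "\<rho> i v = a i ! position xs w" by (simp add: \<rho>_def)
      moreover have "position xs w < length (a i)" using position(1)[OF \<open>w \<in> set xs\<close>] a[OF \<open>i \<in> I\<close>] by (simp add: tuples_def)
      ultimately show ?thesis using a[OF \<open>i \<in> I\<close>] nth_mem by auto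
    qed
    show "\<exists>c\<in>tuples M n. \<forall>i\<in>J. val M (\<lambda>v. if v < n then c ! v else \<rho> i v) (ren \<sigma> \<phi>) \<in> {lo i..hi i}"
      if J: "finite J" "J \<subseteq> I" for J
    proof -
      obtain b where "b \<in> tuples M n" "\<forall>i\<in>J. pval M \<phi> xs ys (a i) b \<in> {lo i..hi i}"
        using fin[OF J] n_def by blast
      then show ?thesis using val_eq J(2) by (intro bexI[of _ b]) (auto simp del: atLeastAtMost_iff)
    qed
  qed
  then obtain b where "b \<in> tuples M n" "\<forall>i\<in>I. val M (\<lambda>v. if v < n then b ! v else \<rho> i v) (ren \<sigma> \<phi>) \<in> {lo i..hi i}"
    by blast
  then show ?thesis using val_eq by (intro bexI[of _ b]) (auto simp: n_def simp del: atLeastAtMost_iff)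
qed

text \<open>
  Compactness: the limit along an ultrafilter of the types of infinite tuples is realized, one
  coordinate at a time, each over the finitely many earlier ones.
\<close>

lemma realize_sequence:
  assumes U: "metric_structure L U" and sat: "\<And>A. finite A \<Longrightarrow> A \<subseteq> carr U \<Longrightarrow> saturated_over L U A"
    and D: "ultrafilter (D :: nat filter)" and \<rho>: "\<And>m v. \<rho> m v \<in> carr U"
  shows "\<exists>c. (\<forall>v. c v \<in> carr U) \<and> (\<forall>\<theta>. wf_fmla L \<theta> \<longrightarrow> ((\<lambda>m. val U (\<rho> m) \<theta>) \<longlongrightarrow> val U c \<theta>) D)"
proof -
  define t where "t \<theta> = ulim D (\<lambda>m. val U (\<rho> m) \<theta>)" for \<theta>
  have t: "((\<lambda>m. val U (\<rho> m) \<theta>) \<longlongrightarrow> t \<theta>) D" if "wf_fmla L \<theta>" for \<theta>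
    unfolding t_def by (rule ulim_tendsto[OF D]) (rule val_in_unit[OF U that \<rho>])
  define Good where "Good cs \<longleftrightarrow> set cs \<subseteq> carr U \<and>
      (\<forall>\<theta>. wf_fmla L \<theta> \<and> fv \<theta> \<subseteq> {..<length cs} \<longrightarrow> val U (\<lambda>v. cs ! v) \<theta> = t \<theta>)" for cs
  have "Good []"
    unfolding Good_def
  proof (intro conjI allI impI)
    fix \<theta> :: "('a, 'b) fmla" assume "wf_fmla L \<theta> \<and> fv \<theta> \<subseteq> {..<length ([] :: 'c list)}"
    then have wf: "wf_fmla L \<theta>" and "fv \<theta> = {}" by auto
    then have "val U (\<rho> m) \<theta> = val U (\<lambda>v. [] ! v) \<theta>" for m by (intro val_cong) auto
    then have "((\<lambda>m. val U (\<rho> m) \<theta>) \<longlongrightarrow> val U (\<lambda>v. [] ! v) \<theta>) D" by simp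
    from ulim_eq[OF D this] show "val U (\<lambda>v. [] ! v) \<theta> = t \<theta>" by (simp add: t_def)
  qed simp
  have step: "\<exists>x. Good (cs @ [x])" if cs: "Good cs" for cs
  proof -
    define k where "k = length cs"
    have cs_carr: "cs ! v \<in> carr U" if "v < k" for v using cs that nth_mem[of v cs] by (auto simp: Good_def k_def)
    define \<sigma> where "\<sigma> v = (if v = k then 0 else Suc v)" for v
    have inj: "inj \<sigma>" by (auto simp: inj_def \<sigma>_def)
    define I where "I = {\<theta>. wf_fmla L \<theta> \<and> fv \<theta> \<subseteq> {..k}} \<times> (UNIV :: nat set)"
    have val_eq: "val U (\<lambda>v. if v < 1 then c ! v else cs ! (v - 1)) (ren \<sigma> \<theta>) = val U (\<lambda>v. (cs @ [c ! 0]) ! v) \<theta>"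
      if "fv \<theta> \<subseteq> {..k}" for \<theta> :: "('a, 'b) fmla" and c
      unfolding val_ren[OF inj]
      by (rule val_cong) (use that in \<open>auto simp: \<sigma>_def nth_append k_def\<close>)
    have "\<exists>c\<in>tuples U 1. \<forall>i\<in>I. val U (\<lambda>v. if v < 1 then c ! v else cs ! (v - 1)) (ren \<sigma> (fst i)) \<in>
        {t (fst i) - 1 / Suc (snd i)..t (fst i) + 1 / Suc (snd i)}"
    proof (rule saturated_realize[where A = "set cs" and \<rho> = "\<lambda>_ v. cs ! (v - 1)"])
      show "saturated_over L U (set cs)" using cs by (intro sat) (auto simp: Good_def)
      show "wf_fmla L (ren \<sigma> (fst i))" if "i \<in> I" for i using that by (auto simp: I_def wf_ren)
      show "cs ! (v - 1) \<in> set cs" if "i \<in> I" and v: "v \<in> fv (ren \<sigma> (fst i))" "1 \<le> v" for i v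
      proof -
        obtain w where w: "w \<in> fv (fst i)" "v = \<sigma> w" using v(1) by (auto simp: fv_ren[OF inj])
        then have "w \<le> k" using \<open>i \<in> I\<close> by (auto simp: I_def)
        with w show ?thesis using v(2) by (auto simp: \<sigma>_def k_def split: if_splits)
      qed
      fix J assume J: "finite J" "J \<subseteq> I"
      obtain \<epsilon> where \<epsilon>: "0 < \<epsilon>" "\<And>i. i \<in> J \<Longrightarrow> \<epsilon> \<le> 1 / real (Suc (snd i))"
        by (rule finite_gap[OF J(1), of "\<lambda>i. 1 / real (Suc (snd i))"]) auto
      define \<eta> where "\<eta> = min 1 \<epsilon> / 2"
      have \<eta>: "0 < \<eta>" "\<eta> < min 1 \<epsilon>" using \<epsilon>(1) by (auto simp: \<eta>_def)
      obtain \<theta>s where \<theta>s: "set \<theta>s = fst ` J" using finite_list[of "fst ` J"] J(1) by auto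
      have wf\<theta>: "wf_fmla L \<theta>" "fv \<theta> \<subseteq> {..k}" if "\<theta> \<in> set \<theta>s" for \<theta> using that J(2) \<theta>s by (auto simp: I_def)
      \<comment> \<open>The formula that a next element approximately realizes the conditions in J is satisfied by the
        given tuples in the limit, hence by the elements found so far.\<close>
      define near where "near = near_fmla \<theta>s (map t \<theta>s)"
      have wf_nu: "wf_fmla L near" unfolding near_def by (rule wf_near) (rule wf\<theta>(1))
      have fv_nu: "fv near \<subseteq> {..k}" using wf\<theta>(2) by (auto simp: near_def)
      define inf_near where "inf_near = foldr Inf_q [k] near"
      have wf_chi: "wf_fmla L inf_near" "fv inf_near \<subseteq> {..<k}" using wf_nu fv_nu by (auto simp: inf_near_def order.strict_iff_order)
      have "((\<lambda>m. val U (\<rho> m) near) \<longlongrightarrow> min 1 (\<Sum>j<length \<theta>s. \<bar>t (\<theta>s ! j) - t (\<theta>s ! j)\<bar>)) D"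
      proof -
        have "val U (\<rho> m) near = min 1 (\<Sum>j<length \<theta>s. \<bar>val U (\<rho> m) (\<theta>s ! j) - t (\<theta>s ! j)\<bar>)" for m
          by (simp add: near_def near_fmla_def pad_def)
        moreover have "((\<lambda>m. min 1 (\<Sum>j<length \<theta>s. \<bar>val U (\<rho> m) (\<theta>s ! j) - t (\<theta>s ! j)\<bar>)) \<longlongrightarrow>
            min 1 (\<Sum>j<length \<theta>s. \<bar>t (\<theta>s ! j) - t (\<theta>s ! j)\<bar>)) D"
          by (intro tendsto_min tendsto_sum tendsto_rabs tendsto_diff tendsto_const t wf\<theta>(1)) simp
        ultimately show ?thesis by simp
      qed
      then have "\<forall>\<^sub>F m in D. val U (\<rho> m) near < \<eta>" using \<eta>(1) by (intro order_tendstoD(2)) simp_all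
      then have "\<forall>\<^sub>F m in D. val U (\<rho> m) inf_near \<le> \<eta>"
      proof eventually_elim
        case (elim m)
        have "val U (\<rho> m) inf_near < \<eta>" unfolding inf_near_def
          by (subst val_Inf_list[OF U wf_nu]) (use \<rho> elim in \<open>auto intro!: exI[of _ "\<rho> m"]\<close>)
        then show ?case by simp
      qed
      then have "t inf_near \<le> \<eta>" by (rule tendsto_upperbound[OF t[OF wf_chi(1)] _ ultrafilter_not_bot[OF D]])
      moreover have "val U (\<lambda>v. cs ! v) inf_near = t inf_near" using cs wf_chi by (auto simp: Good_def k_def)
      ultimately have "val U (\<lambda>v. cs ! v) (foldr Inf_q [k] near) < min 1 \<epsilon>" using \<eta>(2) by (simp only: inf_near_def)
      moreover have "cs ! v \<in> carr U" if "v \<in> fv near - set [k]" for v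
        using that fv_nu by (intro cs_carr) (auto simp: order.strict_iff_order)
      ultimately obtain \<rho>' where \<rho>': "\<forall>v. v \<notin> set [k] \<longrightarrow> \<rho>' v = cs ! v" "\<rho>' k \<in> carr U" "val U \<rho>' near < min 1 \<epsilon>"
        using val_Inf_list[OF U wf_nu, of "[k]" "\<lambda>v. cs ! v" "min 1 \<epsilon>"] by auto
      show "\<exists>c\<in>tuples U 1. \<forall>i\<in>J. val U (\<lambda>v. if v < 1 then c ! v else cs ! (v - 1)) (ren \<sigma> (fst i)) \<in>
        {t (fst i) - 1 / Suc (snd i)..t (fst i) + 1 / Suc (snd i)}"
      proof (intro bexI[of _ "[\<rho>' k]"] ballI)
        fix i assume i: "i \<in> J"
        then have \<theta>: "fst i \<in> set \<theta>s" using \<theta>s by auto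
        have "val U (\<lambda>v. (cs @ [[\<rho>' k] ! 0]) ! v) (fst i) = val U \<rho>' (fst i)"
          by (rule val_cong) (use wf\<theta>(2)[OF \<theta>] \<rho>'(1) in \<open>auto simp: nth_append k_def\<close>)
        moreover have "\<bar>val U \<rho>' (fst i) - t (fst i)\<bar> < min 1 \<epsilon>"
          by (rule val_near_less[OF \<rho>'(3)[unfolded near_def] _ \<theta>]) simp
        ultimately have "\<bar>val U (\<lambda>v. if v < 1 then [\<rho>' k] ! v else cs ! (v - 1)) (ren \<sigma> (fst i)) - t (fst i)\<bar> < 1 / Suc (snd i)"
          unfolding val_eq[OF wf\<theta>(2)[OF \<theta>]] using \<epsilon>(2)[OF i] by linarith
        then show "val U (\<lambda>v. if v < 1 then [\<rho>' k] ! v else cs ! (v - 1)) (ren \<sigma> (fst i)) \<in>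
          {t (fst i) - 1 / Suc (snd i)..t (fst i) + 1 / Suc (snd i)}"
          unfolding atLeastAtMost_iff by linarith
      qed (use \<rho>'(2) in \<open>simp add: tuples_def\<close>)
    qed
    then obtain c where c: "c \<in> tuples U 1"
      "\<And>i. i \<in> I \<Longrightarrow> val U (\<lambda>v. if v < 1 then c ! v else cs ! (v - 1)) (ren \<sigma> (fst i)) \<in>
        {t (fst i) - 1 / Suc (snd i)..t (fst i) + 1 / Suc (snd i)}" by blast
    have "val U (\<lambda>v. (cs @ [c ! 0]) ! v) \<theta> = t \<theta>" if \<theta>: "wf_fmla L \<theta>" "fv \<theta> \<subseteq> {..k}" for \<theta>
    proof -
      have close: "\<bar>val U (\<lambda>v. (cs @ [c ! 0]) ! v) \<theta> - t \<theta>\<bar> \<le> 1 / Suc l" for l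
      proof -
        have "(\<theta>, l) \<in> I" using \<theta> by (simp add: I_def)
        from c(2)[OF this] show ?thesis
          unfolding fst_conv snd_conv val_eq[OF \<theta>(2)] atLeastAtMost_iff by linarith
      qed
      have "\<bar>val U (\<lambda>v. (cs @ [c ! 0]) ! v) \<theta> - t \<theta>\<bar> \<le> 0"
      proof (rule field_le_epsilon)
        fix e :: real assume "0 < e"
        then obtain l where "1 / real (Suc l) < e" using reals_Archimedean by (auto simp: inverse_eq_divide)
        with close[of l] show "\<bar>val U (\<lambda>v. (cs @ [c ! 0]) ! v) \<theta> - t \<theta>\<bar> \<le> 0 + e" by linarith
      qed
      then show ?thesis by simp
    qed
    moreover have "c ! 0 \<in> carr U" using c(1) nth_mem[of 0 c] by (auto simp: tuples_def)
    ultimately have "Good (cs @ [c ! 0])"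
      using cs unfolding Good_def by (auto simp: k_def lessThan_Suc_atMost)
    then show ?thesis ..
  qed
  have "\<exists>cs. \<forall>n. (Good (cs n) \<and> length (cs n) = n) \<and> (\<exists>x. cs (Suc n) = cs n @ [x])"
    by (rule dependent_nat_choice) (use \<open>Good []\<close> step in \<open>force+\<close>)
  then obtain cs where cs: "\<And>n. Good (cs n)" "\<And>n. length (cs n) = n" "\<And>n. \<exists>x. cs (Suc n) = cs n @ [x]" by blast
  define c where "c v = cs (Suc v) ! v" for v
  have prefix: "cs n ! v = c v" if "v < n" for n v
    using that
  proof (induction n)
    case (Suc n)
    show ?case
    proof (cases "v = n")
      case False
      then have "v < n" using Suc.prems by simp
      moreover obtain x where "cs (Suc n) = cs n @ [x]" using cs(3) by blast
      ultimately show ?thesis using Suc.IH cs(2)[of n] by (simp add: nth_append)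
    qed (simp add: c_def)
  qed simp
  show ?thesis
  proof (intro exI[of _ c] conjI allI impI)
    show "c v \<in> carr U" for v
      using cs(1)[of "Suc v"] nth_mem[of v "cs (Suc v)"] cs(2)[of "Suc v"] by (auto simp: Good_def c_def)
    fix \<theta> assume \<theta>: "wf_fmla L \<theta>"
    obtain n where n: "fv \<theta> \<subseteq> {..<n}" using finite_fv[of \<theta>] by (auto simp: finite_nat_iff_bounded)
    have "val U c \<theta> = val U (\<lambda>v. cs n ! v) \<theta>" by (rule val_cong) (use n prefix in auto)
    also have "\<dots> = t \<theta>" using cs(1)[of n] cs(2)[of n] \<theta> n by (auto simp: Good_def)
    finally show "((\<lambda>m. val U (\<rho> m) \<theta>) \<longlongrightarrow> val U c \<theta>) D" using t[OF \<theta>] by simp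
  qed
qed

text \<open>The configurations of length m, together with their y-tuples for all subsets, are coded as
  assignments; the limit of their types is realized by an infinite sequence with exact bounds.  The
  y-tuple for a finite set E is found among the coordinates of this realization.\<close>

theorem has_IP_of_shattering:
  assumes U: "metric_structure L U" and sat: "\<And>A. finite A \<Longrightarrow> A \<subseteq> carr U \<Longrightarrow> saturated_over L U A"
    and \<phi>: "partitioned_formula L \<phi> xs ys"
    and "r < s" and sh: "\<And>m. shatters (pval U \<phi> xs ys) (tuples U (length xs)) (tuples U (length ys)) r s m"
  shows "has_IP U \<phi> xs ys"
proof -
  obtain D :: "nat filter" where D: "ultrafilter D" "D \<le> sequentially" by (rule ultrafilter_at_top)
  obtain d where d: "d \<in> carr U" using metric_structureD(1)[OF U] by blast
  obtain t where t: "t \<in> tuples U (length xs)" using tuples_nonempty[OF U] by blast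
  define W where "W m p \<longleftrightarrow> (\<forall>i. fst p i \<in> tuples U (length xs)) \<and> (\<forall>J. snd p J \<in> tuples U (length ys)) \<and>
      (\<forall>J. \<forall>i<m. if i \<in> J then pval U \<phi> xs ys (fst p i) (snd p J) < r else s < pval U \<phi> xs ys (fst p i) (snd p J))"
    for m :: nat and p
  have "\<exists>p. W m p" for m
  proof -
    obtain e where e: "\<And>i. i < m \<Longrightarrow> e i \<in> tuples U (length xs)"
      "\<And>J. \<exists>b\<in>tuples U (length ys). \<forall>i<m. if i \<in> J then pval U \<phi> xs ys (e i) b < r else s < pval U \<phi> xs ys (e i) b"
      using sh[of m] unfolding shatters_def by blast
    then obtain y where y: "\<And>J. y J \<in> tuples U (length ys)"
      "\<And>J. \<forall>i<m. if i \<in> J then pval U \<phi> xs ys (e i) (y J) < r else s < pval U \<phi> xs ys (e i) (y J)" by metis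
    have "W m (\<lambda>i. if i < m then e i else t, y)"
      unfolding W_def using e(1) t y by auto
    then show ?thesis ..
  qed
  then have "\<forall>m. \<exists>p. W m p" ..
  from choice[OF this] obtain p where p: "\<And>m. W m (p m)" by blast
  define e y where "e m = fst (p m)" and "y m = snd (p m)" for m
  have e: "e m i \<in> tuples U (length xs)" and y: "y m J \<in> tuples U (length ys)"
    and ey: "i < m \<Longrightarrow> if i \<in> J then pval U \<phi> xs ys (e m i) (y m J) < r else s < pval U \<phi> xs ys (e m i) (y m J)" for m i J
    using p[of m] unfolding W_def e_def y_def by blast+
  define \<rho> where "\<rho> m = code_tuples d (length xs) (e m) (length ys) (\<lambda>k. y m (set_decode k))" for m
  have \<rho>: "\<rho> m v \<in> carr U" for m v unfolding \<rho>_def by (rule code_tuples_carr[OF d e y])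
  obtain c where c: "\<And>v. c v \<in> carr U" "\<And>\<theta>. wf_fmla L \<theta> \<Longrightarrow> ((\<lambda>m. val U (\<rho> m) \<theta>) \<longlongrightarrow> val U c \<theta>) D"
    using realize_sequence[OF U sat D(1), of \<rho>, OF _ _ \<rho>] by blast
  define a where "a = xtuple c (length xs)"
  define b where "b = ytuple c (length ys)"
  have ab: "a i \<in> tuples U (length xs)" "b k \<in> tuples U (length ys)" for i k
    using c(1) by (auto simp: a_def b_def xtuple_def ytuple_def tuples_def)
  have lim: "((\<lambda>m. pval U \<phi> xs ys (e m i) (y m (set_decode k))) \<longlongrightarrow> pval U \<phi> xs ys (a i) (b k)) D" for i k
  proof -
    have "wf_fmla L (ren (place xs ys i k) \<phi>)" using \<phi> by (simp add: wf_ren partitioned_formula_def)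
    from c(2)[OF this] show ?thesis
      using e y unfolding val_place[OF \<phi>] by (simp add: \<rho>_def a_def b_def xtuple_code ytuple_code tuples_def)
  qed
  have large: "\<forall>\<^sub>F m in D. i < m" for i
    using filter_leD[OF D(2) eventually_gt_at_top[of i]] .
  have "\<exists>b\<in>tuples U (length ys). (\<forall>i\<in>E. pval U \<phi> xs ys (a i) b \<le> r) \<and> (\<forall>i\<in>F. pval U \<phi> xs ys (a i) b \<ge> s)"
    if EF: "finite E \<and> finite F \<and> E \<inter> F = {}" for E F
  proof (intro bexI[of _ "b (set_encode E)"] conjI ballI)
    have dec: "set_decode (set_encode E) = E" using EF by simp
    show "pval U \<phi> xs ys (a i) (b (set_encode E)) \<le> r" if "i \<in> E" for i
    proof (rule tendsto_upperbound[OF lim _ ultrafilter_not_bot[OF D(1)]])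
      show "\<forall>\<^sub>F m in D. pval U \<phi> xs ys (e m i) (y m (set_decode (set_encode E))) \<le> r"
        using large[of i]
      proof eventually_elim
        case (elim m)
        from ey[OF this, of E] that show ?case unfolding dec by simp
      qed
    qed
    show "s \<le> pval U \<phi> xs ys (a i) (b (set_encode E))" if "i \<in> F" for i
    proof (rule tendsto_lowerbound[OF lim _ ultrafilter_not_bot[OF D(1)]])
      show "\<forall>\<^sub>F m in D. s \<le> pval U \<phi> xs ys (e m i) (y m (set_decode (set_encode E)))"
        using large[of i]
      proof eventually_elim
        case (elim m)
        have "i \<notin> E" using that EF by blast
        with ey[OF elim, of E] show ?case unfolding dec by simp
      qed
    qed
  qed (rule ab)
  then show ?thesis unfolding has_IP_def using \<open>r < s\<close> ab(1) by blast
qed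

section \<open>Types over a model and their values\<close>

lemma elementary_embedding_val:
  "elementary_embedding L M N j \<Longrightarrow> wf_fmla L \<phi> \<Longrightarrow> (\<And>v. v \<in> fv \<phi> \<Longrightarrow> \<rho> v \<in> carr M) \<Longrightarrow> val N (j \<circ> \<rho>) \<phi> = val M \<rho> \<phi>"
  by (simp add: elementary_embedding_def elementary_map_def)

lemma tuples_of_map:
  "xtuple (\<lambda>v. g (\<rho> v)) n k = map g (xtuple \<rho> n k)" "ytuple (\<lambda>v. g (\<rho> v)) n k = map g (ytuple \<rho> n k)"
  by (simp_all add: xtuple_def ytuple_def)

lemma pval_elementary:
  assumes M: "metric_structure L M" and j: "elementary_embedding L M N j" and \<phi>: "partitioned_formula L \<phi> xs ys"
    and a: "a \<in> tuples M (length xs)" and b: "b \<in> tuples M (length ys)"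
  shows "pval N \<phi> xs ys (map j a) (map j b) = pval M \<phi> xs ys a b"
proof -
  obtain c where c: "c \<in> carr M" using metric_structureD(1)[OF M] by blast
  define \<rho> where "\<rho> = code_tuples c (length xs) (\<lambda>_. a) (length ys) (\<lambda>_. b)"
  have \<rho>: "\<rho> v \<in> carr M" for v unfolding \<rho>_def by (rule code_tuples_carr[OF c a b])
  have ab: "xtuple \<rho> (length xs) 0 = a" "ytuple \<rho> (length ys) 0 = b"
    using a b by (auto simp: \<rho>_def xtuple_code ytuple_code tuples_def)
  have "xtuple (j \<circ> \<rho>) n i = map j (xtuple \<rho> n i)" "ytuple (j \<circ> \<rho>) n i = map j (ytuple \<rho> n i)" for n i
    using tuples_of_map[of j \<rho>] by (simp_all add: o_def)
  moreover have "val N (j \<circ> \<rho>) (ren (place xs ys 0 0) \<phi>) = val M \<rho> (ren (place xs ys 0 0) \<phi>)"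
    using j \<phi> \<rho> by (auto simp: elementary_embedding_def elementary_map_def wf_ren partitioned_formula_def)
  ultimately show ?thesis by (simp add: val_place[OF \<phi>] ab)
qed

lemma elementary_embedding_trans:
  assumes "elementary_embedding L M N j" and "elementary_embedding L N K k"
  shows "elementary_embedding L M K (k \<circ> j)"
  unfolding elementary_embedding_def elementary_map_def
proof (intro conjI allI impI)
  have jN: "j x \<in> carr N" if "x \<in> carr M" for x
    using that assms(1) by (auto simp: elementary_embedding_def elementary_map_def)
  then show "(k \<circ> j) ` carr M \<subseteq> carr K"
    using assms(2) by (auto simp: elementary_embedding_def elementary_map_def)
  fix \<phi> \<rho> assume *: "wf_fmla L \<phi> \<and> (\<forall>v\<in>fv \<phi>. \<rho> v \<in> carr M)"
  have "val K (k \<circ> (j \<circ> \<rho>)) \<phi> = val N (j \<circ> \<rho>) \<phi>"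
    using assms(2) * jN by (auto simp: elementary_embedding_def elementary_map_def)
  also have "\<dots> = val M \<rho> \<phi>"
    using assms(1) * by (auto simp: elementary_embedding_def elementary_map_def)
  finally show "val K (k \<circ> j \<circ> \<rho>) \<phi> = val M \<rho> \<phi>" by (simp add: o_assoc)
qed simp

lemma tuples_map:
  assumes "elementary_embedding L M N j" and "a \<in> tuples M n"
  shows "map j a \<in> tuples N n"
  using assms by (fastforce simp: elementary_embedding_def elementary_map_def tuples_def)

text \<open>A type realized in Mstar is also realized in the ultrapower of Mstar, which lives on the type of
  sequences that the definition of the space of types asks for.\<close>

lemma phi_tp_in_phi_types:
  fixes M Mstar :: "('f, 'p, 'u) mstruct"
  assumes L: "signature L" and Mstar: "metric_structure L Mstar" and M: "metric_structure L M"
    and emb: "elementary_embedding L M Mstar id"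
    and \<phi>: "partitioned_formula L \<phi> xs ys" and a: "a \<in> tuples Mstar (length xs)"
  shows "phi_tp Mstar id M \<phi> xs ys a \<in> phi_types L M \<phi> xs ys"
proof -
  obtain D :: "nat filter" where D: "ultrafilter D" using ultrafilter_at_top by blast
  define j where "j = (\<lambda>x. rep D Mstar (\<lambda>_. x))"
  let ?N = "ultrapower D Mstar"
  have j: "elementary_embedding L Mstar ?N j"
    unfolding j_def by (rule diagonal_elementary[OF D L Mstar])
  have "elementary_embedding L M ?N j"
    using elementary_embedding_trans[OF emb j] by simp
  moreover have "phi_tp Mstar id M \<phi> xs ys a = phi_tp ?N j M \<phi> xs ys (map j a)"
    unfolding phi_tp_def
  proof (rule restrict_ext)
    fix b assume "b \<in> tuples M (length ys)"
    then have "b \<in> tuples Mstar (length ys)" using tuples_map[OF emb] by simp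
    then show "pval Mstar \<phi> xs ys a (map id b) = pval ?N \<phi> xs ys (map j a) (map j b)"
      using pval_elementary[OF Mstar j \<phi> a] by simp
  qed
  ultimately show ?thesis
    unfolding phi_types_def using ultrapower_metric_structure[OF D L Mstar] tuples_map[OF j a] by blast
qed

lemma elementary_extensionD:
  assumes "elementary_extension L M N"
  shows "metric_structure L N" "elementary_embedding L M N id" "carr M \<subseteq> carr N"
    "\<And>a n. a \<in> tuples M n \<Longrightarrow> a \<in> tuples N n"
  using assms by (auto simp: elementary_extension_def elementary_embedding_def elementary_map_def tuples_def)

lemma approx_fin_satisfiableD:
  "approx_fin_satisfiable M Mstar \<phi> xs ys p \<Longrightarrow> 0 < \<epsilon> \<Longrightarrow> finite B \<Longrightarrow> B \<subseteq> tuples Mstar (length ys) \<Longrightarrow>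
    \<exists>a\<in>tuples M (length xs). \<forall>b\<in>B. \<bar>p b - pval Mstar \<phi> xs ys a b\<bar> < \<epsilon>"
  by (simp add: approx_fin_satisfiable_def)

text \<open>Tuples b, b' with the same type over M give the same values of \<open>\<phi>(a,y)\<close> for a in M, and the
  values of p at both are approximated by these for a common a.\<close>

lemma type_value_eq:
  assumes M: "metric_structure L M" and ext: "elementary_extension L M Mstar" and \<phi>: "partitioned_formula L \<phi> xs ys"
    and p: "approx_fin_satisfiable M Mstar \<phi> xs ys p" and b: "b \<in> tuples Mstar (length ys)"
  shows "type_value M Mstar \<phi> xs ys p (phi_tp Mstar id M \<phi> ys xs b) = p b"
  unfolding type_value_def
proof (rule the_equality)
  show "\<exists>b'\<in>tuples Mstar (length ys). phi_tp Mstar id M \<phi> ys xs b' = phi_tp Mstar id M \<phi> ys xs b \<and> p b = p b'"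
    using b by blast
  fix r assume "\<exists>b'\<in>tuples Mstar (length ys). phi_tp Mstar id M \<phi> ys xs b' = phi_tp Mstar id M \<phi> ys xs b \<and> r = p b'"
  then obtain b' where b': "b' \<in> tuples Mstar (length ys)" "phi_tp Mstar id M \<phi> ys xs b' = phi_tp Mstar id M \<phi> ys xs b" "r = p b'"
    by blast
  have "\<bar>p b' - p b\<bar> \<le> 0"
  proof (rule field_le_epsilon)
    fix e :: real assume "0 < e"
    then have "0 < e / 2" by simp
    moreover have "finite {b, b'}" "{b, b'} \<subseteq> tuples Mstar (length ys)" using b b'(1) by simp_all
    ultimately obtain a where a: "a \<in> tuples M (length xs)" "\<forall>c\<in>{b, b'}. \<bar>p c - pval Mstar \<phi> xs ys a c\<bar> < e / 2"
      using approx_fin_satisfiableD[OF p] by blast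
    have "phi_tp Mstar id M \<phi> ys xs c a = pval Mstar \<phi> xs ys a c" if "c \<in> tuples Mstar (length ys)" for c
      using a(1) that pval_swap[OF \<phi>, of a c Mstar] by (simp add: phi_tp_def tuples_def)
    then have "pval Mstar \<phi> xs ys a b = pval Mstar \<phi> xs ys a b'" using b b'(1,2) by metis
    moreover have "\<bar>p b - pval Mstar \<phi> xs ys a b\<bar> < e / 2" "\<bar>p b' - pval Mstar \<phi> xs ys a b'\<bar> < e / 2" using a(2) by simp_all
    ultimately show "\<bar>p b' - p b\<bar> \<le> 0 + e" by linarith
  qed
  then show "r = p b" using b'(3) by simp
qed

text \<open>Finitely many of the conditions are realized in M itself, with small errors; so the conditions
  that the values lie in the intervals of radius 1/(l+1) are finitely satisfiable.\<close>

lemma type_realized: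
  fixes M Mstar :: "('f, 'p, 'u) mstruct"
  assumes M: "metric_structure L M" and sat: "saturated_elementary_extension L M Mstar"
    and \<phi>: "partitioned_formula L \<phi> xs ys" and q: "q \<in> phi_types L M \<phi> ys xs"
  obtains b where "b \<in> tuples Mstar (length ys)" "phi_tp Mstar id M \<phi> ys xs b = q"
proof -
  have ext: "elementary_extension L M Mstar" and satM: "saturated_over L Mstar (carr M)"
    using sat elementary_extensionD(3) lepoll_refl unfolding saturated_elementary_extension_def by blast+
  note ext' = elementary_extensionD[OF ext]
  obtain N :: "('f, 'p, nat \<Rightarrow> 'u) mstruct" and j d where N: "metric_structure L N" "elementary_embedding L M N j"
    "d \<in> tuples N (length ys)" "q = phi_tp N j M \<phi> ys xs d"
    using q unfolding phi_types_def by blast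
  have q_val: "q a = pval N \<phi> xs ys (map j a) d" if "a \<in> tuples M (length xs)" for a
    using that N(3) tuples_map[OF N(2) that] pval_swap[OF \<phi>, of "map j a" d N] unfolding N(4) phi_tp_def by (simp add: tuples_def)
  have "\<exists>b\<in>tuples Mstar (length ys). \<forall>i\<in>tuples M (length xs) \<times> (UNIV :: nat set).
       pval Mstar \<phi> xs ys (fst i) b \<in> {q (fst i) - 1 / Suc (snd i)..q (fst i) + 1 / Suc (snd i)}"
  proof (rule realize_tuple[OF satM \<phi>, where I = "tuples M (length xs) \<times> (UNIV :: nat set)" and a = fst
        and lo = "\<lambda>i. q (fst i) - 1 / Suc (snd i)" and hi = "\<lambda>i. q (fst i) + 1 / Suc (snd i)"])
    show "fst i \<in> tuples Mstar (length xs) \<and> set (fst i) \<subseteq> carr M" if "i \<in> tuples M (length xs) \<times> (UNIV :: nat set)" for i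
      using that ext'(3) by (auto simp: tuples_def)
    fix J :: "('u list \<times> nat) set" assume J: "finite J" "J \<subseteq> tuples M (length xs) \<times> UNIV"
    obtain \<epsilon> where \<epsilon>: "0 < \<epsilon>" "\<And>i. i \<in> J \<Longrightarrow> \<epsilon> \<le> 1 / real (Suc (snd i))"
      by (rule finite_gap[OF J(1), of "\<lambda>i. 1 / real (Suc (snd i))"]) auto
    have B: "finite (fst ` J)" "fst ` J \<subseteq> tuples M (length xs)" using J by auto
    obtain b where b: "b \<in> tuples M (length ys)"
      "\<And>a. a \<in> fst ` J \<Longrightarrow> \<bar>pval M \<phi> xs ys a b - pval N \<phi> xs ys (map j a) d\<bar> < \<epsilon>"
      using tuple_approx_in_submodel[OF M N(1,2) \<phi> N(3) B \<epsilon>(1)] by blast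
    have "pval Mstar \<phi> xs ys (fst i) b \<in> {q (fst i) - 1 / Suc (snd i)..q (fst i) + 1 / Suc (snd i)}" if i: "i \<in> J" for i
    proof -
      have a: "fst i \<in> tuples M (length xs)" using i J(2) by auto
      have "pval Mstar \<phi> xs ys (fst i) b = pval M \<phi> xs ys (fst i) b"
        using pval_elementary[OF M ext'(2) \<phi> a b(1)] by simp
      then show ?thesis using b(2)[of "fst i"] \<epsilon>(2)[OF i] i q_val[OF a] unfolding atLeastAtMost_iff by fastforce
    qed
    then show "\<exists>b\<in>tuples Mstar (length ys). \<forall>i\<in>J. pval Mstar \<phi> xs ys (fst i) b \<in>
        {q (fst i) - 1 / Suc (snd i)..q (fst i) + 1 / Suc (snd i)}"
      using ext'(4)[OF b(1)] by blast
  qed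
  then obtain b where b: "b \<in> tuples Mstar (length ys)"
    "\<And>i. i \<in> tuples M (length xs) \<times> (UNIV :: nat set) \<Longrightarrow>
       pval Mstar \<phi> xs ys (fst i) b \<in> {q (fst i) - 1 / Suc (snd i)..q (fst i) + 1 / Suc (snd i)}"
    by blast
  have "pval Mstar \<phi> xs ys a b = q a" if a: "a \<in> tuples M (length xs)" for a
  proof -
    have "\<bar>pval Mstar \<phi> xs ys a b - q a\<bar> \<le> 0"
    proof (rule field_le_epsilon)
      fix e :: real assume "0 < e"
      then obtain l where "1 / real (Suc l) < e" using reals_Archimedean by (auto simp: inverse_eq_divide)
      moreover have "(a, l) \<in> tuples M (length xs) \<times> UNIV" using a by simp
      from b(2)[OF this] have "\<bar>pval Mstar \<phi> xs ys a b - q a\<bar> \<le> 1 / Suc l"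
        unfolding fst_conv snd_conv atLeastAtMost_iff by linarith
      ultimately show "\<bar>pval Mstar \<phi> xs ys a b - q a\<bar> \<le> 0 + e" by linarith
    qed
    then show ?thesis by simp
  qed
  moreover have "pval Mstar \<phi> ys xs b a = pval Mstar \<phi> xs ys a b" if "a \<in> tuples M (length xs)" for a
    using that b(1) pval_swap[OF \<phi>, of a b Mstar] by (simp add: tuples_def)
  moreover have "q = restrict q (tuples M (length xs))" unfolding N(4) phi_tp_def by simp
  ultimately have "phi_tp Mstar id M \<phi> ys xs b = q"
    unfolding phi_tp_def by (metis (no_types, lifting) list.map_id restrict_ext)
  with b(1) that show ?thesis by blast
qed


section \<open>Cardinalities\<close>

lemma separable_dense:
  fixes M :: "('f, 'p, 'u) mstruct"
  assumes M: "metric_structure L M" and "separable M"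
  obtains s :: "nat \<Rightarrow> 'u" where "range s \<subseteq> carr M"
    "\<And>x \<epsilon>. x \<in> carr M \<Longrightarrow> 0 < \<epsilon> \<Longrightarrow> \<exists>i. mdist M x (s i) < \<epsilon>"
proof -
  interpret Metric_space "carr M" "mdist M" by (rule metric_structureD(2)[OF M])
  obtain C where C: "countable C" "C \<subseteq> carr M" "mtopology closure_of C = carr M"
    using assms(2) unfolding separable_def separable_space_def by auto
  have dense: "\<exists>y\<in>C. mdist M x y < \<epsilon>" if x: "x \<in> carr M" "0 < \<epsilon>" for x \<epsilon>
  proof -
    have "x \<in> mtopology closure_of C" using C(3) x(1) by simp
    then obtain y where "y \<in> C" "y \<in> mball x \<epsilon>" using x(2) unfolding metric_closure_of by blast
    then show ?thesis by auto
  qed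
  obtain x where "x \<in> carr M" using metric_structureD(1)[OF M] by blast
  with dense[of x 1] have "C \<noteq> {}" by auto
  with C(1) have range: "range (from_nat_into C) = C" by (simp add: range_from_nat_into)
  show ?thesis
  proof (rule that[of "from_nat_into C"])
    show "\<exists>i. mdist M x (from_nat_into C i) < \<epsilon>" if x: "x \<in> carr M" "0 < \<epsilon>" for x \<epsilon>
    proof -
      obtain y where y: "y \<in> C" "mdist M x y < \<epsilon>" using dense[OF x] by blast
      obtain i where "y = from_nat_into C i" using y(1) range by blast
      with y(2) show ?thesis by blast
    qed
  qed (use range C(2) in simp)
qed

text \<open>A point is determined by the set of pairs of a point of a dense sequence and a radius such that the
  ball contains it.\<close>

lemma separable_lepoll:
  fixes M :: "('f, 'p, 'u) mstruct"
  assumes M: "metric_structure L M" and "separable M"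
  shows "carr M \<lesssim> (UNIV :: nat set set)"
proof -
  interpret Metric_space "carr M" "mdist M" by (rule metric_structureD(2)[OF M])
  obtain s :: "nat \<Rightarrow> 'u" where s: "range s \<subseteq> carr M" "\<And>x \<epsilon>. x \<in> carr M \<Longrightarrow> 0 < \<epsilon> \<Longrightarrow> \<exists>i. mdist M x (s i) < \<epsilon>"
    using separable_dense[OF assms] by blast
  define f where "f x = {prod_encode (i, k) |i k. mdist M x (s i) < 1 / real (Suc k)}" for x
  have "inj_on f (carr M)"
  proof (rule inj_onI)
    fix x y assume xy: "x \<in> carr M" "y \<in> carr M" "f x = f y"
    have "mdist M x y \<le> 0"
    proof (rule field_le_epsilon)
      fix e :: real assume "0 < e"
      then obtain k where k: "1 / real (Suc k) < e / 2"
        using reals_Archimedean[of "e / 2"] by (auto simp: inverse_eq_divide)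
      obtain i where i: "mdist M x (s i) < 1 / real (Suc k)" using s(2)[OF xy(1), of "1 / real (Suc k)"] by auto
      then have "prod_encode (i, k) \<in> f x" unfolding f_def by blast
      then have "prod_encode (i, k) \<in> f y" using xy(3) by simp
      then have "mdist M y (s i) < 1 / real (Suc k)" by (auto simp: f_def prod_encode_eq)
      moreover have "s i \<in> carr M" using s(1) by blast
      ultimately show "mdist M x y \<le> 0 + e"
        using triangle[OF xy(1) _ xy(2), of "s i"] commute[of "s i" y] i k by linarith
    qed
    then show "x = y" using zero[OF xy(1,2)] nonneg[of x y] by simp
  qed
  then show ?thesis unfolding lepoll_def by blast
qed

lemma tuple_sequences_lepoll:
  assumes "carr M \<lesssim> (UNIV :: nat set set)"
  shows "{a. \<forall>n :: nat. a n \<in> tuples M k} \<lesssim> (UNIV :: nat set set)"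
proof -
  obtain f :: "'a \<Rightarrow> nat set" where f: "inj_on f (carr M)" using assms unfolding lepoll_def by blast
  define F where "F a = {prod_encode (n, prod_encode (j, w)) |n j w. j < k \<and> w \<in> f (a n ! j)}" for a :: "nat \<Rightarrow> 'a list"
  have "inj_on F {a. \<forall>n. a n \<in> tuples M k}"
  proof (rule inj_onI, rule ext)
    fix a b n assume ab: "a \<in> {a. \<forall>n. a n \<in> tuples M k}" "b \<in> {a. \<forall>n. a n \<in> tuples M k}" "F a = F b"
    have len: "length (a n) = k" "length (b n) = k" and sub: "set (a n) \<subseteq> carr M" "set (b n) \<subseteq> carr M"
      using ab(1,2) by (auto simp: tuples_def)
    have mem: "prod_encode (n, prod_encode (j, w)) \<in> F c \<longleftrightarrow> w \<in> f (c n ! j)" if "j < k" for j w c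
      using that unfolding F_def by (auto simp: prod_encode_eq)
    show "a n = b n"
    proof (rule nth_equalityI)
      fix j assume "j < length (a n)"
      then have j: "j < k" using len by simp
      have "f (a n ! j) = f (b n ! j)" using mem[OF j, of _ a] mem[OF j, of _ b] ab(3) by blast
      then show "a n ! j = b n ! j"
        by (rule inj_onD[OF f]) (use j len sub nth_mem in auto)
    qed (use len in simp)
  qed
  then show ?thesis unfolding lepoll_def by blast
qed

section \<open>The three implications\<close>

text \<open>The value of p at a tuple b of Mstar is the limit of the values at b of the defining sequence.\<close>

lemma few_types_of_definable:
  fixes M Mstar :: "('f, 'p, 'u) mstruct"
  assumes L: "signature L" and M: "metric_structure L M" and "separable M"
    and sat: "saturated_elementary_extension L M Mstar" and \<phi>: "partitioned_formula L \<phi> xs ys"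
    and def: "\<And>p. p \<in> phi_types L Mstar \<phi> xs ys \<Longrightarrow> approx_fin_satisfiable M Mstar \<phi> xs ys p \<Longrightarrow>
       Baire_half_definable L M Mstar \<phi> xs ys p"
  shows "{p \<in> phi_types L Mstar \<phi> xs ys. approx_fin_satisfiable M Mstar \<phi> xs ys p} \<prec> (UNIV :: nat set set set)"
proof -
  let ?P = "{p \<in> phi_types L Mstar \<phi> xs ys. approx_fin_satisfiable M Mstar \<phi> xs ys p}"
  have ext: "elementary_extension L M Mstar" using sat unfolding saturated_elementary_extension_def by blast
  note ext' = elementary_extensionD[OF ext]
  have "\<exists>a. (\<forall>n. a n \<in> tuples M (length xs)) \<and>
      (\<forall>b\<in>tuples Mstar (length ys). (\<lambda>n. phi_tp Mstar id M \<phi> ys xs b (a n)) \<longlonglongrightarrow> p b)" if p: "p \<in> ?P" for p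
  proof -
    obtain a f where a: "\<And>n. a n \<in> tuples M (length xs)"
      "\<And>q. q \<in> phi_types L M \<phi> ys xs \<Longrightarrow> (\<lambda>n. q (a n :: 'u list)) \<longlonglongrightarrow> f q"
      "\<And>q. q \<in> phi_types L M \<phi> ys xs \<Longrightarrow> type_value M Mstar \<phi> xs ys p q = f q"
      using def[of p] p unfolding Baire_half_definable_def by blast
    have "(\<lambda>n. phi_tp Mstar id M \<phi> ys xs b (a n)) \<longlonglongrightarrow> p b" if b: "b \<in> tuples Mstar (length ys)" for b
    proof -
      let ?q = "phi_tp Mstar id M \<phi> ys xs b"
      have q: "?q \<in> phi_types L M \<phi> ys xs"
        by (rule phi_tp_in_phi_types[OF L ext'(1) M ext'(2) partitioned_swap[OF \<phi>] b])
      have "f ?q = p b" using a(3)[OF q] type_value_eq[OF M ext \<phi> _ b] p by simp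
      with a(2)[OF q] show ?thesis by simp
    qed
    with a(1) show ?thesis by blast
  qed
  then have "\<forall>p\<in>?P. \<exists>a. (\<forall>n. a n \<in> tuples M (length xs)) \<and>
      (\<forall>b\<in>tuples Mstar (length ys). (\<lambda>n. phi_tp Mstar id M \<phi> ys xs b (a n)) \<longlonglongrightarrow> p b)" ..
  from bchoice[OF this] obtain a where a: "\<And>p n. p \<in> ?P \<Longrightarrow> a p n \<in> tuples M (length xs)"
    "\<And>p b. p \<in> ?P \<Longrightarrow> b \<in> tuples Mstar (length ys) \<Longrightarrow> (\<lambda>n. phi_tp Mstar id M \<phi> ys xs b (a p n)) \<longlonglongrightarrow> p b"
    by blast
  have "inj_on a ?P"
  proof (rule inj_onI)
    fix p p' assume p: "p \<in> ?P" "p' \<in> ?P" "a p = a p'"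
    have restr: "p = restrict p (tuples Mstar (length ys))" if "p \<in> ?P" for p
      using that unfolding phi_types_def phi_tp_def by auto
    have "p b = p' b" if b: "b \<in> tuples Mstar (length ys)" for b
      using LIMSEQ_unique[OF a(2)[OF p(1) b]] a(2)[OF p(2) b] p(3) by simp
    then have "restrict p (tuples Mstar (length ys)) = restrict p' (tuples Mstar (length ys))" by (rule restrict_ext)
    then show "p = p'" using restr[OF p(1)] restr[OF p(2)] by simp
  qed
  moreover have "a ` ?P \<subseteq> {a. \<forall>n. a n \<in> tuples M (length xs)}" using a(1) by blast
  ultimately have "?P \<lesssim> {a. \<forall>n :: nat. a n \<in> tuples M (length xs)}" unfolding lepoll_def by blast
  also have "\<dots> \<lesssim> (UNIV :: nat set set)" by (rule tuple_sequences_lepoll[OF separable_lepoll[OF M assms(3)]])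
  also have "(UNIV :: nat set set) \<prec> (UNIV :: nat set set set)"
    using lesspoll_Pow_self[of "UNIV :: nat set set"] by simp
  finally show ?thesis .
qed

lemma monster_saturated:
  assumes U: "monster_model L T \<kappa> U" and "A \<subseteq> carr U" "A \<lesssim> (UNIV :: nat set set)"
  shows "saturated_over L U A"
  using U assms(2) lesspoll_trans1[OF assms(3)] unfolding monster_model_def kappa_saturated_def by blast

lemma countable_lepoll_continuum:
  assumes "countable A"
  shows "A \<lesssim> (UNIV :: nat set set)"
proof -
  obtain f :: "'a \<Rightarrow> nat" where "inj_on f A" using assms by (auto simp: countable_def)
  then have "inj_on (\<lambda>x. {f x}) A" by (auto simp: inj_on_def)
  then show ?thesis unfolding lepoll_def by blast
qed

text \<open>The limit of the given sequence along an ultrafilter is the type of the class of the sequence in the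
  ultrapower.  If a set S belongs to one ultrafilter and its complement to another, a tuple b that gives
  values at most r on S and at least s off S, which exists by saturation, tells the two limits apart.\<close>

lemma many_types_of_IP:
  fixes U :: "('f, 'p, 'u) mstruct"
  assumes L: "signature L" "countable_signature L" and T: "complete_theory TYPE('w) L T" and U: "monster_model L T \<kappa> U"
    and \<phi>: "partitioned_formula L \<phi> xs ys" and ip: "has_IP U \<phi> xs ys"
  obtains M :: "('f, 'p, 'u) mstruct" where "model_of L T M" "separable M" "saturated_elementary_extension L M U"
    "(UNIV :: nat set set set) \<lesssim> {p \<in> phi_types L U \<phi> xs ys. approx_fin_satisfiable M U \<phi> xs ys p}"
proof -
  have UM: "model_of L T U" "metric_structure L U" using U by (auto simp: monster_model_def model_of_def)
  obtain r s :: real and a :: "nat \<Rightarrow> 'u list" where "r < s \<and> (\<forall>i. a i \<in> tuples U (length xs)) \<and>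
      (\<forall>E F. finite E \<and> finite F \<and> E \<inter> F = {} \<longrightarrow> (\<exists>b\<in>tuples U (length ys).
         (\<forall>i\<in>E. pval U \<phi> xs ys (a i) b \<le> r) \<and> (\<forall>i\<in>F. pval U \<phi> xs ys (a i) b \<ge> s)))"
    using ip unfolding has_IP_def by (elim exE) (rule that)
  then have rs: "r < s" and a: "\<And>i. a i \<in> tuples U (length xs)"
    and E: "\<And>E F. finite E \<and> finite F \<and> E \<inter> F = {} \<Longrightarrow> (\<exists>b\<in>tuples U (length ys).
         (\<forall>i\<in>E. pval U \<phi> xs ys (a i) b \<le> r) \<and> (\<forall>i\<in>F. pval U \<phi> xs ys (a i) b \<ge> s))"
    by simp_all
  define A where "A = (\<Union>i. set (a i))"
  have A: "countable A" "A \<subseteq> carr U" using a by (auto simp: A_def tuples_def countable_finite)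
  obtain M where M: "metric_structure L M" "separable M" "A \<subseteq> carr M" "elementary_map L M (carr M) U id"
    using separable_elementary_substructure[OF L UM(2) A] by blast
  have sub: "carr M \<subseteq> carr U" using M(4) by (auto simp: elementary_map_def)
  have "model_of L T M"
  proof -
    have "val M \<rho> \<sigma> = 0" if "\<sigma> \<in> T" for \<sigma> \<rho>
    proof -
      have \<sigma>: "wf_fmla L \<sigma>" "fv \<sigma> = {}"
        using T that by (auto simp: complete_theory_def theory_of_def sentence_def)
      then have "val U (id \<circ> \<rho>) \<sigma> = val M \<rho> \<sigma>" using M(4) unfolding elementary_map_def by blast
      then show ?thesis using UM(1) that by (simp add: model_of_def)
    qed
    then show ?thesis using M(1) by (simp add: model_of_def)
  qed
  have satU: "saturated_elementary_extension L M U"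
    unfolding saturated_elementary_extension_def elementary_extension_def elementary_embedding_def
    using UM(2) M(4) monster_saturated[OF U] lepoll_trans separable_lepoll[OF M(1,2)] by blast
  have aM: "a i \<in> tuples M (length xs)" for i using a[of i] M(3) by (auto simp: A_def tuples_def)
  obtain \<D> :: "nat set set \<Rightarrow> nat filter" where \<D>: "\<And>H. ultrafilter (\<D> H)"
    "\<And>H H'. H \<noteq> H' \<Longrightarrow> \<exists>S. eventually (\<lambda>n. n \<in> S) (\<D> H) \<and> eventually (\<lambda>n. n \<notin> S) (\<D> H')"
    using ultrafilter_separating_family by blast
  have split: "\<exists>b\<in>tuples U (length ys). \<forall>i. (i \<in> S \<longrightarrow> pval U \<phi> xs ys (a i) b \<le> r) \<and> (i \<notin> S \<longrightarrow> s \<le> pval U \<phi> xs ys (a i) b)" for S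
  proof -
    have "saturated_over L U A" by (rule monster_saturated[OF U A(2) countable_lepoll_continuum[OF A(1)]])
    then have "\<exists>b\<in>tuples U (length ys). \<forall>i\<in>UNIV. pval U \<phi> xs ys (a i) b \<in> {(if i \<in> S then 0 else s)..(if i \<in> S then r else 1)}"
    proof (rule realize_tuple[OF _ \<phi>, where I = UNIV and a = a and lo = "\<lambda>i. if i \<in> S then 0 else s" and hi = "\<lambda>i. if i \<in> S then r else 1"])
      show "a i \<in> tuples U (length xs) \<and> set (a i) \<subseteq> A" for i using a by (auto simp: A_def)
      fix J :: "nat set" assume J: "finite J"
      obtain b where b: "b \<in> tuples U (length ys)" "\<forall>i\<in>J \<inter> S. pval U \<phi> xs ys (a i) b \<le> r"
        "\<forall>i\<in>J - S. pval U \<phi> xs ys (a i) b \<ge> s"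
        using E[of "J \<inter> S" "J - S"] J by blast
      then show "\<exists>b\<in>tuples U (length ys). \<forall>i\<in>J. pval U \<phi> xs ys (a i) b \<in> {(if i \<in> S then 0 else s)..(if i \<in> S then r else 1)}"
        using pval_unit[OF UM(2) \<phi> a b(1)] by (intro bexI[OF _ b(1)]) auto
    qed
    then obtain b where b: "b \<in> tuples U (length ys)"
      "\<And>i. pval U \<phi> xs ys (a i) b \<in> {(if i \<in> S then 0 else s)..(if i \<in> S then r else 1)}" by blast
    have "(i \<in> S \<longrightarrow> pval U \<phi> xs ys (a i) b \<le> r) \<and> (i \<notin> S \<longrightarrow> s \<le> pval U \<phi> xs ys (a i) b)" for i
      using b(2)[of i] by (cases "i \<in> S") auto
    with b(1) show ?thesis by blast
  qed
  define c where "c = map (\<lambda>k i. a i ! k) [0..<length xs]"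
  define p where "p H = phi_tp (ultrapower (\<D> H) U) (\<lambda>x. rep (\<D> H) U (\<lambda>_. x)) U \<phi> xs ys (map (rep (\<D> H) U) c)" for H
  have c: "set c \<subseteq> seqs U" "length c = length xs" "map (\<lambda>x. x i) c = a i" for i
  proof -
    have "a i ! k \<in> carr U" if "k < length xs" for i k
      using a[of i] that nth_mem[of k "a i"] by (auto simp: tuples_def)
    then show "set c \<subseteq> seqs U" by (auto simp: c_def seqs_def)
    show "length c = length xs" "map (\<lambda>x. x i) c = a i"
      using a[of i] by (auto simp: c_def tuples_def intro!: nth_equalityI)
  qed
  have p_lim: "((\<lambda>i. pval U \<phi> xs ys (a i) b) \<longlongrightarrow> p H b) (\<D> H)" if b: "b \<in> tuples U (length ys)" for H b
  proof -
    let ?N = "ultrapower (\<D> H) U" and ?R = "rep (\<D> H) U"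
    obtain d where d: "d \<in> carr U" using metric_structureD(1)[OF UM(2)] by blast
    define \<rho> where "\<rho> = code_tuples (\<lambda>_. d) (length xs) (\<lambda>_. c) (length ys) (\<lambda>_. map (\<lambda>x _. x) b)"
    have "\<rho> v \<in> carr (\<lparr>carr = seqs U, mdist = undefined, fun_of = undefined, pred_of = undefined\<rparr> :: ('f, 'p, nat \<Rightarrow> 'u) mstruct)" for v
      unfolding \<rho>_def using b c by (intro code_tuples_carr) (auto simp: tuples_def seqs_def d)
    then have \<rho>: "\<rho> v \<in> seqs U" for v by simp
    have wf: "wf_fmla L (ren (place xs ys 0 0) \<phi>)" using \<phi> by (simp add: wf_ren partitioned_formula_def)
    have xt: "xtuple \<rho> (length xs) 0 = c" "ytuple \<rho> (length ys) 0 = map (\<lambda>x _. x) b"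
      using c(2) b by (auto simp: \<rho>_def xtuple_code ytuple_code tuples_def)
    have "((\<lambda>i. val U (\<lambda>v. \<rho> v i) (ren (place xs ys 0 0) \<phi>)) \<longlongrightarrow> val ?N (\<lambda>v. ?R (\<rho> v)) (ren (place xs ys 0 0) \<phi>)) (\<D> H)"
      by (rule ultrapower_val[OF \<D>(1) L(1) UM(2) \<rho> wf])
    moreover have "val U (\<lambda>v. \<rho> v i) (ren (place xs ys 0 0) \<phi>) = pval U \<phi> xs ys (a i) b" for i
      unfolding val_place[OF \<phi>] using tuples_of_map[of "\<lambda>x. x i" \<rho>] by (simp add: xt c(3) o_def)
    moreover have "val ?N (\<lambda>v. ?R (\<rho> v)) (ren (place xs ys 0 0) \<phi>) = p H b"
      unfolding val_place[OF \<phi>] using tuples_of_map[of ?R \<rho>] b by (simp add: xt p_def phi_tp_def o_def)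
    ultimately show ?thesis by simp
  qed
  have p_type: "p H \<in> phi_types L U \<phi> xs ys" for H
  proof -
    have "map (rep (\<D> H) U) c \<in> tuples (ultrapower (\<D> H) U) (length xs)"
      using c(1,2) by (auto simp: tuples_def ultrapower_def)
    then show ?thesis
      unfolding phi_types_def p_def
      using ultrapower_metric_structure[OF \<D>(1) L(1) UM(2)] diagonal_elementary[OF \<D>(1) L(1) UM(2)] by blast
  qed
  have p_afs: "approx_fin_satisfiable M U \<phi> xs ys (p H)" for H
    unfolding approx_fin_satisfiable_def
  proof (intro allI impI)
    fix \<epsilon> :: real and B assume *: "0 < \<epsilon>" "finite B \<and> B \<subseteq> tuples U (length ys)"
    have "\<forall>\<^sub>F i in \<D> H. \<forall>b\<in>B. \<bar>p H b - pval U \<phi> xs ys (a i) b\<bar> < \<epsilon>"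
      using * tendstoD[OF p_lim *(1)] by (intro eventually_ball_finite) (auto simp: dist_real_def abs_minus_commute)
    then obtain i where "\<forall>b\<in>B. \<bar>p H b - pval U \<phi> xs ys (a i) b\<bar> < \<epsilon>"
      using eventually_happens'[OF ultrafilter_not_bot[OF \<D>(1)]] by blast
    then show "\<exists>a\<in>tuples M (length xs). \<forall>b\<in>B. \<bar>p H b - pval U \<phi> xs ys a b\<bar> < \<epsilon>" using aM by blast
  qed
  have "inj p"
  proof (rule injI, rule ccontr)
    fix H H' assume eq: "p H = p H'" and "H \<noteq> H'"
    obtain S where S: "eventually (\<lambda>n. n \<in> S) (\<D> H)" "eventually (\<lambda>n. n \<notin> S) (\<D> H')" using \<D>(2)[OF \<open>H \<noteq> H'\<close>] by blast
    obtain b where b: "b \<in> tuples U (length ys)"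
      "\<And>i. i \<in> S \<Longrightarrow> pval U \<phi> xs ys (a i) b \<le> r" "\<And>i. i \<notin> S \<Longrightarrow> s \<le> pval U \<phi> xs ys (a i) b" using split[of S] by blast
    have "p H b \<le> r"
      by (rule tendsto_upperbound[OF p_lim[OF b(1)] eventually_mono[OF S(1) b(2)] ultrafilter_not_bot[OF \<D>(1)]])
    moreover have "s \<le> p H' b"
      by (rule tendsto_lowerbound[OF p_lim[OF b(1)] eventually_mono[OF S(2) b(3)] ultrafilter_not_bot[OF \<D>(1)]])
    ultimately show False using eq rs by simp
  qed
  then have "(UNIV :: nat set set set) \<lesssim> {p \<in> phi_types L U \<phi> xs ys. approx_fin_satisfiable M U \<phi> xs ys p}"
    unfolding lepoll_def using p_type p_afs by blast
  with \<open>model_of L T M\<close> M(2) satU that show ?thesis by blast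
qed


lemma NIP_no_shattering:
  fixes U :: "('f, 'p, 'u) mstruct" and M :: "('f, 'p, 'v) mstruct"
  assumes T: "complete_theory TYPE('w) L T" and U: "monster_model L T \<kappa> U" and \<phi>: "partitioned_formula L \<phi> xs ys"
    and nip: "has_NIP U \<phi> xs ys" and M: "model_of L T M" and "r < s"
  shows "\<exists>m. \<not> shatters (pval M \<phi> xs ys) (tuples M (length xs)) (tuples M (length ys)) r s m"
proof (rule ccontr)
  assume "\<not> ?thesis"
  then have sh: "\<And>m. shatters (pval M \<phi> xs ys) (tuples M (length xs)) (tuples M (length ys)) r s m" by blast
  have UM: "model_of L T U" "metric_structure L U" "metric_structure L M"
    using U M by (auto simp: monster_model_def model_of_def)
  define \<epsilon> where "\<epsilon> = (s - r) / 3"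
  have \<epsilon>: "0 < \<epsilon>" "r + \<epsilon> < s - \<epsilon>" using \<open>r < s\<close> by (auto simp: \<epsilon>_def field_simps)
  have "shatters (pval U \<phi> xs ys) (tuples U (length xs)) (tuples U (length ys)) (r + \<epsilon>) (s - \<epsilon>) m" for m
    by (rule shatters_transfer[OF UM(3,2) \<phi> complete_theory_agree[OF T M UM(1)] sh \<epsilon>(1)])
  then have "has_IP U \<phi> xs ys"
    by (intro has_IP_of_shattering[OF UM(2) _ \<phi> \<epsilon>(2)] monster_saturated[OF U])
      (auto intro: countable_lepoll_continuum countable_finite)
  with nip show False by (simp add: has_NIP_def)
qed

text \<open>By uniform continuity of the formula, tuples with coordinates in a countable dense subset of M
  are enough, uniformly in the second argument.\<close>

lemma dense_tuples:
  fixes M Mstar :: "('f, 'p, 'u) mstruct"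
  assumes L: "signature L" and M: "metric_structure L M" "separable M" and ext: "elementary_extension L M Mstar"
    and \<phi>: "partitioned_formula L \<phi> xs ys"
  obtains g :: "nat \<Rightarrow> 'u list" where "\<And>i. g i \<in> tuples M (length xs)"
    "\<And>a \<epsilon>. a \<in> tuples M (length xs) \<Longrightarrow> 0 < \<epsilon> \<Longrightarrow>
       \<exists>i. \<forall>b\<in>tuples Mstar (length ys). \<bar>pval Mstar \<phi> xs ys a b - pval Mstar \<phi> xs ys (g i) b\<bar> < \<epsilon>"
proof -
  note ext' = elementary_extensionD[OF ext]
  obtain s :: "nat \<Rightarrow> 'u" where s: "range s \<subseteq> carr M" "\<And>x \<epsilon>. x \<in> carr M \<Longrightarrow> 0 < \<epsilon> \<Longrightarrow> \<exists>i. mdist M x (s i) < \<epsilon>"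
    using separable_dense[OF M] by blast
  define n where "n = length xs"
  define g where "g i = map (\<lambda>j. s (from_nat i ! j)) [0..<n]" for i :: nat
  have g: "g i \<in> tuples M n" for i using s(1) by (auto simp: g_def tuples_def)
  have dist: "mdist Mstar x y = mdist M x y" if "x \<in> carr M" "y \<in> carr M" for x y
  proof -
    have "val Mstar (id \<circ> (\<lambda>v. if v = 0 then x else y)) (Dist (Var 0) (Var (Suc 0))) =
        val M (\<lambda>v. if v = 0 then x else y) (Dist (Var 0) (Var (Suc 0)))"
      by (rule elementary_embedding_val[OF ext'(2)]) (use that in auto)
    then show ?thesis by simp
  qed
  have wf: "wf_fmla L (ren (place xs ys 0 0) \<phi>)" using \<phi> by (simp add: wf_ren partitioned_formula_def)
  obtain d where d: "d \<in> carr Mstar" using metric_structureD(1)[OF ext'(1)] by blast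
  have "\<exists>i. \<forall>b\<in>tuples Mstar (length ys). \<bar>pval Mstar \<phi> xs ys a b - pval Mstar \<phi> xs ys (g i) b\<bar> < \<epsilon>"
    if a: "a \<in> tuples M n" and "0 < \<epsilon>" for a \<epsilon>
  proof -
    obtain \<delta> where \<delta>: "0 < \<delta>" "\<And>\<rho> \<rho>'. assignments_close Mstar (fv (ren (place xs ys 0 0) \<phi>)) \<delta> \<rho> \<rho>' \<Longrightarrow>
        \<bar>val Mstar \<rho> (ren (place xs ys 0 0) \<phi>) - val Mstar \<rho>' (ren (place xs ys 0 0) \<phi>)\<bar> < \<epsilon>"
      using val_uniform[OF L ext'(1) wf \<open>0 < \<epsilon>\<close>] by blast
    have a_carr: "a ! j \<in> carr M" if "j < n" for j using a that nth_mem[of j a] by (auto simp: tuples_def)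
    then have "\<forall>j. \<exists>i. j < n \<longrightarrow> mdist M (a ! j) (s i) < \<delta>" using s(2) \<delta>(1) by blast
    then obtain f where f: "\<And>j. j < n \<Longrightarrow> mdist M (a ! j) (s (f j)) < \<delta>" by metis
    define i where "i = to_nat (map f [0..<n])"
    have gi: "g i ! j = s (f j)" if "j < n" for j using that by (simp add: g_def i_def)
    have "\<bar>pval Mstar \<phi> xs ys a b - pval Mstar \<phi> xs ys (g i) b\<bar> < \<epsilon>" if b: "b \<in> tuples Mstar (length ys)" for b
    proof -
      define code where "code c = code_tuples d (length xs) (\<lambda>_. c) (length ys) (\<lambda>_. b)" for c
      have code: "code c v \<in> carr Mstar" if "c \<in> tuples M n" for c v
        unfolding code_def by (rule code_tuples_carr[OF d]) (use ext'(4)[OF that] b n_def in auto)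
      have val_code: "val Mstar (code c) (ren (place xs ys 0 0) \<phi>) = pval Mstar \<phi> xs ys c b" if "c \<in> tuples M n" for c
        using that b by (simp add: val_place[OF \<phi>] code_def xtuple_code ytuple_code tuples_def n_def)
      have "mdist Mstar (code a v) (code (g i) v) < \<delta>" for v
      proof (cases "v mod 3 = 0 \<and> snd (prod_decode (v div 3)) < n")
        case True
        obtain k j where pd: "prod_decode (v div 3) = (k, j)" by (cases "prod_decode (v div 3)")
        have j: "j < n" "code a v = a ! j" "code (g i) v = g i ! j"
          using True pd by (simp_all add: code_def code_tuples_def n_def)
        have "s (f j) \<in> carr M" using s(1) by blast
        then show ?thesis using j f[OF j(1)] gi[OF j(1)] dist[OF a_carr[OF j(1)]] by simp
      next
        case False
        obtain k j where pd: "prod_decode (v div 3) = (k, j)" by (cases "prod_decode (v div 3)")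
        have "code a v = code (g i) v" using False pd by (auto simp: code_def code_tuples_def n_def)
        then show ?thesis
          using code[OF a, of v] \<delta>(1) Metric_space.mdist_zero[OF metric_structureD(2)[OF ext'(1)]] by simp
      qed
      then have "assignments_close Mstar (fv (ren (place xs ys 0 0) \<phi>)) \<delta> (code a) (code (g i))"
        using code[OF a] code[OF g] by (simp add: assignments_close_def)
      from \<delta>(2)[OF this] show ?thesis using val_code[OF a] val_code[OF g] by simp
    qed
    then show ?thesis by blast
  qed
  then show ?thesis using that[of g] g by (simp add: n_def)
qed

lemma phi_type_unit:
  fixes M :: "('f, 'p, 'u) mstruct"
  assumes "p \<in> phi_types L M \<phi> xs ys" and \<phi>: "partitioned_formula L \<phi> xs ys" and b: "b \<in> tuples M (length ys)"
  shows "p b \<in> {0..1}"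
proof -
  obtain N :: "('f, 'p, nat \<Rightarrow> 'u) mstruct" and j a where N: "metric_structure L N" "elementary_embedding L M N j"
    "a \<in> tuples N (length xs)" "p = phi_tp N j M \<phi> xs ys a"
    using assms(1) unfolding phi_types_def by blast
  have "p b = pval N \<phi> xs ys a (map j b)" using b by (simp add: N(4) phi_tp_def)
  then show ?thesis using pval_unit[OF N(1) \<phi> N(3) tuples_map[OF N(2) b]] by simp
qed

lemma topspace_phi_type_space:
  assumes M: "metric_structure L M"
  shows "topspace (phi_type_space L M \<phi> xs ys) = phi_types L M \<phi> xs ys"
proof -
  obtain b where b: "b \<in> tuples M (length ys)" using tuples_nonempty[OF M] by blast
  have "{q \<in> phi_types L M \<phi> xs ys. q b \<in> UNIV} \<in>
      {{q \<in> phi_types L M \<phi> xs ys. q b \<in> V} | b V. b \<in> tuples M (length ys) \<and> open V}"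
    using b open_UNIV by blast
  then show ?thesis unfolding phi_type_space_def topology_generated_by_topspace by auto
qed

text \<open>The ultrafilter that converges to p is the same for all points of the type space, because every
  type over M is realized by a tuple of Mstar; the two facts on tame families apply to it.\<close>

lemma definable_of_NIP:
  fixes U M Mstar :: "('f, 'p, 'u) mstruct"
  assumes L: "signature L" and T: "complete_theory TYPE('w) L T" and U: "monster_model L T \<kappa> U"
    and \<phi>: "partitioned_formula L \<phi> xs ys" and nip: "has_NIP U \<phi> xs ys"
    and M: "model_of L T M" "separable M" and sat: "saturated_elementary_extension L M Mstar"
    and p: "p \<in> phi_types L Mstar \<phi> xs ys" "approx_fin_satisfiable M Mstar \<phi> xs ys p"
  shows "Baire_half_definable L M Mstar \<phi> xs ys p"
proof -
  have ext: "elementary_extension L M Mstar" using sat unfolding saturated_elementary_extension_def by blast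
  note ext' = elementary_extensionD[OF ext]
  have MM: "metric_structure L M" using M(1) by (simp add: model_of_def)
  let ?X = "tuples M (length xs)" and ?Y = "tuples M (length ys)" and ?Y' = "tuples Mstar (length ys)"
  let ?S = "phi_types L M \<phi> ys xs"
  note tame = NIP_no_shattering[OF T U \<phi> nip M(1)]
  have elem: "pval Mstar \<phi> xs ys a b = pval M \<phi> xs ys a b" if "a \<in> ?X" "b \<in> ?Y" for a b
    using pval_elementary[OF MM ext'(2) \<phi> that] by simp
  obtain g :: "nat \<Rightarrow> 'u list" where g: "\<And>i. g i \<in> ?X"
    "\<And>a \<epsilon>. a \<in> ?X \<Longrightarrow> 0 < \<epsilon> \<Longrightarrow> \<exists>i. \<forall>b\<in>?Y'. \<bar>pval Mstar \<phi> xs ys a b - pval Mstar \<phi> xs ys (g i) b\<bar> < \<epsilon>"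
    using dense_tuples[OF L MM M(2) ext \<phi>] by blast
  obtain D :: "nat filter" where D: "ultrafilter D"
    and D_lim: "\<And>b. b \<in> ?Y' \<Longrightarrow> ((\<lambda>i. pval Mstar \<phi> xs ys (g i) b) \<longlongrightarrow> p b) D"
  proof -
    define \<S> where "\<S> = (\<lambda>(b, \<epsilon>). {i. \<bar>p b - pval Mstar \<phi> xs ys (g i) b\<bar> < \<epsilon>}) ` (?Y' \<times> {0<..})"
    have fip: "\<Inter>\<F> \<noteq> {}" if \<F>: "finite \<F>" "\<F> \<subseteq> \<S>" for \<F>
    proof -
      obtain C where C: "C \<subseteq> ?Y' \<times> {0<..}" "finite C" "\<F> = (\<lambda>(b, \<epsilon>). {i. \<bar>p b - pval Mstar \<phi> xs ys (g i) b\<bar> < \<epsilon>}) ` C"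
        using finite_subset_image[OF \<F>(1) \<F>(2)[unfolded \<S>_def]] by blast
      obtain \<epsilon> where \<epsilon>: "0 < \<epsilon>" "\<And>c. c \<in> C \<Longrightarrow> \<epsilon> \<le> snd c"
        by (rule finite_gap[OF C(2), of snd]) (use C(1) in auto)
      have fstC: "0 < \<epsilon> / 2" "finite (fst ` C)" "fst ` C \<subseteq> ?Y'" using C(1,2) \<epsilon>(1) by auto
      obtain a where a: "a \<in> ?X" "\<forall>b\<in>fst ` C. \<bar>p b - pval Mstar \<phi> xs ys a b\<bar> < \<epsilon> / 2"
        using approx_fin_satisfiableD[OF p(2) fstC] by blast
      obtain i where i: "\<forall>b\<in>?Y'. \<bar>pval Mstar \<phi> xs ys a b - pval Mstar \<phi> xs ys (g i) b\<bar> < \<epsilon> / 2"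
        using g(2)[OF a(1) fstC(1)] by blast
      have "\<bar>p (fst c) - pval Mstar \<phi> xs ys (g i) (fst c)\<bar> < snd c" if c: "c \<in> C" for c
      proof -
        have "\<bar>p (fst c) - pval Mstar \<phi> xs ys a (fst c)\<bar> < \<epsilon> / 2" using a(2) c by blast
        moreover have "fst c \<in> ?Y'" using C(1) c by auto
        then have "\<bar>pval Mstar \<phi> xs ys a (fst c) - pval Mstar \<phi> xs ys (g i) (fst c)\<bar> < \<epsilon> / 2" using i by blast
        ultimately show ?thesis using \<epsilon>(2)[OF c] by linarith
      qed
      then have "i \<in> \<Inter>\<F>" unfolding C(3) by (auto simp: split_def)
      then show ?thesis by blast
    qed
    obtain D where D: "ultrafilter D" "\<And>A. A \<in> \<S> \<Longrightarrow> eventually (\<lambda>x. x \<in> A) D"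
      using ultrafilter_containing[of \<S>, OF fip] by blast
    have "((\<lambda>i. pval Mstar \<phi> xs ys (g i) b) \<longlongrightarrow> p b) D" if b: "b \<in> ?Y'" for b
    proof (rule tendstoI)
      fix \<epsilon> :: real assume "0 < \<epsilon>"
      then have "{i. \<bar>p b - pval Mstar \<phi> xs ys (g i) b\<bar> < \<epsilon>} \<in> \<S>" unfolding \<S>_def using b by force
      from D(2)[OF this] show "\<forall>\<^sub>F i in D. dist (pval Mstar \<phi> xs ys (g i) b) (p b) < \<epsilon>"
        by (simp add: dist_real_def abs_minus_commute)
    qed
    with D(1) that show ?thesis by blast
  qed
  have "\<exists>m. \<not> shatters (\<lambda>i. pval M \<phi> xs ys (g i)) UNIV ?Y r s m" if rs: "r < s" for r s
  proof -
    obtain m where "\<not> shatters (pval M \<phi> xs ys) ?X ?Y r s m" using tame[OF rs] by blast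
    then have "\<not> shatters (\<lambda>i. pval M \<phi> xs ys (g i)) UNIV ?Y r s m"
      using shatters_reindex[of "pval M \<phi> xs ys" g UNIV ?Y r s m ?X] g(1) by auto
    then show ?thesis ..
  qed
  then obtain x where x: "\<And>h l. approximable (\<lambda>i. pval M \<phi> xs ys (g i)) ?Y h \<Longrightarrow> (h \<longlongrightarrow> l) D \<Longrightarrow> (\<lambda>n. h (x n)) \<longlonglongrightarrow> l"
    using convergent_sequence_of_no_shattering[OF D] by blast
  have lim: "(\<lambda>n. pval Mstar \<phi> xs ys (g (x n)) b) \<longlonglongrightarrow> p b" if b: "b \<in> ?Y'" for b
  proof (rule x[OF _ D_lim[OF b]])
    show "approximable (\<lambda>i. pval M \<phi> xs ys (g i)) ?Y (\<lambda>i. pval Mstar \<phi> xs ys (g i) b)"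
      unfolding approximable_def
    proof (intro allI impI)
      fix B :: "nat set" and \<epsilon> :: real assume B: "finite B \<and> 0 < \<epsilon>"
      have B': "finite (g ` B)" "g ` B \<subseteq> ?X" "0 < \<epsilon>" using B g(1) by auto
      obtain b' where b': "b' \<in> ?Y" "\<And>a. a \<in> g ` B \<Longrightarrow> \<bar>pval M \<phi> xs ys a b' - pval Mstar \<phi> xs ys (map id a) b\<bar> < \<epsilon>"
        using tuple_approx_in_submodel[OF MM ext'(1,2) \<phi> b B'] by blast
      then show "\<exists>y\<in>?Y. \<forall>i\<in>B. \<bar>pval Mstar \<phi> xs ys (g i) b - pval M \<phi> xs ys (g i) y\<bar> < \<epsilon>"
        by (intro bexI[OF _ b'(1)]) (simp add: abs_minus_commute)
    qed
  qed
  have "\<exists>b. b \<in> ?Y' \<and> phi_tp Mstar id M \<phi> ys xs b = q" if "q \<in> ?S" for q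
    using type_realized[OF MM sat \<phi> that] by blast
  then have "\<forall>q\<in>?S. \<exists>b. b \<in> ?Y' \<and> phi_tp Mstar id M \<phi> ys xs b = q" ..
  from bchoice[OF this] obtain \<beta> where
    \<beta>: "\<And>q. q \<in> ?S \<Longrightarrow> \<beta> q \<in> ?Y' \<and> phi_tp Mstar id M \<phi> ys xs (\<beta> q) = q" by blast
  have q_val: "q a = pval Mstar \<phi> xs ys a (\<beta> q)" if "q \<in> ?S" "a \<in> ?X" for q a
  proof -
    have "q a = phi_tp Mstar id M \<phi> ys xs (\<beta> q) a" using \<beta>[OF that(1)] by simp
    also have "\<dots> = pval Mstar \<phi> ys xs (\<beta> q) a" using that(2) by (simp add: phi_tp_def)
    also have "\<dots> = pval Mstar \<phi> xs ys a (\<beta> q)"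
      by (rule pval_swap[OF \<phi>]) (use that(2) \<beta>[OF that(1)] in \<open>auto simp: tuples_def\<close>)
    finally show ?thesis .
  qed
  define f where "f q = type_value M Mstar \<phi> xs ys p q" for q
  have f: "f q = p (\<beta> q)" if "q \<in> ?S" for q
    using type_value_eq[OF MM ext \<phi> p(2), of "\<beta> q"] \<beta>[OF that] by (simp add: f_def)
  let ?T = "phi_type_space L M \<phi> ys xs"
  have top: "topspace ?T = ?S" by (rule topspace_phi_type_space[OF MM])
  have open_T: "openin ?T {q \<in> ?S. q a \<in> V}" if "a \<in> ?X" "open V" for a V
    unfolding phi_type_space_def by (rule topology_generated_by_Basis) (use that in blast)
  have "Baire_half ?T f"
  proof (rule Baire_half_of_no_shattering[where I = ?X and \<Phi> = "\<lambda>a q. q a"])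
    show "openin ?T {q \<in> topspace ?T. q a < c}" if "a \<in> ?X" for a c
      using open_T[OF that, of "{..<c}"] by (simp add: top)
    show "openin ?T {q \<in> topspace ?T. c < q a}" if "a \<in> ?X" for a c
      using open_T[OF that, of "{c<..}"] by (simp add: top)
    show "f q \<in> {0..1}" if "q \<in> topspace ?T" for q
      using phi_type_unit[OF p(1) \<phi>] \<beta> f that by (simp add: top)
    show "\<exists>a\<in>?X. \<forall>q\<in>B. \<bar>f q - q a\<bar> < \<epsilon>" if B: "finite B" "B \<subseteq> topspace ?T" "0 < \<epsilon>" for B \<epsilon>
    proof -
      have \<beta>B: "finite (\<beta> ` B)" "\<beta> ` B \<subseteq> ?Y'" using B \<beta> by (auto simp: top)
      obtain a where a: "a \<in> ?X" "\<forall>b\<in>\<beta> ` B. \<bar>p b - pval Mstar \<phi> xs ys a b\<bar> < \<epsilon>"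
        using approx_fin_satisfiableD[OF p(2) B(3) \<beta>B] by blast
      have "\<bar>f q - q a\<bar> < \<epsilon>" if "q \<in> B" for q
      proof -
        have q: "q \<in> ?S" using that B(2) by (auto simp: top)
        show ?thesis using a(2) that f[OF q] q_val[OF q a(1)] by simp
      qed
      with a(1) show ?thesis by blast
    qed
    show "\<exists>m. \<not> shatters (\<lambda>a q. q a) ?X (topspace ?T) r s m" if rs: "r < s" for r s
    proof -
      define \<epsilon> where "\<epsilon> = (s - r) / 3"
      have \<epsilon>: "0 < \<epsilon>" "r + \<epsilon> < s - \<epsilon>" using rs by (auto simp: \<epsilon>_def field_simps)
      obtain m where m: "\<not> shatters (pval M \<phi> xs ys) ?X ?Y (r + \<epsilon>) (s - \<epsilon>) m" using tame[OF \<epsilon>(2)] by blast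
      have approx: "\<exists>b\<in>?Y. \<forall>a\<in>B. \<bar>pval M \<phi> xs ys a b - q a\<bar> < \<epsilon>" if q: "q \<in> topspace ?T" and B: "finite B" "B \<subseteq> ?X" for q B
      proof -
        have q': "q \<in> ?S" using q by (simp add: top)
        obtain b where "b \<in> ?Y" "\<And>a. a \<in> B \<Longrightarrow> \<bar>pval M \<phi> xs ys a b - pval Mstar \<phi> xs ys (map id a) (\<beta> q)\<bar> < \<epsilon>"
          using tuple_approx_in_submodel[OF MM ext'(1,2) \<phi> _ B \<epsilon>(1)] \<beta>[OF q'] by blast
        then show ?thesis using q_val[OF q'] B(2) by (intro bexI[of _ b]) auto
      qed
      have "\<not> shatters (\<lambda>a q. q a) ?X (topspace ?T) r s m"
      proof
        assume sh: "shatters (\<lambda>a q. q a) ?X (topspace ?T) r s m"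
        have "shatters (pval M \<phi> xs ys) ?X ?Y (r + \<epsilon>) (s - \<epsilon>) m"
          by (rule shatters_approx[OF sh \<epsilon>(1)]) (rule approx)
        with m show False by simp
      qed
      then show ?thesis ..
    qed
  qed
  moreover have "(\<lambda>n. q (g (x n))) \<longlonglongrightarrow> f q" if "q \<in> ?S" for q
    using lim[of "\<beta> q"] \<beta>[OF that] q_val[OF that g(1)] f[OF that] by simp
  ultimately show ?thesis
    unfolding Baire_half_definable_def using g(1) f_def by (intro exI[of _ "\<lambda>n. g (x n)"] exI[of _ f]) auto
qed

theorem theorem4p12:
  fixes L :: "('f, 'p) msig" and T :: "('f, 'p) fmla set"
    and \<kappa> :: "'k set" and U :: "('f, 'p, 'u) mstruct"
    and \<phi> :: "('f, 'p) fmla" and xs ys :: "nat list"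
  assumes "signature L" and "countable_signature L"
    and "complete_theory TYPE('u) L T"
    and "monster_model L T \<kappa> U"
    and "partitioned_formula L \<phi> xs ys"
  shows
    "(has_NIP U \<phi> xs ys \<longleftrightarrow>
       (\<forall>(M :: ('f, 'p, 'u) mstruct) Mstar p.
          model_of L T M \<and> separable M \<and> saturated_elementary_extension L M Mstar \<and>
          p \<in> phi_types L Mstar \<phi> xs ys \<and> approx_fin_satisfiable M Mstar \<phi> xs ys p \<longrightarrow>
          Baire_half_definable L M Mstar \<phi> xs ys p)) \<and>
     (has_NIP U \<phi> xs ys \<longleftrightarrow>
       (\<forall>(M :: ('f, 'p, 'u) mstruct) Mstar.
          model_of L T M \<and> separable M \<and> saturated_elementary_extension L M Mstar \<longrightarrow>
          {p \<in> phi_types L Mstar \<phi> xs ys. approx_fin_satisfiable M Mstar \<phi> xs ys p}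
            \<prec> (UNIV :: nat set set set)))"
    (is "(?nip \<longleftrightarrow> ?definable) \<and> (?nip \<longleftrightarrow> ?few)")
proof -
  have definable: ?definable if ?nip
  proof (intro allI impI)
    fix M Mstar :: "('f, 'p, 'u) mstruct" and p
    assume *: "model_of L T M \<and> separable M \<and> saturated_elementary_extension L M Mstar \<and>
      p \<in> phi_types L Mstar \<phi> xs ys \<and> approx_fin_satisfiable M Mstar \<phi> xs ys p"
    show "Baire_half_definable L M Mstar \<phi> xs ys p"
      by (rule definable_of_NIP[OF assms(1,3,4,5) that]) (use * in simp_all)
  qed
  have few: ?few if def: ?definable
  proof (intro allI impI)
    fix M Mstar :: "('f, 'p, 'u) mstruct"
    assume M: "model_of L T M \<and> separable M \<and> saturated_elementary_extension L M Mstar"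
    show "{p \<in> phi_types L Mstar \<phi> xs ys. approx_fin_satisfiable M Mstar \<phi> xs ys p} \<prec> (UNIV :: nat set set set)"
    proof (rule few_types_of_definable[OF assms(1) _ _ _ assms(5)])
      show "metric_structure L M" "separable M" "saturated_elementary_extension L M Mstar"
        using M by (simp_all add: model_of_def)
      show "Baire_half_definable L M Mstar \<phi> xs ys p"
        if "p \<in> phi_types L Mstar \<phi> xs ys" "approx_fin_satisfiable M Mstar \<phi> xs ys p" for p
        using def[rule_format, of M Mstar p] M that by simp
    qed
  qed
  have nip: ?nip if few: ?few
  proof (rule ccontr)
    assume "\<not> ?nip"
    then have ip: "has_IP U \<phi> xs ys" by (simp add: has_NIP_def)
    obtain M :: "('f, 'p, 'u) mstruct" where M: "model_of L T M" "separable M" "saturated_elementary_extension L M U"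
      "(UNIV :: nat set set set) \<lesssim> {p \<in> phi_types L U \<phi> xs ys. approx_fin_satisfiable M U \<phi> xs ys p}"
      by (rule many_types_of_IP[OF assms ip])
    have "{p \<in> phi_types L U \<phi> xs ys. approx_fin_satisfiable M U \<phi> xs ys p} \<prec> (UNIV :: nat set set set)"
      using few[rule_format, of M U] M(1-3) by simp
    with M(4) have "(UNIV :: nat set set set) \<prec> (UNIV :: nat set set set)" by (rule lesspoll_trans1)
    then show False by simp
  qed
  show ?thesis
  proof (intro conjI iffI)
    show ?definable ?few if ?nip by (rule definable[OF that], rule few[OF definable[OF that]])
    show ?nip if ?definable by (rule nip[OF few[OF that]])
    show ?nip if ?few by (rule nip[OF that])
  qed
qed

end
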